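(* Let $\mathfrak{g}$ be a finite-dimensional complex simple Lie algebra, let $\lambda\in\mathfrak{h}^*$, $l,k,c\in\mathbb{C}$, let $\mu\in\Lambda^+$ with $\mu\neq 0$, and let $a,b\in\mathbb{C}$ with $0\le \mathrm{Re}\,a<1$. Then $\mathrm{End}_{\mathfrak{L(g)}}\big(L_{\lambda,l,k,c}^{\mu,a,b}\big)\cong\mathbb{C}$.
   Context: All vector spaces are over $\mathbb{C}$; $\mathbb{N}$ denotes the positive integers, $\mathbb{Z}_+$ the nonnegative integers. $\mathfrak{g}$ is a finite-dimensional complex simple Lie algebra with Cartan subalgebra $\mathfrak{h}$, positive roots $\Delta_+$, triangular decomposition $\mathfrak{g}=\mathfrak{n}_-\oplus\mathfrak{h}\oplus\mathfrak{n}_+$, and invariant form $(\cdot\mid\cdot)$ (Killing form normalized so that $(\theta\mid\theta)=2$ for the highest root $\theta$). $\Lambda^+$ is the set of dominant integral weights of $\mathfrak{g}$. The affine-Virasoro algebra $\mathfrak{L(g)}=\bigoplus_{n\in\mathbb{Z}}\mathfrak{g}(n)\oplus\bigoplus_{n\in\mathbb{Z}}\mathbb{C}d_n\oplus\mathbb{C}\mathbf{k}\oplus\mathbb{C}\mathbf{c}$, where $\mathfrak{g}(n)=\{x(n):x\in\mathfrak{g}\}$ is a copy of $\mathfrak{g}$ ($x(n)=x\otimes t^n$, $x(0)$ identified with $x$), has brackets $[x(m),y(n)]=[x,y](m+n)+m(x\mid y)\delta_{m+n,0}\mathbf{k}$, $[d_m,d_n]=(n-m)d_{m+n}+\delta_{m+n,0}\frac{m^3-m}{12}\mathbf{c}$,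 $[d_n,x(m)]=m\,x(m+n)$, with $\mathbf{k},\mathbf{c}$ central. Put $\mathcal{H}=\mathfrak{h}+\mathbb{C}d_0+\mathbb{C}\mathbf{k}+\mathbb{C}\mathbf{c}$, $\mathfrak{L(g)}_+=\mathfrak{n}_+\oplus\bigoplus_{n\in\mathbb{N}}(\mathfrak{g}(n)\oplus\mathbb{C}d_n)$, $\mathfrak{L(g)}_-=\mathfrak{n}_-\oplus\bigoplus_{n\in\mathbb{N}}(\mathfrak{g}(-n)\oplus\mathbb{C}d_{-n})$. An element $P\in U(\mathfrak{L(g)})$ is homogeneous of degree $\deg(P)=m$ if $[d_0,P]=mP$. For $\lambda\in\mathfrak{h}^*$, $l,k,c\in\mathbb{C}$, the Verma module $M(\lambda,l,k,c)$ is induced from the one-dimensional $\mathcal{H}\oplus\mathfrak{L(g)}_+$-module $\mathbb{C}u$ with $hu=\lambda(h)u$ ($h\in\mathfrak{h}$), $d_0u=lu$, $\mathbf{k}u=ku$, $\mathbf{c}u=cu$, $\mathfrak{L(g)}_+u=0$. $L(\lambda,l,k,c)$ is its unique irreducible quotient, with highest weight vector $\bar u$ (the image of $u$). $L(\mu)$ is the finite-dimensional irreducible $\mathfrak{g}$-module with highest weight $\mu\in\Lambda^+$. For $a,b\in\mathbb{C}$, $L_{\lambda,l,k,c}^{\mu,a,b}$ is the vector space $L(\lambda,l,k,c)\otimes L(\mu)\otimes\mathbb{C}[t^{\pm1}]$ with $\mathfrak{L(g)}$-action $d_m(P\bar u\otimes v\otimes t^n)=\big((d_m+a+n-\deg(P)+bm)P\bar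 u\big)\otimes v\otimes t^{m+n}$, $x(m)(P\bar u\otimes v\otimes t^n)=\big(x(m)P\bar u\otimes v+P\bar u\otimes xv\big)\otimes t^{m+n}$, with $\mathbf{k},\mathbf{c}$ acting as the scalars $k,c$, for $x\in\mathfrak{g}$, $v\in L(\mu)$, $m,n\in\mathbb{Z}$ and homogeneous $P\in U(\mathfrak{L(g)}_-)$. This is an $\mathfrak{L(g)}$-module, isomorphic via $P\bar u\otimes v\otimes t^n\mapsto P\bar u\otimes v\otimes t^{n+\deg(P)}$ to the tensor product of $L(\lambda,l,k,c)$ with the loop module $L_{a,b}(\mu)=L(\mu)\otimes\mathbb{C}[t^{\pm1}]$, on which $d_m(v\otimes t^n)=(a+bm+n)v\otimes t^{m+n}$, $x(m)(v\otimes t^n)=(xv)\otimes t^{m+n}$, $\mathbf{k}=\mathbf{c}=0$. *)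

theory Defs
  imports
    Complex_Main
    "HOL-Library.Poly_Mapping"
    "HOL-Library.Product_Plus"
    "HOL-Library.Function_Algebras"
begin

section \<open>Complex vector spaces\<close>

class complex_vec = ab_group_add +
  fixes scaleC :: "complex \<Rightarrow> 'a \<Rightarrow> 'a"  (infixr \<open>*\<^sub>C\<close> 75)
  assumes scaleC_add_right: "c *\<^sub>C (x + y) = c *\<^sub>C x + c *\<^sub>C y"
    and scaleC_add_left: "(c + d) *\<^sub>C x = c *\<^sub>C x + d *\<^sub>C x"
    and scaleC_scaleC: "c *\<^sub>C d *\<^sub>C x = (c * d) *\<^sub>C x"
    and scaleC_one: "1 *\<^sub>C x = x"

global_interpretation cvec: vector_space "scaleC :: complex \<Rightarrow> 'a \<Rightarrow> 'a::complex_vec"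
  by unfold_locales (simp_all add: scaleC_add_right scaleC_add_left scaleC_scaleC scaleC_one)

abbreviation clinear :: "('a::complex_vec \<Rightarrow> 'b::complex_vec) \<Rightarrow> bool" where
  "clinear \<equiv> Vector_Spaces.linear scaleC scaleC"

definition cbilinear :: "('a::complex_vec \<Rightarrow> 'b::complex_vec \<Rightarrow> 'c::complex_vec) \<Rightarrow> bool" where
  "cbilinear f \<longleftrightarrow> (\<forall>x. clinear (f x)) \<and> (\<forall>y. clinear (\<lambda>x. f x y))"

instantiation complex :: complex_vec
begin
definition scaleC_complex :: "complex \<Rightarrow> complex \<Rightarrow> complex" where "scaleC_complex = (*)"
instance by standard (simp_all add: scaleC_complex_def algebra_simps)
end

instantiation prod :: (complex_vec, complex_vec) complex_vec
begin
definition scaleC_prod :: "complex \<Rightarrow> 'a \<times> 'b \<Rightarrow> 'a \<times> 'b" where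
  "scaleC_prod c p = (c *\<^sub>C fst p, c *\<^sub>C snd p)"
instance
  by standard (simp_all add: scaleC_prod_def scaleC_add_right scaleC_add_left scaleC_scaleC scaleC_one)
end

instantiation "fun" :: (type, complex_vec) complex_vec
begin
definition scaleC_fun :: "complex \<Rightarrow> ('a \<Rightarrow> 'b) \<Rightarrow> 'a \<Rightarrow> 'b" where
  "scaleC_fun c f = (\<lambda>x. c *\<^sub>C f x)"
instance
  by standard (simp_all add: fun_eq_iff scaleC_fun_def scaleC_add_right scaleC_add_left scaleC_scaleC scaleC_one)
end

instantiation poly_mapping :: (type, complex_vec) complex_vec
begin
definition scaleC_poly_mapping :: "complex \<Rightarrow> ('a \<Rightarrow>\<^sub>0 'b) \<Rightarrow> 'a \<Rightarrow>\<^sub>0 'b" where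
  "scaleC_poly_mapping c = Poly_Mapping.map (scaleC c)"

lemma lookup_scaleC: "Poly_Mapping.lookup (c *\<^sub>C p) k = c *\<^sub>C Poly_Mapping.lookup p k"
  unfolding scaleC_poly_mapping_def by (transfer, auto simp: when_def)

instance
  by standard
    (auto intro!: poly_mapping_eqI
      simp: lookup_scaleC lookup_add scaleC_add_right scaleC_add_left scaleC_scaleC scaleC_one)
end

definition finite_dimensional :: "'a::complex_vec itself \<Rightarrow> bool" where
  "finite_dimensional _ \<longleftrightarrow> (\<exists>B::'a set. finite B \<and> cvec.span B = UNIV)"

text \<open>The trace in the basis supplied by \<open>extend_basis\<close>; on a finite-dimensional space it does not
  depend on the basis.\<close>

definition endo_trace :: "('a::complex_vec \<Rightarrow> 'a) \<Rightarrow> complex" where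
  "endo_trace f = (\<Sum>b\<in>cvec.extend_basis {}. cvec.representation (cvec.extend_basis {}) (f b) b)"


section \<open>Tensor products\<close>

definition tensor_relations :: "('a::complex_vec \<times> 'b::complex_vec \<Rightarrow>\<^sub>0 complex) set" where
  "tensor_relations =
     {Poly_Mapping.single (x + y, z) 1 - Poly_Mapping.single (x, z) 1 - Poly_Mapping.single (y, z) 1 |x y z. True}
   \<union> {Poly_Mapping.single (x, y + z) 1 - Poly_Mapping.single (x, y) 1 - Poly_Mapping.single (x, z) 1 |x y z. True}
   \<union> {Poly_Mapping.single (c *\<^sub>C x, y) 1 - c *\<^sub>C Poly_Mapping.single (x, y) 1 |c x y. True}
   \<union> {Poly_Mapping.single (x, c *\<^sub>C y) 1 - c *\<^sub>C Poly_Mapping.single (x, y) 1 |c x y. True}"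

definition tensor_rel ::
  "('a::complex_vec \<times> 'b::complex_vec \<Rightarrow>\<^sub>0 complex) \<Rightarrow> ('a \<times> 'b \<Rightarrow>\<^sub>0 complex) \<Rightarrow> bool" where
  "tensor_rel p q \<longleftrightarrow> p - q \<in> cvec.span tensor_relations"

quotient_type (overloaded) ('a, 'b) tensor =
  "'a::complex_vec \<times> 'b::complex_vec \<Rightarrow>\<^sub>0 complex" / tensor_rel
proof (rule equivpI)
  show "reflp (tensor_rel :: ('a \<times> 'b \<Rightarrow>\<^sub>0 complex) \<Rightarrow> _)"
    by (simp add: reflp_def tensor_rel_def cvec.span_zero)
  show "symp (tensor_rel :: ('a \<times> 'b \<Rightarrow>\<^sub>0 complex) \<Rightarrow> _)"
    unfolding symp_def tensor_rel_def using cvec.span_neg by (metis minus_diff_eq)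
  show "transp (tensor_rel :: ('a \<times> 'b \<Rightarrow>\<^sub>0 complex) \<Rightarrow> _)"
    unfolding transp_def tensor_rel_def
  proof (intro allI impI)
    fix p q r :: "'a \<times> 'b \<Rightarrow>\<^sub>0 complex"
    assume "p - q \<in> cvec.span tensor_relations" "q - r \<in> cvec.span tensor_relations"
    from cvec.span_add[OF this] show "p - r \<in> cvec.span tensor_relations" by simp
  qed
qed

instantiation tensor :: (complex_vec, complex_vec) complex_vec
begin

lift_definition zero_tensor :: "('a, 'b) tensor" is 0 .

lift_definition plus_tensor :: "('a, 'b) tensor \<Rightarrow> ('a, 'b) tensor \<Rightarrow> ('a, 'b) tensor" is "(+)"
  unfolding tensor_rel_def by (metis add_diff_add cvec.span_add)

lift_definition minus_tensor :: "('a, 'b) tensor \<Rightarrow> ('a, 'b) tensor \<Rightarrow> ('a, 'b) tensor" is "(-)"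
  unfolding tensor_rel_def
proof -
  fix p p' q q' :: "'a \<times> 'b \<Rightarrow>\<^sub>0 complex"
  assume "p - p' \<in> cvec.span tensor_relations" "q - q' \<in> cvec.span tensor_relations"
  from cvec.span_diff[OF this] show "p - q - (p' - q') \<in> cvec.span tensor_relations"
    by (simp add: algebra_simps)
qed

lift_definition uminus_tensor :: "('a, 'b) tensor \<Rightarrow> ('a, 'b) tensor" is uminus
  unfolding tensor_rel_def by (metis minus_diff_minus cvec.span_neg)

lift_definition scaleC_tensor :: "complex \<Rightarrow> ('a, 'b) tensor \<Rightarrow> ('a, 'b) tensor" is scaleC
  unfolding tensor_rel_def by (metis cvec.scale_right_diff_distrib cvec.span_scale)

instance
  by standard
    (transfer, simp add: tensor_rel_def algebra_simps cvec.span_zero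
      scaleC_add_right scaleC_add_left scaleC_scaleC scaleC_one)+

end

lift_definition tens :: "'a::complex_vec \<Rightarrow> 'b::complex_vec \<Rightarrow> ('a, 'b) tensor"  (infixl \<open>\<otimes>\<^sub>C\<close> 70)
  is "\<lambda>x y. Poly_Mapping.single (x, y) 1" .


section \<open>Lie algebras and their modules\<close>

definition lie_algebra :: "('x::complex_vec \<Rightarrow> 'x \<Rightarrow> 'x) \<Rightarrow> bool" where
  "lie_algebra br \<longleftrightarrow> cbilinear br \<and> (\<forall>x. br x x = 0) \<and>
     (\<forall>x y z. br x (br y z) + br y (br z x) + br z (br x y) = 0)"

definition lie_module ::
  "('x::complex_vec \<Rightarrow> 'x \<Rightarrow> 'x) \<Rightarrow> ('x \<Rightarrow> 'v::complex_vec \<Rightarrow> 'v) \<Rightarrow> bool" where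
  "lie_module br \<rho> \<longleftrightarrow> cbilinear \<rho> \<and> (\<forall>x y v. \<rho> (br x y) v = \<rho> x (\<rho> y v) - \<rho> y (\<rho> x v))"

definition submodule :: "('x \<Rightarrow> 'v::complex_vec \<Rightarrow> 'v) \<Rightarrow> 'v set \<Rightarrow> bool" where
  "submodule \<rho> N \<longleftrightarrow> cvec.subspace N \<and> (\<forall>x. \<forall>v\<in>N. \<rho> x v \<in> N)"

definition irreducible_module ::
  "('x::complex_vec \<Rightarrow> 'x \<Rightarrow> 'x) \<Rightarrow> ('x \<Rightarrow> 'v::complex_vec \<Rightarrow> 'v) \<Rightarrow> bool" where
  "irreducible_module br \<rho> \<longleftrightarrow> lie_module br \<rho> \<and> (\<exists>v::'v. v \<noteq> 0) \<and>
     (\<forall>N. submodule \<rho> N \<longrightarrow> N = {0} \<or> N = UNIV)"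

definition module_hom_lie ::
  "('x \<Rightarrow> 'v::complex_vec \<Rightarrow> 'v) \<Rightarrow> ('x \<Rightarrow> 'w::complex_vec \<Rightarrow> 'w) \<Rightarrow> ('v \<Rightarrow> 'w) \<Rightarrow> bool" where
  "module_hom_lie \<rho> \<sigma> f \<longleftrightarrow> clinear f \<and> (\<forall>x v. f (\<rho> x v) = \<sigma> x (f v))"

definition module_End :: "('x \<Rightarrow> 'v::complex_vec \<Rightarrow> 'v) \<Rightarrow> ('v \<Rightarrow> 'v) set" where
  "module_End \<rho> = {f. module_hom_lie \<rho> \<rho> f}"

text \<open>A set of linear operators, regarded as a unital complex algebra under composition, is
  isomorphic to the complex numbers.\<close>

definition iso_complex_algebra :: "('v::complex_vec \<Rightarrow> 'v) set \<Rightarrow> bool" where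
  "iso_complex_algebra E \<longleftrightarrow> (\<exists>\<Phi>. bij_betw \<Phi> (UNIV :: complex set) E \<and>
     (\<forall>z w. \<Phi> (z + w) = \<Phi> z + \<Phi> w) \<and> (\<forall>z w. \<Phi> (z *\<^sub>C w) = z *\<^sub>C \<Phi> w) \<and>
     (\<forall>z w. \<Phi> (z * w) = \<Phi> z \<circ> \<Phi> w) \<and> \<Phi> 1 = id)"


section \<open>Simple Lie algebras, roots and weights\<close>

definition simple_lie_algebra :: "('g::complex_vec \<Rightarrow> 'g \<Rightarrow> 'g) \<Rightarrow> bool" where
  "simple_lie_algebra br \<longleftrightarrow> lie_algebra br \<and> (\<exists>x y. br x y \<noteq> 0) \<and>
     (\<forall>I. cvec.subspace I \<and> (\<forall>x. \<forall>y\<in>I. br x y \<in> I) \<longrightarrow> I = {0} \<or> I = UNIV)"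

primrec lower_central :: "('g::complex_vec \<Rightarrow> 'g \<Rightarrow> 'g) \<Rightarrow> 'g set \<Rightarrow> nat \<Rightarrow> 'g set" where
  "lower_central br h 0 = h"
| "lower_central br h (Suc n) = cvec.span {br x y |x y. x \<in> h \<and> y \<in> lower_central br h n}"

definition cartan_subalgebra :: "('g::complex_vec \<Rightarrow> 'g \<Rightarrow> 'g) \<Rightarrow> 'g set \<Rightarrow> bool" where
  "cartan_subalgebra br h \<longleftrightarrow> cvec.subspace h \<and> (\<forall>x\<in>h. \<forall>y\<in>h. br x y \<in> h) \<and>
     (\<exists>n. lower_central br h n = {0}) \<and> {x. \<forall>y\<in>h. br x y \<in> h} = h"

text \<open>A linear functional on the subspace \<open>h\<close> is represented by its extension by \<open>0\<close> outside \<open>h\<close>,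
  so that functionals on \<open>h\<close> are equal iff the representing functions are.\<close>

definition dual_space :: "'g::complex_vec set \<Rightarrow> ('g \<Rightarrow> complex) set" where
  "dual_space h = {f. (\<forall>x\<in>h. \<forall>y\<in>h. f (x + y) = f x + f y) \<and> (\<forall>c. \<forall>x\<in>h. f (c *\<^sub>C x) = c * f x) \<and>
     (\<forall>x. x \<notin> h \<longrightarrow> f x = 0)}"

definition root_space ::
  "('g::complex_vec \<Rightarrow> 'g \<Rightarrow> 'g) \<Rightarrow> 'g set \<Rightarrow> ('g \<Rightarrow> complex) \<Rightarrow> 'g set" where
  "root_space br h \<alpha> = {x. \<forall>y\<in>h. br y x = \<alpha> y *\<^sub>C x}"

definition roots :: "('g::complex_vec \<Rightarrow> 'g \<Rightarrow> 'g) \<Rightarrow> 'g set \<Rightarrow> ('g \<Rightarrow> complex) set" where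
  "roots br h = {\<alpha> \<in> dual_space h. \<alpha> \<noteq> 0 \<and> root_space br h \<alpha> \<noteq> {0}}"

definition nonneg_comb :: "('g \<Rightarrow> complex) set \<Rightarrow> ('g \<Rightarrow> complex) \<Rightarrow> bool" where
  "nonneg_comb S \<beta> \<longleftrightarrow> (\<exists>n :: ('g \<Rightarrow> complex) \<Rightarrow> nat. \<beta> = (\<Sum>\<alpha>\<in>S. of_nat (n \<alpha>) *\<^sub>C \<alpha>))"

definition root_base ::
  "('g::complex_vec \<Rightarrow> 'g \<Rightarrow> 'g) \<Rightarrow> 'g set \<Rightarrow> ('g \<Rightarrow> complex) set \<Rightarrow> bool" where
  "root_base br h S \<longleftrightarrow> finite S \<and> S \<subseteq> roots br h \<and>
     \<not> cvec.dependent S \<and> cvec.span S = dual_space h \<and>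
     (\<forall>\<beta>\<in>roots br h. nonneg_comb S \<beta> \<or> nonneg_comb S (- \<beta>))"

definition positive_roots ::
  "('g::complex_vec \<Rightarrow> 'g \<Rightarrow> 'g) \<Rightarrow> 'g set \<Rightarrow> ('g \<Rightarrow> complex) set \<Rightarrow> bool" where
  "positive_roots br h \<Delta>p \<longleftrightarrow>
     (\<exists>S. root_base br h S \<and> \<Delta>p = {\<beta> \<in> roots br h. nonneg_comb S \<beta>})"

definition highest_root ::
  "('g::complex_vec \<Rightarrow> 'g \<Rightarrow> 'g) \<Rightarrow> 'g set \<Rightarrow> ('g \<Rightarrow> complex) set \<Rightarrow> ('g \<Rightarrow> complex) \<Rightarrow> bool" where
  "highest_root br h \<Delta>p \<theta> \<longleftrightarrow>
     \<theta> \<in> roots br h \<and> (\<forall>\<beta>\<in>roots br h. nonneg_comb \<Delta>p (\<theta> - \<beta>))"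

definition killing_form :: "('g::complex_vec \<Rightarrow> 'g \<Rightarrow> 'g) \<Rightarrow> 'g \<Rightarrow> 'g \<Rightarrow> complex" where
  "killing_form br x y = endo_trace (\<lambda>z. br x (br y z))"

text \<open>The form on the dual of \<open>h\<close> induced by a form on \<open>h\<close>; \<open>riesz_vec frm h \<alpha>\<close> is the vector of \<open>h\<close>
  representing \<open>\<alpha>\<close>, which is well defined when the form is nondegenerate on \<open>h\<close>.\<close>

definition riesz_vec :: "('g \<Rightarrow> 'g \<Rightarrow> complex) \<Rightarrow> 'g set \<Rightarrow> ('g \<Rightarrow> complex) \<Rightarrow> 'g" where
  "riesz_vec frm h \<alpha> = (THE t. t \<in> h \<and> (\<forall>y\<in>h. frm t y = \<alpha> y))"

definition dual_form ::
  "('g \<Rightarrow> 'g \<Rightarrow> complex) \<Rightarrow> 'g set \<Rightarrow> ('g \<Rightarrow> complex) \<Rightarrow> ('g \<Rightarrow> complex) \<Rightarrow> complex" where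
  "dual_form frm h \<alpha> \<beta> = frm (riesz_vec frm h \<alpha>) (riesz_vec frm h \<beta>)"

definition normalized_form ::
  "('g::complex_vec \<Rightarrow> 'g \<Rightarrow> 'g) \<Rightarrow> 'g set \<Rightarrow> ('g \<Rightarrow> complex) set \<Rightarrow> ('g \<Rightarrow> 'g \<Rightarrow> complex) \<Rightarrow> bool" where
  "normalized_form br h \<Delta>p frm \<longleftrightarrow> (\<exists>s. \<forall>x y. frm x y = s * killing_form br x y) \<and>
     (\<exists>\<theta>. highest_root br h \<Delta>p \<theta> \<and> dual_form frm h \<theta> \<theta> = 2)"

definition dominant_integral ::
  "'g::complex_vec set \<Rightarrow> ('g \<Rightarrow> complex) set \<Rightarrow> ('g \<Rightarrow> 'g \<Rightarrow> complex) \<Rightarrow> ('g \<Rightarrow> complex) set" where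
  "dominant_integral h \<Delta>p frm = {\<mu> \<in> dual_space h.
     \<forall>\<alpha>\<in>\<Delta>p. \<exists>n::nat. 2 * dual_form frm h \<mu> \<alpha> / dual_form frm h \<alpha> \<alpha> = of_nat n}"

definition n_plus ::
  "('g::complex_vec \<Rightarrow> 'g \<Rightarrow> 'g) \<Rightarrow> 'g set \<Rightarrow> ('g \<Rightarrow> complex) set \<Rightarrow> 'g set" where
  "n_plus br h \<Delta>p = cvec.span (\<Union>\<alpha>\<in>\<Delta>p. root_space br h \<alpha>)"

definition n_minus ::
  "('g::complex_vec \<Rightarrow> 'g \<Rightarrow> 'g) \<Rightarrow> 'g set \<Rightarrow> ('g \<Rightarrow> complex) set \<Rightarrow> 'g set" where
  "n_minus br h \<Delta>p = cvec.span (\<Union>\<alpha>\<in>\<Delta>p. root_space br h (- \<alpha>))"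

definition fd_irreducible_hw_module ::
  "('g::complex_vec \<Rightarrow> 'g \<Rightarrow> 'g) \<Rightarrow> 'g set \<Rightarrow> ('g \<Rightarrow> complex) set \<Rightarrow> ('g \<Rightarrow> complex)
    \<Rightarrow> ('g \<Rightarrow> 'v::complex_vec \<Rightarrow> 'v) \<Rightarrow> bool" where
  "fd_irreducible_hw_module br h \<Delta>p \<mu> \<sigma> \<longleftrightarrow>
     finite_dimensional TYPE('v) \<and> irreducible_module br \<sigma> \<and>
     (\<exists>v. v \<noteq> 0 \<and> (\<forall>x\<in>h. \<sigma> x v = \<mu> x *\<^sub>C v) \<and> (\<forall>x\<in>n_plus br h \<Delta>p. \<sigma> x v = 0))"


section \<open>Universal enveloping algebras\<close>

text \<open>Lists form the free monoid, so \<open>'x list \<Rightarrow>\<^sub>0 complex\<close> with the convolution product is the free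
  unital associative algebra on the set \<open>'x\<close>.  The enveloping algebra of a Lie algebra on \<open>'x\<close> is its
  quotient by the ideal \<open>uea_ideal\<close>; elements of the enveloping algebra are handled through
  representatives in the free algebra.\<close>

instantiation list :: (type) monoid_add
begin
definition zero_list :: "'a list" where "zero_list = []"
definition plus_list :: "'a list \<Rightarrow> 'a list \<Rightarrow> 'a list" where "plus_list = (@)"
instance by standard (simp_all add: zero_list_def plus_list_def)
end

type_synonym 'x free_algebra = "'x list \<Rightarrow>\<^sub>0 complex"

definition gen :: "'x \<Rightarrow> 'x free_algebra" where
  "gen x = Poly_Mapping.single [x] 1"

definition scal :: "complex \<Rightarrow> 'x free_algebra" where
  "scal c = Poly_Mapping.single [] c"

inductive_set two_sided_ideal :: "'r::ring_1 set \<Rightarrow> 'r set" for R where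
  zero: "0 \<in> two_sided_ideal R"
| step: "r \<in> R \<Longrightarrow> q \<in> two_sided_ideal R \<Longrightarrow> x * r * y + q \<in> two_sided_ideal R"

inductive_set left_ideal :: "'r::ring_1 set \<Rightarrow> 'r set" for R where
  zero: "0 \<in> left_ideal R"
| step: "r \<in> R \<Longrightarrow> q \<in> left_ideal R \<Longrightarrow> x * r + q \<in> left_ideal R"

definition uea_ideal :: "('x::complex_vec \<Rightarrow> 'x \<Rightarrow> 'x) \<Rightarrow> 'x free_algebra set" where
  "uea_ideal br = two_sided_ideal
     ({gen (x + y) - gen x - gen y |x y. True}
    \<union> {gen (c *\<^sub>C x) - scal c * gen x |c x. True}
    \<union> {gen x * gen y - gen y * gen x - gen (br x y) |x y. True})"

definition uea_eq :: "('x::complex_vec \<Rightarrow> 'x \<Rightarrow> 'x) \<Rightarrow> 'x free_algebra \<Rightarrow> 'x free_algebra \<Rightarrow> bool" where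
  "uea_eq br P Q \<longleftrightarrow> P - Q \<in> uea_ideal br"

definition uea_act ::
  "('x \<Rightarrow> 'v::complex_vec \<Rightarrow> 'v) \<Rightarrow> 'x free_algebra \<Rightarrow> 'v \<Rightarrow> 'v" where
  "uea_act \<rho> P v = (\<Sum>xs\<in>Poly_Mapping.keys P. Poly_Mapping.lookup P xs *\<^sub>C foldr \<rho> xs v)"

definition uea_of :: "'x set \<Rightarrow> 'x free_algebra set" where
  "uea_of A = {P. Poly_Mapping.keys P \<subseteq> lists A}"


section \<open>The affine-Virasoro algebra\<close>

text \<open>A tuple \<open>(X, D, k, c)\<close> stands for
  \<open>\<Sum>\<^sub>n X\<^sub>n(n) + \<Sum>\<^sub>n D\<^sub>n d\<^sub>n + k\<close> times the level element \<open>+ c\<close> times the Virasoro central element.\<close>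

type_synonym 'g affvir = "(int \<Rightarrow>\<^sub>0 'g) \<times> (int \<Rightarrow>\<^sub>0 complex) \<times> complex \<times> complex"

definition loop_elt :: "'g \<Rightarrow> int \<Rightarrow> 'g::complex_vec affvir" where
  "loop_elt x n = (Poly_Mapping.single n x, 0, 0, 0)"

definition d_elt :: "int \<Rightarrow> 'g::complex_vec affvir" where
  "d_elt n = (0, Poly_Mapping.single n 1, 0, 0)"

definition k_elt :: "'g::complex_vec affvir" where
  "k_elt = (0, 0, 1, 0)"

definition c_elt :: "'g::complex_vec affvir" where
  "c_elt = (0, 0, 0, 1)"

text \<open>The bracket is the bilinear extension of the relations in \<open>affvir_bracket_relations\<close> below.\<close>

definition affvir_bracket ::
  "('g::complex_vec \<Rightarrow> 'g \<Rightarrow> 'g) \<Rightarrow> ('g \<Rightarrow> 'g \<Rightarrow> complex) \<Rightarrow> 'g affvir \<Rightarrow> 'g affvir \<Rightarrow> 'g affvir" where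
  "affvir_bracket br frm = (\<lambda>(X, D, _, _) (Y, E, _, _).
     let x = Poly_Mapping.lookup X; y = Poly_Mapping.lookup Y;
         d = Poly_Mapping.lookup D; e = Poly_Mapping.lookup E
     in ((\<Sum>m\<in>Poly_Mapping.keys X. \<Sum>n\<in>Poly_Mapping.keys Y. Poly_Mapping.single (m + n) (br (x m) (y n)))
          + (\<Sum>n\<in>Poly_Mapping.keys D. \<Sum>m\<in>Poly_Mapping.keys Y.
               Poly_Mapping.single (m + n) ((of_int m * d n) *\<^sub>C y m))
          - (\<Sum>n\<in>Poly_Mapping.keys E. \<Sum>m\<in>Poly_Mapping.keys X.
               Poly_Mapping.single (m + n) ((of_int m * e n) *\<^sub>C x m)),
         (\<Sum>m\<in>Poly_Mapping.keys D. \<Sum>n\<in>Poly_Mapping.keys E.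
               Poly_Mapping.single (m + n) (of_int (n - m) * d m * e n)),
         (\<Sum>m\<in>Poly_Mapping.keys X. of_int m * frm (x m) (y (- m))),
         (\<Sum>m\<in>Poly_Mapping.keys D. of_int (m ^ 3 - m) / 12 * d m * e (- m))))"

lemma scaleC_single: "c *\<^sub>C Poly_Mapping.single n x = Poly_Mapping.single n (c *\<^sub>C x)"
  by (rule poly_mapping_eqI) (simp add: lookup_scaleC lookup_single when_def)

lemma affvir_bracket_relations:
  fixes br :: "'g::complex_vec \<Rightarrow> 'g \<Rightarrow> 'g" and frm :: "'g \<Rightarrow> 'g \<Rightarrow> complex"
  assumes br: "cbilinear br" and frm: "cbilinear frm"
  shows "affvir_bracket br frm (loop_elt x m) (loop_elt y n)
           = loop_elt (br x y) (m + n) + (if m + n = 0 then (of_int m * frm x y) *\<^sub>C k_elt else 0)"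
    and "affvir_bracket br frm (d_elt m) (d_elt n)
           = of_int (n - m) *\<^sub>C d_elt (m + n)
             + (if m + n = 0 then (of_int (m ^ 3 - m) / 12) *\<^sub>C c_elt else 0)"
    and "affvir_bracket br frm (d_elt n) (loop_elt x m) = of_int m *\<^sub>C loop_elt x (m + n)"
    and "affvir_bracket br frm (loop_elt x m) (d_elt n) = - of_int m *\<^sub>C loop_elt x (m + n)"
    and "affvir_bracket br frm k_elt Z = 0" and "affvir_bracket br frm Z k_elt = 0"
    and "affvir_bracket br frm c_elt Z = 0" and "affvir_bracket br frm Z c_elt = 0"
proof -
  have br0: "br x 0 = 0" "br 0 x = 0" and frm0: "frm x 0 = 0" "frm 0 x = 0" for x
    using br frm Vector_Spaces.linear.axioms(3)[THEN module_hom.zero]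
    unfolding cbilinear_def by blast+
  note defs = affvir_bracket_def loop_elt_def d_elt_def k_elt_def c_elt_def scaleC_prod_def
    scaleC_single scaleC_complex_def Let_def
  show "affvir_bracket br frm (loop_elt x m) (loop_elt y n)
           = loop_elt (br x y) (m + n) + (if m + n = 0 then (of_int m * frm x y) *\<^sub>C k_elt else 0)"
    by (cases "x = 0"; cases "y = 0") (auto simp: defs br0 frm0 lookup_single when_def zero_prod_def)
  show "affvir_bracket br frm (d_elt m) (d_elt n)
           = of_int (n - m) *\<^sub>C d_elt (m + n)
             + (if m + n = 0 then (of_int (m ^ 3 - m) / 12) *\<^sub>C c_elt else 0)"
    by (auto simp: defs lookup_single when_def zero_prod_def)
  show "affvir_bracket br frm (d_elt n) (loop_elt x m) = of_int m *\<^sub>C loop_elt x (m + n)"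
    by (cases "x = 0") (auto simp: defs)
  show "affvir_bracket br frm (loop_elt x m) (d_elt n) = - of_int m *\<^sub>C loop_elt x (m + n)"
    by (cases "x = 0") (auto simp: defs single_uminus frm0)
  show "affvir_bracket br frm k_elt Z = 0" "affvir_bracket br frm c_elt Z = 0"
    by (cases Z; simp add: defs zero_prod_def)+
  show "affvir_bracket br frm Z k_elt = 0" "affvir_bracket br frm Z c_elt = 0"
    by (cases Z; simp add: defs zero_prod_def frm0)+
qed

definition affvir_plus ::
  "('g::complex_vec \<Rightarrow> 'g \<Rightarrow> 'g) \<Rightarrow> 'g set \<Rightarrow> ('g \<Rightarrow> complex) set \<Rightarrow> 'g affvir set" where
  "affvir_plus br h \<Delta>p = cvec.span
     ({loop_elt x 0 |x. x \<in> n_plus br h \<Delta>p} \<union> {loop_elt x n |x n. n > 0} \<union> {d_elt n |n. n > 0})"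

definition affvir_minus ::
  "('g::complex_vec \<Rightarrow> 'g \<Rightarrow> 'g) \<Rightarrow> 'g set \<Rightarrow> ('g \<Rightarrow> complex) set \<Rightarrow> 'g affvir set" where
  "affvir_minus br h \<Delta>p = cvec.span
     ({loop_elt x 0 |x. x \<in> n_minus br h \<Delta>p} \<union> {loop_elt x (- n) |x n. n > 0} \<union> {d_elt (- n) |n. n > 0})"

definition homogeneous ::
  "('g::complex_vec \<Rightarrow> 'g \<Rightarrow> 'g) \<Rightarrow> ('g \<Rightarrow> 'g \<Rightarrow> complex) \<Rightarrow> int \<Rightarrow> 'g affvir free_algebra \<Rightarrow> bool" where
  "homogeneous br frm m P \<longleftrightarrow>
     uea_eq (affvir_bracket br frm) (gen (d_elt 0) * P - P * gen (d_elt 0)) (scal (of_int m) * P)"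


section \<open>Verma modules and their irreducible quotients\<close>

text \<open>The kernel of the map from the free algebra onto the module induced from the one-dimensional module
  \<open>\<complex>u\<close>: it is generated, over the defining ideal of the enveloping algebra, by the
  relations that the elements of the inducing subalgebra satisfy on \<open>u\<close>.\<close>

definition verma_ideal ::
  "('g::complex_vec \<Rightarrow> 'g \<Rightarrow> 'g) \<Rightarrow> ('g \<Rightarrow> 'g \<Rightarrow> complex) \<Rightarrow> 'g set \<Rightarrow> ('g \<Rightarrow> complex) set
    \<Rightarrow> ('g \<Rightarrow> complex) \<Rightarrow> complex \<Rightarrow> complex \<Rightarrow> complex \<Rightarrow> 'g affvir free_algebra set" where
  "verma_ideal br frm h \<Delta>p lam l k c = left_ideal
     (uea_ideal (affvir_bracket br frm)
      \<union> {gen (loop_elt x 0) - scal (lam x) |x. x \<in> h}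
      \<union> {gen (d_elt 0) - scal l, gen k_elt - scal k, gen c_elt - scal c}
      \<union> gen ` affvir_plus br h \<Delta>p)"

text \<open>\<open>(M, \<rho>)\<close> with the vector \<open>u\<close> is the Verma module: \<open>P \<mapsto> P u\<close> identifies \<open>M\<close> with the enveloping algebra
  tensored over that of the inducing subalgebra with \<open>\<complex>u\<close>.\<close>

definition verma_module ::
  "('g::complex_vec \<Rightarrow> 'g \<Rightarrow> 'g) \<Rightarrow> ('g \<Rightarrow> 'g \<Rightarrow> complex) \<Rightarrow> 'g set \<Rightarrow> ('g \<Rightarrow> complex) set
    \<Rightarrow> ('g \<Rightarrow> complex) \<Rightarrow> complex \<Rightarrow> complex \<Rightarrow> complex
    \<Rightarrow> ('g affvir \<Rightarrow> 'm::complex_vec \<Rightarrow> 'm) \<Rightarrow> 'm \<Rightarrow> bool" where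
  "verma_module br frm h \<Delta>p lam l k c \<rho> u \<longleftrightarrow>
     lie_module (affvir_bracket br frm) \<rho> \<and>
     (\<forall>v. \<exists>P. v = uea_act \<rho> P u) \<and>
     {P. uea_act \<rho> P u = 0} = verma_ideal br frm h \<Delta>p lam l k c"

definition irreducible_quotient ::
  "('x::complex_vec \<Rightarrow> 'x \<Rightarrow> 'x) \<Rightarrow> ('x \<Rightarrow> 'm::complex_vec \<Rightarrow> 'm) \<Rightarrow> ('x \<Rightarrow> 'w::complex_vec \<Rightarrow> 'w)
    \<Rightarrow> ('m \<Rightarrow> 'w) \<Rightarrow> bool" where
  "irreducible_quotient br \<rho>M \<rho>L \<pi> \<longleftrightarrow>
     irreducible_module br \<rho>L \<and> module_hom_lie \<rho>M \<rho>L \<pi> \<and> surj \<pi>"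


section \<open>The tensor product modules\<close>

type_synonym laurent = "int \<Rightarrow>\<^sub>0 complex"

abbreviation t_pow :: "int \<Rightarrow> laurent" where
  "t_pow n \<equiv> Poly_Mapping.single n 1"

text \<open>\<open>\<tau>\<close> is the action on \<open>L(\<lambda>,l,k,c) \<otimes> L(\<mu>) \<otimes> \<complex>[t,t\<^sup>-\<^sup>1]\<close>, where \<open>\<rho>\<close> and \<open>\<sigma>\<close> are the actions on
  the first two factors and \<open>ub\<close> is the highest weight vector of the first.  The vectors on which
  \<open>\<tau>\<close> is prescribed span the space, so \<open>\<tau>\<close> is unique.\<close>

definition tensor_module_action ::
  "('g::complex_vec \<Rightarrow> 'g \<Rightarrow> 'g) \<Rightarrow> ('g \<Rightarrow> 'g \<Rightarrow> complex) \<Rightarrow> 'g set \<Rightarrow> ('g \<Rightarrow> complex) set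
    \<Rightarrow> complex \<Rightarrow> complex \<Rightarrow> ('g affvir \<Rightarrow> 'w::complex_vec \<Rightarrow> 'w) \<Rightarrow> 'w \<Rightarrow> ('g \<Rightarrow> 'v::complex_vec \<Rightarrow> 'v)
    \<Rightarrow> complex \<Rightarrow> complex \<Rightarrow> ('g affvir \<Rightarrow> (('w, 'v) tensor, laurent) tensor \<Rightarrow> (('w, 'v) tensor, laurent) tensor)
    \<Rightarrow> bool" where
  "tensor_module_action br frm h \<Delta>p k c \<rho> ub \<sigma> a b \<tau> \<longleftrightarrow>
     cbilinear \<tau> \<and>
     (\<forall>P deg v m n. P \<in> uea_of (affvir_minus br h \<Delta>p) \<and> homogeneous br frm deg P \<longrightarrow>
        (let w = uea_act \<rho> P ub in
           \<tau> (d_elt m) (w \<otimes>\<^sub>C v \<otimes>\<^sub>C t_pow n)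
             = (\<rho> (d_elt m) w + (a + of_int n - of_int deg + b * of_int m) *\<^sub>C w) \<otimes>\<^sub>C v \<otimes>\<^sub>C t_pow (m + n) \<and>
           (\<forall>x. \<tau> (loop_elt x m) (w \<otimes>\<^sub>C v \<otimes>\<^sub>C t_pow n)
             = (\<rho> (loop_elt x m) w \<otimes>\<^sub>C v + w \<otimes>\<^sub>C \<sigma> x v) \<otimes>\<^sub>C t_pow (m + n)))) \<and>
     (\<forall>T. \<tau> k_elt T = k *\<^sub>C T) \<and> (\<forall>T. \<tau> c_elt T = c *\<^sub>C T)"

end

theory Submission
  imports Defs "HOL-Computational_Algebra.Fundamental_Theorem_Algebra"
begin

text \<open>
  Write \<open>W\<close> for the irreducible highest weight module \<open>L(\<lambda>,l,k,c)\<close> and \<open>V\<close> for \<open>L(\<mu>)\<close>, and let \<open>f\<close> be an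
  endomorphism of the tensor product.  The idea is that a mode \<open>x(p)\<close> of large degree kills any given
  vector of \<open>W\<close> (\<open>eventually_annihilated\<close>), so on any given tensor it acts as \<open>x\<close> on \<open>V\<close> together with a
  shift of the power of \<open>t\<close>.  Commuting with these modes makes \<open>f\<close> look like a \<open>\<gg>\<close>-endomorphism of \<open>V\<close>.

  In detail, \<open>d\<^sub>0\<close> acts on \<open>W \<otimes> V \<otimes> t\<^sup>n\<close> as the scalar \<open>l + a + n\<close>, so \<open>f\<close> preserves \<open>n\<close>.  Fix \<open>w \<in> W\<close> and
  a coordinate functional on \<open>W\<close>; contracting \<open>f (w \<otimes> v \<otimes> t\<^sup>n)\<close> with it gives linear maps \<open>F\<^sub>n\<close> of \<open>V\<close>
  with \<open>F\<^sub>n\<^sub>+\<^sub>p (x v) = x (F\<^sub>n v)\<close> for large \<open>p\<close>.  As \<open>V\<close> is irreducible and nontrivial, \<open>\<gg>V = V\<close>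
  and \<open>V\<close> has no invariants; with Schur's lemma on \<open>V\<close> this forces all \<open>F\<^sub>n\<close> to be one and the same scalar
  (\<open>asymptotic_intertwiner_scalar\<close>).  Hence \<open>f (w \<otimes> v \<otimes> t\<^sup>n) = G w \<otimes> v \<otimes> t\<^sup>n\<close> for a linear map \<open>G\<close> of
  \<open>W\<close>, which turns out to commute with the whole algebra.  The highest weight space of \<open>W\<close> is a line, so
  \<open>G\<close>, and with it \<open>f\<close>, is a scalar (\<open>schur\<close>, \<open>endomorphism_scalar\<close>).

  The action on the tensor product is prescribed on vectors whose first factor is obtained from the
  highest weight vector by a homogeneous element of \<open>U(L\<^sub>-)\<close>.  That these vectors span
  (\<open>monomials_span\<close>), and that the highest weight space is a line, rests on the triangular decomposition
  of \<open>\<gg>\<close> (\<open>triangular_decomposition\<close>) for a Cartan subalgebra that is only known to be nilpotent and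
  self-normalizing.  The normalization of the form makes the Killing form nonzero, hence nondegenerate
  by simplicity, and so derivations are inner.  For \<open>x \<in> h\<close> the semisimple part of \<open>ad x\<close> is a derivation,
  thus equal to \<open>ad z\<close>, and \<open>z \<in> h\<close>; every simple root takes the same value at \<open>x\<close> and \<open>z\<close>, and simple roots
  separate the points of \<open>h\<close>, so \<open>ad x\<close> is diagonalizable (\<open>ad_semisimple\<close>).
\<close>


section \<open>Linear maps\<close>

lemma clinear_iff:
  "clinear f \<longleftrightarrow> (\<forall>x y. f (x + y) = f x + f y) \<and> (\<forall>c x. f (c *\<^sub>C x) = c *\<^sub>C f x)"
  by (auto simp: Vector_Spaces.linear_def module_hom_def module_hom_axioms_def
      cvec.vector_space_axioms cvec.module_axioms)

lemma clinearI:
  assumes "\<And>x y. f (x + y) = f x + f y" and "\<And>c x. f (c *\<^sub>C x) = c *\<^sub>C f x"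
  shows "clinear f"
  using assms by (simp add: clinear_iff)

lemma clinear_add: "clinear f \<Longrightarrow> f (x + y) = f x + f y"
  and clinear_scale: "clinear f \<Longrightarrow> f (c *\<^sub>C x) = c *\<^sub>C f x"
  by (simp_all add: clinear_iff)

lemma clinear_zero: "clinear f \<Longrightarrow> f 0 = 0"
  by (metis add_cancel_right_left clinear_add)

lemma clinear_minus: "clinear f \<Longrightarrow> f (- x) = - f x"
  by (metis add_eq_0_iff clinear_add clinear_zero)

lemma clinear_diff: "clinear f \<Longrightarrow> f (x - y) = f x - f y"
  by (metis clinear_add clinear_minus uminus_add_conv_diff add.commute)

lemma clinear_sum: "clinear f \<Longrightarrow> f (sum g A) = (\<Sum>i\<in>A. f (g i))"
  by (induction A rule: infinite_finite_induct) (simp_all add: clinear_zero clinear_add)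

lemmas clinear_simps = clinear_add clinear_scale clinear_zero clinear_minus clinear_diff clinear_sum

lemma clinear_compose: "clinear f \<Longrightarrow> clinear g \<Longrightarrow> clinear (\<lambda>x. f (g x))"
  by (simp add: clinear_iff)

lemma clinear_plus: "clinear f \<Longrightarrow> clinear g \<Longrightarrow> clinear (\<lambda>x. f x + g x)"
  by (simp add: clinear_iff algebra_simps scaleC_add_right)

lemma clinear_scaled: "clinear f \<Longrightarrow> clinear (\<lambda>x. c *\<^sub>C f x)"
  by (simp add: clinear_iff scaleC_add_right scaleC_scaleC mult.commute)

lemma clinear_sub: "clinear f \<Longrightarrow> clinear g \<Longrightarrow> clinear (\<lambda>x. f x - g x)"
  by (simp add: clinear_iff algebra_simps cvec.scale_right_diff_distrib)

lemma clinear_ident: "clinear (\<lambda>x. x)"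
  by (simp add: clinear_iff)

lemma clinear_const_zero: "clinear (\<lambda>x. 0)"
  by (simp add: clinear_iff)

lemma clinear_scale_left: "clinear (\<lambda>c. c *\<^sub>C x)"
  by (simp add: clinear_iff scaleC_add_left scaleC_scaleC scaleC_complex_def)

lemma clinear_sum_of: "(\<And>i. i \<in> A \<Longrightarrow> clinear (f i)) \<Longrightarrow> clinear (\<lambda>x. \<Sum>i\<in>A. f i x)"
  by (induction A rule: infinite_finite_induct)
    (auto intro: clinear_const_zero clinear_plus)

lemma clinear_funpow: "clinear (f :: 'a::complex_vec \<Rightarrow> 'a) \<Longrightarrow> clinear (f ^^ n)"
  by (induction n) (simp_all add: clinear_iff)



lemma clinear_eq_on_span:
  assumes "clinear f" "clinear g" "\<And>x. x \<in> X \<Longrightarrow> f x = g x" "v \<in> cvec.span X"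
  shows "f v = g v"
  using assms(4)
  by (induction rule: cvec.span_induct_alt) (simp_all add: clinear_simps assms)

lemma clinear_span_image:
  assumes "clinear f" "cvec.subspace N" "\<And>x. x \<in> X \<Longrightarrow> f x \<in> N" "v \<in> cvec.span X"
  shows "f v \<in> N"
  using assms(4)
  by (induction rule: cvec.span_induct_alt)
    (simp_all add: clinear_simps assms cvec.subspace_0 cvec.subspace_add cvec.subspace_scale)

lemma cbilinearI:
  assumes "\<And>x. clinear (f x)" and "\<And>y. clinear (\<lambda>x. f x y)"
  shows "cbilinear f"
  using assms by (simp add: cbilinear_def)

lemma cbilinear_right: "cbilinear f \<Longrightarrow> clinear (f x)"
  and cbilinear_left: "cbilinear f \<Longrightarrow> clinear (\<lambda>x. f x y)"
  by (simp_all add: cbilinear_def)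

lemma cbilinear_simps:
  assumes "cbilinear f"
  shows "f (x + x') y = f x y + f x' y" "f x (y + y') = f x y + f x y'"
    "f (c *\<^sub>C x) y = c *\<^sub>C f x y" "f x (c *\<^sub>C y) = c *\<^sub>C f x y"
    "f 0 y = 0" "f x 0 = 0" "f (- x) y = - f x y" "f x (- y) = - f x y"
    "f (x - x') y = f x y - f x' y" "f x (y - y') = f x y - f x y'"
  using clinear_simps(1-5)[OF cbilinear_left[OF assms]] clinear_simps(1-5)[OF cbilinear_right[OF assms]]
  by auto

lemma subspace_eq_of_clinear:
  assumes "clinear f" "clinear g"
  shows "cvec.subspace {v. f v = g v}"
  by (rule cvec.subspaceI) (simp_all add: clinear_simps[OF assms(1)] clinear_simps[OF assms(2)])


section \<open>Finitely supported families\<close>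

text \<open>The map out of a direct sum with the given restrictions to the summands.  With scalar
  coefficients it is the linear extension of a map from a basis, which is how tensor products use it;
  with vector coefficients it recombines the components of a vector.\<close>

definition family_lift :: "('i \<Rightarrow> 'a \<Rightarrow> 'b) \<Rightarrow> ('i \<Rightarrow>\<^sub>0 'a::complex_vec) \<Rightarrow> 'b::complex_vec" where
  "family_lift g u = (\<Sum>i\<in>Poly_Mapping.keys u. g i (Poly_Mapping.lookup u i))"

lemma family_lift_superset:
  assumes "\<And>i. g i 0 = 0" "finite K" "Poly_Mapping.keys u \<subseteq> K"
  shows "family_lift g u = (\<Sum>i\<in>K. g i (Poly_Mapping.lookup u i))"
  unfolding family_lift_def
  by (rule sum.mono_neutral_left) (use assms in \<open>auto simp: in_keys_iff\<close>)

lemma clinear_family_lift: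
  assumes "\<And>i. clinear (g i)"
  shows "clinear (family_lift g)"
proof (rule clinearI)
  have g0: "g i 0 = 0" for i using clinear_zero[OF assms] .
  fix u v :: "'a \<Rightarrow>\<^sub>0 'b"
  let ?K = "Poly_Mapping.keys u \<union> Poly_Mapping.keys v"
  have "family_lift g (u + v) = (\<Sum>i\<in>?K. g i (Poly_Mapping.lookup (u + v) i))"
    by (rule family_lift_superset) (use g0 Poly_Mapping.keys_add[of u v] in auto)
  also have "\<dots> = (\<Sum>i\<in>?K. g i (Poly_Mapping.lookup u i)) + (\<Sum>i\<in>?K. g i (Poly_Mapping.lookup v i))"
    by (simp add: lookup_add clinear_add[OF assms] sum.distrib)
  also have "\<dots> = family_lift g u + family_lift g v"
    using family_lift_superset[of g ?K u] family_lift_superset[of g ?K v] g0 by simp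
  finally show "family_lift g (u + v) = family_lift g u + family_lift g v" .
next
  have g0: "g i 0 = 0" for i using clinear_zero[OF assms] .
  fix c and u :: "'a \<Rightarrow>\<^sub>0 'b"
  have "family_lift g (c *\<^sub>C u) = (\<Sum>i\<in>Poly_Mapping.keys u. g i (Poly_Mapping.lookup (c *\<^sub>C u) i))"
    by (rule family_lift_superset) (use g0 in \<open>auto simp: in_keys_iff lookup_scaleC\<close>)
  also have "\<dots> = c *\<^sub>C family_lift g u"
    by (simp add: family_lift_def lookup_scaleC clinear_scale[OF assms] cvec.scale_sum_right)
  finally show "family_lift g (c *\<^sub>C u) = c *\<^sub>C family_lift g u" .
qed

lemma family_lift_single: "g i 0 = 0 \<Longrightarrow> family_lift g (Poly_Mapping.single i x) = g i x"
  by (cases "x = 0") (simp_all add: family_lift_def)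

lemma family_as_sum: "u = (\<Sum>i\<in>Poly_Mapping.keys u. Poly_Mapping.single i (Poly_Mapping.lookup u i))"
proof (rule poly_mapping_eqI)
  fix k
  show "Poly_Mapping.lookup u k
    = Poly_Mapping.lookup (\<Sum>i\<in>Poly_Mapping.keys u. Poly_Mapping.single i (Poly_Mapping.lookup u i)) k"
    by (auto simp: lookup_sum lookup_single when_def sum.delta' in_keys_iff)
qed

lemma lookup_clinear: "clinear (\<lambda>u. Poly_Mapping.lookup u i)"
  by (rule clinearI) (simp_all add: lookup_add lookup_scaleC)



abbreviation family_sum :: "('i \<Rightarrow>\<^sub>0 'a::complex_vec) \<Rightarrow> 'a" where
  "family_sum \<equiv> family_lift (\<lambda>_ x. x)"

lemma clinear_family_sum: "clinear family_sum"
  by (rule clinear_family_lift) (rule clinear_ident)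

lemma family_map:
  assumes "\<And>i. g i 0 = 0"
  shows "\<exists>u'. (\<forall>i. Poly_Mapping.lookup u' i = g i (Poly_Mapping.lookup u i)) \<and> family_sum u' = family_lift g u"
proof (intro exI conjI allI)
  define u' where "u' = Abs_poly_mapping (\<lambda>i. g i (Poly_Mapping.lookup u i))"
  have "finite {i. g i (Poly_Mapping.lookup u i) \<noteq> 0}"
    by (rule finite_subset[of _ "Poly_Mapping.keys u"]) (auto simp: in_keys_iff assms)
  then show *: "Poly_Mapping.lookup u' i = g i (Poly_Mapping.lookup u i)" for i
    by (simp add: u'_def)
  have "Poly_Mapping.keys u' \<subseteq> Poly_Mapping.keys u"
    by (auto simp: in_keys_iff * assms)
  then show "family_sum u' = family_lift g u"
    using family_lift_superset[of "\<lambda>_ x. x" "Poly_Mapping.keys u" u'] *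
    by (simp add: family_lift_def)
qed

lemma in_span_Union_imp_family_sum:
  assumes "\<And>i. cvec.subspace (G i)" "v \<in> cvec.span (\<Union>i. G i)"
  shows "\<exists>u. (\<forall>i. Poly_Mapping.lookup u i \<in> G i) \<and> family_sum u = v"
  using assms(2)
proof (induction rule: cvec.span_induct_alt)
  case base
  show ?case
    by (rule exI[of _ 0]) (simp add: cvec.subspace_0[OF assms(1)] clinear_zero[OF clinear_family_sum])
next
  case (step c x y)
  then obtain i u where i: "x \<in> G i" and u: "\<forall>i. Poly_Mapping.lookup u i \<in> G i" "family_sum u = y"
    by blast
  show ?case
  proof (intro exI conjI allI)
    fix j
    show "Poly_Mapping.lookup (Poly_Mapping.single i (c *\<^sub>C x) + u) j \<in> G j"
      using u(1) i
      by (auto simp: lookup_add lookup_single when_def cvec.subspace_0[OF assms(1)]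
          intro!: cvec.subspace_add[OF assms(1)] cvec.subspace_scale[OF assms(1)])
    show "family_sum (Poly_Mapping.single i (c *\<^sub>C x) + u) = c *\<^sub>C x + y"
      by (simp add: clinear_add[OF clinear_family_sum] u(2) family_lift_single)
  qed
qed


section \<open>Generalized eigenspaces\<close>

abbreviation shifted :: "('a::complex_vec \<Rightarrow> 'a) \<Rightarrow> complex \<Rightarrow> 'a \<Rightarrow> 'a" where
  "shifted T c \<equiv> (\<lambda>v. T v - c *\<^sub>C v)"

definition gen_eigenspace :: "('a::complex_vec \<Rightarrow> 'a) \<Rightarrow> complex \<Rightarrow> 'a set" where
  "gen_eigenspace T c = {v. \<exists>n. (shifted T c ^^ n) v = 0}"

lemma clinear_shifted: "clinear T \<Longrightarrow> clinear (shifted T c)"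
  by (intro clinear_sub clinear_scaled clinear_ident)

lemma funpow_zero_mono:
  fixes T :: "'a::complex_vec \<Rightarrow> 'a"
  assumes "clinear T" "(T ^^ n) v = 0" "n \<le> m"
  shows "(T ^^ m) v = 0"
proof -
  have "(T ^^ m) v = (T ^^ (m - n)) ((T ^^ n) v)"
    using assms(3) by (metis comp_apply funpow_add le_add_diff_inverse2)
  then show ?thesis using assms clinear_zero[OF clinear_funpow] by metis
qed

lemma subspace_gen_eigenspace:
  assumes "clinear T"
  shows "cvec.subspace (gen_eigenspace T c)"
proof (rule cvec.subspaceI)
  note L = clinear_shifted[OF assms, of c]
  note P = clinear_funpow[OF L]
  show "0 \<in> gen_eigenspace T c"
    unfolding gen_eigenspace_def by (simp, rule exI[of _ 0]) simp
  show "x + y \<in> gen_eigenspace T c" if "x \<in> gen_eigenspace T c" "y \<in> gen_eigenspace T c" for x y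
  proof -
    obtain m n where mn: "(shifted T c ^^ m) x = 0" "(shifted T c ^^ n) y = 0"
      using \<open>x \<in> _\<close> \<open>y \<in> _\<close> unfolding gen_eigenspace_def by blast
    have "(shifted T c ^^ (max m n)) (x + y) = 0"
      using funpow_zero_mono[OF L mn(1), of "max m n"] funpow_zero_mono[OF L mn(2), of "max m n"]
      by (simp add: clinear_add[OF P])
    then show ?thesis unfolding gen_eigenspace_def by blast
  qed
  show "d *\<^sub>C x \<in> gen_eigenspace T c" if "x \<in> gen_eigenspace T c" for d x
    using that by (auto simp: gen_eigenspace_def clinear_scale[OF P])
qed

lemma shifted_in_gen_eigenspace:
  assumes "clinear T" "v \<in> gen_eigenspace T d"
  shows "shifted T c v \<in> gen_eigenspace T d"
proof -
  obtain n where n: "(shifted T d ^^ n) v = 0" using assms by (auto simp: gen_eigenspace_def)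
  have "(shifted T d ^^ n) (shifted T d v) = (shifted T d ^^ Suc n) v"
    using funpow_swap1[of "shifted T d" n v] by simp
  also have "\<dots> = 0" by (simp add: n clinear_zero[OF assms(1)])
  finally have "shifted T d v \<in> gen_eigenspace T d" unfolding gen_eigenspace_def by blast
  moreover have "shifted T c v = shifted T d v + (d - c) *\<^sub>C v"
    by (simp add: cvec.scale_left_diff_distrib)
  ultimately show ?thesis using assms
    by (metis cvec.subspace_add cvec.subspace_scale subspace_gen_eigenspace)
qed

text \<open>On the generalized eigenspace for \<open>d \<noteq> c\<close>, the operator \<open>T - c\<close> is the nonzero scalar \<open>d - c\<close>
  plus a locally nilpotent operator, hence invertible.  The induction solves \<open>(T - c) s = v\<close> by
  correcting \<open>v / (d - c)\<close> with the solution for \<open>(T - d) v\<close>.\<close>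

lemma shifted_surj_on_gen_eigenspace:
  assumes T: "clinear T" and "c \<noteq> d" and "v \<in> gen_eigenspace T d"
  shows "\<exists>s\<in>gen_eigenspace T d. shifted T c s = v"
proof -
  have "(shifted T d ^^ n) v = 0 \<Longrightarrow> \<exists>s\<in>gen_eigenspace T d. shifted T c s = v" for n v
  proof (induction n arbitrary: v)
    case 0
    then show ?case
      using cvec.subspace_0[OF subspace_gen_eigenspace[OF T]]
      by (intro bexI[of _ 0]) (auto simp: clinear_zero[OF T])
  next
    case (Suc n)
    then have v: "v \<in> gen_eigenspace T d" unfolding gen_eigenspace_def by blast
    have "(shifted T d ^^ n) (shifted T d v) = 0"
      using Suc.prems funpow_swap1[of "shifted T d" n v] by simp
    from Suc.IH[OF this] obtain s' where s': "s' \<in> gen_eigenspace T d" "shifted T c s' = shifted T d v"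
      by blast
    define s where "s = (1 / (d - c)) *\<^sub>C (v - s')"
    have "s \<in> gen_eigenspace T d"
      unfolding s_def using v s'(1) subspace_gen_eigenspace[OF T]
      by (intro cvec.subspace_scale cvec.subspace_diff)
    moreover have "shifted T c s = (1 / (d - c)) *\<^sub>C (shifted T c v - shifted T c s')"
      unfolding s_def clinear_scale[OF clinear_shifted[OF T]] clinear_diff[OF clinear_shifted[OF T]] ..
    moreover have "shifted T c v - shifted T c s' = (d - c) *\<^sub>C v"
      unfolding s'(2) by (simp add: cvec.scale_left_diff_distrib)
    ultimately show ?case using \<open>c \<noteq> d\<close> by (auto simp: scaleC_scaleC scaleC_one)
  qed
  then show ?thesis using assms(3) unfolding gen_eigenspace_def by blast
qed

lemma eigenvector_in_gen_eigenspace: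
  assumes "clinear T" "T v = c *\<^sub>C v"
  shows "v \<in> gen_eigenspace T c"
proof -
  have "(shifted T c ^^ 1) v = 0" using assms by simp
  then show ?thesis unfolding gen_eigenspace_def by blast
qed

lemma eigenvector_in_gen_eigenspace_eq_zero:
  assumes T: "clinear T" and "c \<noteq> d" "v \<in> gen_eigenspace T d" "T v = c *\<^sub>C v"
  shows "v = 0"
proof -
  have "(shifted T d ^^ n) v = (c - d) ^ n *\<^sub>C v" for n
  proof (induction n)
    case (Suc n)
    then show ?case
      by (simp add: clinear_scale[OF T] assms(4) cvec.scale_left_diff_distrib scaleC_scaleC
          algebra_simps)
  qed (simp add: scaleC_one)
  then show ?thesis using assms(2,3) by (auto simp: gen_eigenspace_def)
qed

lemma shifted_power_inj_on_gen_eigenspace: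
  assumes T: "clinear T" and "c \<noteq> d"
  shows "v \<in> gen_eigenspace T d \<Longrightarrow> (shifted T c ^^ n) v = 0 \<Longrightarrow> v = 0"
proof (induction n arbitrary: v)
  case (Suc n)
  have "(shifted T c ^^ n) (shifted T c v) = 0"
    using Suc.prems(2) funpow_swap1[of "shifted T c" n v] by simp
  from Suc.IH[OF shifted_in_gen_eigenspace[OF T Suc.prems(1)] this]
  have "T v = c *\<^sub>C v" by simp
  then show ?case using eigenvector_in_gen_eigenspace_eq_zero[OF T \<open>c \<noteq> d\<close> Suc.prems(1)] by blast
qed simp

text \<open>A power of \<open>T - d\<close> removes the summand for \<open>d\<close> and is injective on the other generalized
  eigenspaces.\<close>

lemma gen_eigenspaces_independent_sum:
  assumes T: "clinear T" and "finite C"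
  shows "(\<And>c. c \<in> C \<Longrightarrow> u c \<in> gen_eigenspace T c) \<Longrightarrow> sum u C = 0 \<Longrightarrow> c \<in> C \<Longrightarrow> u c = 0"
  using \<open>finite C\<close>
proof (induction C arbitrary: u c rule: finite_induct)
  case (insert d C)
  obtain n where n: "(shifted T d ^^ n) (u d) = 0"
    using insert.prems(1)[of d] by (auto simp: gen_eigenspace_def)
  let ?S = "shifted T d ^^ n"
  have L: "clinear ?S" by (intro clinear_funpow clinear_shifted T)
  have S: "?S v \<in> gen_eigenspace T c" if "v \<in> gen_eigenspace T c" for c v
    using that by (induction n) (auto intro: shifted_in_gen_eigenspace[OF T])
  have "0 = ?S (sum u (insert d C))" using insert.prems(2) clinear_zero[OF L] by simp
  also have "\<dots> = (\<Sum>c\<in>C. ?S (u c))"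
    using insert.hyps n by (simp add: clinear_add[OF L] clinear_sum[OF L])
  finally have "(\<Sum>c\<in>C. ?S (u c)) = 0" by simp
  then have "?S (u c) = 0" if "c \<in> C" for c
    using insert.IH[of "\<lambda>c. ?S (u c)" c] S insert.prems(1) that by blast
  then have z: "u c = 0" if "c \<in> C" for c
    using shifted_power_inj_on_gen_eigenspace[OF T] insert.prems(1) insert.hyps that
    by (metis insertCI)
  then have "u d = 0" using insert.prems(2) insert.hyps by simp
  then show ?case using z insert.prems(3) by blast
qed simp

lemma gen_eigenspaces_independent:
  assumes T: "clinear T" and u: "\<And>c. Poly_Mapping.lookup u c \<in> gen_eigenspace T c" and "family_sum u = 0"
  shows "u = 0"
proof -
  have "Poly_Mapping.lookup u c = 0" if "c \<in> Poly_Mapping.keys u" for c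
    using gen_eigenspaces_independent_sum[OF T finite_keys, of u "Poly_Mapping.lookup u" c] u that assms(3)
    by (simp add: family_lift_def)
  then show ?thesis by (intro poly_mapping_eqI) (auto simp: in_keys_iff)
qed

lemma gen_eigenspaces_unique:
  assumes T: "clinear T" and u: "\<And>c. Poly_Mapping.lookup u c \<in> gen_eigenspace T c"
    and v: "\<And>c. Poly_Mapping.lookup v c \<in> gen_eigenspace T c" and "family_sum u = family_sum v"
  shows "u = v"
proof -
  have "u - v = 0"
  proof (rule gen_eigenspaces_independent[OF T])
    show "Poly_Mapping.lookup (u - v) c \<in> gen_eigenspace T c" for c
      using u v by (simp add: lookup_minus cvec.subspace_diff subspace_gen_eigenspace[OF T])
    show "family_sum (u - v) = 0" by (simp add: clinear_diff[OF clinear_family_sum] assms(4))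
  qed
  then show ?thesis by simp
qed

text \<open>If \<open>(T - c) v\<close> is a sum of generalized eigenvectors, then up to an element of the
  generalized eigenspace for \<open>c\<close> it is \<open>(T - c) s\<close> with \<open>s\<close> again such a sum, and \<open>v - s\<close> lies in
  the generalized eigenspace for \<open>c\<close>.\<close>

lemma split_annihilated_in_span_gen_eigenspaces:
  assumes T: "clinear T"
  shows "foldr (shifted T) cs v = 0 \<Longrightarrow> v \<in> cvec.span (\<Union>c. gen_eigenspace T c)"
proof (induction cs arbitrary: v rule: rev_induct)
  case Nil
  then show ?case by (simp add: cvec.span_zero)
next
  case (snoc c cs)
  let ?G = "gen_eigenspace T"
  have inS: "x \<in> cvec.span (\<Union>c. ?G c)" if "x \<in> ?G d" for x d
    using that by (meson UN_I UNIV_I cvec.span_base)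
  have "shifted T c v \<in> cvec.span (\<Union>c. ?G c)" using snoc.IH snoc.prems by simp
  \<comment> \<open>the components outside the eigenvalue \<open>c\<close> can be divided by \<open>T - c\<close>\<close>
  moreover have "\<exists>s\<in>cvec.span (\<Union>c. ?G c). \<exists>u\<in>?G c. y = shifted T c s + u"
    if "y \<in> cvec.span (\<Union>c. ?G c)" for y
    using that
  proof (induction rule: cvec.span_induct_alt)
    case base
    show ?case
      by (rule bexI[of _ 0], rule bexI[of _ 0])
        (simp_all add: clinear_zero[OF T] cvec.span_zero cvec.subspace_0 subspace_gen_eigenspace[OF T])
  next
    case (step a x y)
    then obtain d s u where x: "x \<in> ?G d" and s: "s \<in> cvec.span (\<Union>c. ?G c)" "u \<in> ?G c"
      "y = shifted T c s + u" by blast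
    show ?case
    proof (cases "d = c")
      case True
      have "a *\<^sub>C x + y = shifted T c s + (a *\<^sub>C x + u)" using s by simp
      moreover have "a *\<^sub>C x + u \<in> ?G c"
        using x True s(2) subspace_gen_eigenspace[OF T] by (auto intro!: cvec.subspace_add cvec.subspace_scale)
      ultimately show ?thesis using s(1) by blast
    next
      case False
      obtain r where r: "r \<in> ?G d" "shifted T c r = x"
        using shifted_surj_on_gen_eigenspace[OF T _ x, of c] False by blast
      have "shifted T c (a *\<^sub>C r + s) = a *\<^sub>C shifted T c r + shifted T c s"
        by (simp add: clinear_add[OF T] clinear_scale[OF T] scaleC_add_right
            cvec.scale_right_diff_distrib scaleC_scaleC mult.commute)
      then have "a *\<^sub>C x + y = shifted T c (a *\<^sub>C r + s) + u"
        unfolding r(2) by (simp add: s)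
      moreover have "a *\<^sub>C r + s \<in> cvec.span (\<Union>c. ?G c)"
        using inS[OF r(1)] s(1) by (intro cvec.span_add cvec.span_scale)
      ultimately show ?thesis using s(2) by blast
    qed
  qed
  ultimately obtain s u where su: "s \<in> cvec.span (\<Union>c. ?G c)" "u \<in> ?G c"
    "shifted T c v = shifted T c s + u" by blast
  have "shifted T c (v - s) = u"
    using su(3) by (simp add: clinear_diff[OF T] cvec.scale_right_diff_distrib algebra_simps)
  moreover obtain n where "(shifted T c ^^ n) u = 0" using su(2) by (auto simp: gen_eigenspace_def)
  ultimately have "(shifted T c ^^ Suc n) (v - s) = 0" unfolding funpow_Suc_right by simp
  then have "v - s \<in> ?G c" unfolding gen_eigenspace_def by blast
  from cvec.span_add[OF inS[OF this] su(1)] show ?case by simp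
qed

definition poly_act :: "('a::complex_vec \<Rightarrow> 'a) \<Rightarrow> complex poly \<Rightarrow> 'a \<Rightarrow> 'a" where
  "poly_act T p v = (\<Sum>i\<le>degree p. coeff p i *\<^sub>C (T ^^ i) v)"

lemma poly_act_bound:
  "degree p \<le> n \<Longrightarrow> poly_act T p v = (\<Sum>i\<le>n. coeff p i *\<^sub>C (T ^^ i) v)"
  unfolding poly_act_def
  by (rule sum.mono_neutral_left) (auto simp: coeff_eq_0 not_le)

lemma poly_act_linear_factor:
  assumes T: "clinear T"
  shows "poly_act T ([:- c, 1:] * p) v = shifted T c (poly_act T p v)"
proof -
  let ?n = "degree p"
  have deg: "degree ([:- c, 1:] * p) \<le> Suc ?n"
    using degree_mult_le[of "[:- c, 1:]" p] by simp
  have co: "coeff ([:- c, 1:] * p) i = (case i of 0 \<Rightarrow> 0 | Suc j \<Rightarrow> coeff p j) - c * coeff p i" for i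
    by (simp add: coeff_pCons split: nat.split)
  have "poly_act T ([:- c, 1:] * p) v
      = (\<Sum>i\<le>Suc ?n. (case i of 0 \<Rightarrow> 0 | Suc j \<Rightarrow> coeff p j) *\<^sub>C (T ^^ i) v)
        - (\<Sum>i\<le>Suc ?n. (c * coeff p i) *\<^sub>C (T ^^ i) v)"
    unfolding poly_act_bound[OF deg] co cvec.scale_left_diff_distrib sum_subtractf ..
  also have "(\<Sum>i\<le>Suc ?n. (case i of 0 \<Rightarrow> 0 | Suc j \<Rightarrow> coeff p j) *\<^sub>C (T ^^ i) v) = T (poly_act T p v)"
    unfolding sum.atMost_Suc_shift by (simp add: poly_act_def clinear_sum[OF T] clinear_scale[OF T])
  also have "(\<Sum>i\<le>Suc ?n. (c * coeff p i) *\<^sub>C (T ^^ i) v) = c *\<^sub>C poly_act T p v"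
    unfolding poly_act_bound[of p "Suc ?n", OF le_SucI[OF order_refl]]
    by (simp add: cvec.scale_sum_right scaleC_scaleC scaleC_add_right)
  finally show ?thesis .
qed

lemma poly_act_factorization:
  assumes T: "clinear T"
  shows "p \<noteq> 0 \<Longrightarrow> poly_act T p v = 0 \<Longrightarrow> \<exists>cs. foldr (shifted T) cs v = 0"
proof -
  have "p \<noteq> 0 \<Longrightarrow> \<exists>cs a. a \<noteq> 0 \<and> poly_act T p v = a *\<^sub>C foldr (shifted T) cs v"
  proof (induction "degree p" arbitrary: p)
    case 0
    have "poly_act T p v = coeff p 0 *\<^sub>C v" using 0(1) by (simp add: poly_act_def)
    moreover have "coeff p 0 \<noteq> 0" using 0 by (metis leading_coeff_0_iff)
    ultimately show ?case by (intro exI[of _ "[]"] exI[of _ "coeff p 0"]) simp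
  next
    case (Suc n)
    obtain z where "poly p z = 0"
      using fundamental_theorem_of_algebra[of p] Suc(2) by (auto simp: constant_degree)
    then obtain q where q: "p = [:- z, 1:] * q" by (auto simp: poly_eq_0_iff_dvd elim: dvdE)
    have "q \<noteq> 0" using q Suc.prems by auto
    moreover have "degree q = n"
      using Suc(2) \<open>q \<noteq> 0\<close> degree_mult_eq[of "[:- z, 1:]" q] unfolding q by simp
    ultimately obtain cs a where "a \<noteq> 0" "poly_act T q v = a *\<^sub>C foldr (shifted T) cs v"
      using Suc(1)[of q] by blast
    then have "poly_act T p v = a *\<^sub>C foldr (shifted T) (z # cs) v"
      unfolding q poly_act_linear_factor[OF T]
      by (simp add: clinear_scale[OF T] cvec.scale_right_diff_distrib scaleC_scaleC mult.commute)
    then show ?case using \<open>a \<noteq> 0\<close> by blast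
  qed
  then show "p \<noteq> 0 \<Longrightarrow> poly_act T p v = 0 \<Longrightarrow> \<exists>cs. foldr (shifted T) cs v = 0"
    by fastforce
qed

lemma finite_dimensional_independent_finite:
  assumes "finite_dimensional TYPE('a::complex_vec)" "\<not> cvec.dependent (X :: 'a set)"
  shows "finite X"
  using assms cvec.independent_span_bound[of _ X] unfolding finite_dimensional_def by auto

text \<open>The iterates \<open>T\<^sup>i v\<close> either repeat or form an infinite, hence dependent, set.\<close>

lemma exists_annihilating_poly:
  assumes fd: "finite_dimensional TYPE('a::complex_vec)"
  shows "\<exists>p. p \<noteq> 0 \<and> poly_act T p (v::'a) = 0"
proof (cases "inj (\<lambda>i. (T ^^ i) v)")
  case False
  then obtain i j where ij: "i < j" "(T ^^ i) v = (T ^^ j) v"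
    by (metis injI linorder_neqE_nat)
  define p :: "complex poly" where "p = monom 1 j - monom 1 i"
  have "coeff p j = 1" using ij by (simp add: p_def)
  then have "p \<noteq> 0" by auto
  have "degree p \<le> j"
    unfolding p_def by (intro degree_diff_le) (use ij in \<open>auto intro: order_trans[OF degree_monom_le]\<close>)
  then have "poly_act T p v = (\<Sum>k\<le>j. (if k = j then (T ^^ k) v else 0) - (if k = i then (T ^^ k) v else 0))"
    unfolding poly_act_bound[OF \<open>degree p \<le> j\<close>]
    by (intro sum.cong) (auto simp: p_def scaleC_one)
  also have "\<dots> = 0" unfolding sum_subtractf using ij by (simp add: sum.delta)
  finally show ?thesis using \<open>p \<noteq> 0\<close> by blast
next
  case True
  have "infinite (range (\<lambda>i. (T ^^ i) v))" using True by (simp add: range_inj_infinite)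
  then have "cvec.dependent (range (\<lambda>i. (T ^^ i) v))"
    using finite_dimensional_independent_finite[OF fd] by blast
  then obtain S q where S: "finite S" "S \<subseteq> range (\<lambda>i. (T ^^ i) v)" "(\<Sum>x\<in>S. q x *\<^sub>C x) = 0"
    "\<exists>x\<in>S. q x \<noteq> 0"
    unfolding cvec.dependent_explicit by blast
  define I where "I = {i. (T ^^ i) v \<in> S}"
  have SI: "S = (\<lambda>i. (T ^^ i) v) ` I" using S(2) by (auto simp: I_def)
  have inj: "inj_on (\<lambda>i. (T ^^ i) v) I" using True by (rule inj_on_subset) simp
  have finI: "finite I" using S(1) SI inj by (simp add: finite_image_iff)
  define p where "p = (\<Sum>i\<in>I. monom (q ((T ^^ i) v)) i)"
  have co: "coeff p i = (if i \<in> I then q ((T ^^ i) v) else 0)" for i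
    unfolding p_def coeff_sum using finI by (simp add: sum.delta coeff_monom)
  obtain x where "x \<in> S" "q x \<noteq> 0" using S(4) by blast
  then obtain i where "i \<in> I" "q ((T ^^ i) v) \<noteq> 0" using SI by blast
  then have "p \<noteq> 0" using co[of i] by auto
  have "poly_act T p v = (\<Sum>i\<in>I. q ((T ^^ i) v) *\<^sub>C (T ^^ i) v)"
  proof -
    have "poly_act T p v = (\<Sum>i\<in>{..degree p} \<inter> I. coeff p i *\<^sub>C (T ^^ i) v)"
      unfolding poly_act_def by (rule sum.mono_neutral_right) (auto simp: co)
    also have "\<dots> = (\<Sum>i\<in>I. coeff p i *\<^sub>C (T ^^ i) v)"
      by (rule sum.mono_neutral_left) (use finI in \<open>auto intro: le_degree\<close>)
    finally show ?thesis by (simp add: co)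
  qed
  also have "\<dots> = (\<Sum>x\<in>S. q x *\<^sub>C x)"
    unfolding SI by (simp add: sum.reindex[OF inj])
  finally show ?thesis using S(3) \<open>p \<noteq> 0\<close> by auto
qed

text \<open>The annihilating polynomial of each vector splits into linear factors over \<open>\<complex>\<close>.\<close>

theorem gen_eigenspaces_span:
  assumes "finite_dimensional TYPE('a::complex_vec)" "clinear (T :: 'a \<Rightarrow> 'a)"
  shows "cvec.span (\<Union>c. gen_eigenspace T c) = UNIV"
  using exists_annihilating_poly[OF assms(1), of T] poly_act_factorization[OF assms(2)]
    split_annihilated_in_span_gen_eigenspaces[OF assms(2)] by blast

lemma exists_eigenvector:
  assumes "finite_dimensional TYPE('a::complex_vec)" "clinear (T :: 'a \<Rightarrow> 'a)" "\<exists>v::'a. v \<noteq> 0"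
  shows "\<exists>c v. v \<noteq> 0 \<and> T v = c *\<^sub>C v"
proof -
  obtain c v where v: "v \<in> gen_eigenspace T c" "v \<noteq> 0"
  proof (rule ccontr)
    assume "\<not> thesis"
    then have "(\<Union>c. gen_eigenspace T c) \<subseteq> {0}" using that by blast
    then have "cvec.span (\<Union>c. gen_eigenspace T c) \<subseteq> cvec.span {0}" by (rule cvec.span_mono)
    then show False using gen_eigenspaces_span[OF assms(1,2)] assms(3) by auto
  qed
  let ?n = "LEAST n. (shifted T c ^^ n) v = 0"
  have n: "(shifted T c ^^ ?n) v = 0" by (rule LeastI_ex) (use v in \<open>simp add: gen_eigenspace_def\<close>)
  then obtain m where m: "?n = Suc m" using v(2) by (cases ?n) auto
  have "(shifted T c ^^ m) v \<noteq> 0" using not_less_Least[of m "\<lambda>n. (shifted T c ^^ n) v = 0"] m by simp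
  moreover have "T ((shifted T c ^^ m) v) = c *\<^sub>C ((shifted T c ^^ m) v)" using n m by simp
  ultimately show ?thesis by blast
qed


text \<open>By independence the components of a vector in the generalized eigenspaces are unique, hence
  depend linearly on it.\<close>

lemma exists_semisimple_part:
  assumes fd: "finite_dimensional TYPE('a::complex_vec)" and T: "clinear (T :: 'a \<Rightarrow> 'a)"
  shows "\<exists>D. clinear D \<and> (\<forall>c. \<forall>v\<in>gen_eigenspace T c. D v = c *\<^sub>C v)"
proof -
  have "\<exists>u. (\<forall>c. Poly_Mapping.lookup u c \<in> gen_eigenspace T c) \<and> family_sum u = v" for v
    using in_span_Union_imp_family_sum[of "gen_eigenspace T" v, OF subspace_gen_eigenspace[OF T]]
      gen_eigenspaces_span[OF fd T] by simp
  then obtain comp where comp: "\<And>v c. Poly_Mapping.lookup (comp v) c \<in> gen_eigenspace T c"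
    "\<And>v. family_sum (comp v) = v" by metis
  have eq: "comp v = u" if "\<And>c. Poly_Mapping.lookup u c \<in> gen_eigenspace T c" "family_sum u = v" for u v
    using gen_eigenspaces_unique[OF T comp(1) that(1)] comp(2) that(2) by metis
  have lin: "clinear comp"
    by (rule clinearI; rule eq)
      (simp_all add: comp clinear_simps[OF clinear_family_sum] clinear_simps[OF lookup_clinear]
        cvec.subspace_add cvec.subspace_scale subspace_gen_eigenspace[OF T])
  have lift: "clinear (family_lift (\<lambda>c x. c *\<^sub>C x) :: _ \<Rightarrow> 'a)"
    by (rule clinear_family_lift) (intro clinear_scaled clinear_ident)
  have "comp v = Poly_Mapping.single c v" if "v \<in> gen_eigenspace T c" for v c
    by (rule eq) (use that in \<open>auto simp: family_lift_single lookup_single when_def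
        cvec.subspace_0 subspace_gen_eigenspace[OF T]\<close>)
  then have "family_lift (\<lambda>c x. c *\<^sub>C x) (comp v) = c *\<^sub>C v" if "v \<in> gen_eigenspace T c" for v c
    using that by (simp add: family_lift_single)
  then show ?thesis using clinear_compose[OF lift lin] by blast
qed


section \<open>The trace\<close>

lemma extend_basis_empty:
  assumes "finite_dimensional TYPE('a::complex_vec)"
  shows "finite (cvec.extend_basis {} :: 'a set)"
    "\<not> cvec.dependent (cvec.extend_basis {} :: 'a set)"
    "cvec.span (cvec.extend_basis {} :: 'a set) = UNIV"
  using finite_dimensional_independent_finite[OF assms]
    cvec.independent_extend_basis cvec.span_extend_basis cvec.independent_empty by blast+

lemma representation_clinear:
  assumes "\<not> cvec.dependent B" "cvec.span B = UNIV"
  shows "clinear (\<lambda>v. cvec.representation B v b)"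
  by (rule clinearI)
    (simp_all add: assms cvec.representation_add cvec.representation_scale scaleC_complex_def)

lemma endo_trace_clinear_arg:
  assumes fd: "finite_dimensional TYPE('a::complex_vec)" and f: "\<And>z. clinear (\<lambda>x. f x (z :: 'a))"
  shows "clinear (\<lambda>x. endo_trace (f x))"
  unfolding endo_trace_def
  by (intro clinear_sum_of clinear_compose[OF representation_clinear] f) (use extend_basis_empty[OF fd] in auto)

lemma endo_trace_diff:
  assumes fd: "finite_dimensional TYPE('a::complex_vec)"
  shows "endo_trace (\<lambda>z::'a. f z - g z) = endo_trace f - endo_trace g"
  unfolding endo_trace_def
  by (simp add: cvec.representation_diff extend_basis_empty[OF fd] sum_subtractf)

lemma endo_trace_comm:
  fixes f g :: "'a::complex_vec \<Rightarrow> 'a"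
  assumes fd: "finite_dimensional TYPE('a::complex_vec)" and f: "clinear f" and g: "clinear g"
  shows "endo_trace (\<lambda>z::'a. f (g z)) = endo_trace (\<lambda>z. g (f z))"
proof -
  let ?B = "cvec.extend_basis {} :: 'a set"
  let ?r = "cvec.representation ?B"
  note B = extend_basis_empty[OF fd]
  note r = representation_clinear[OF B(2,3)]
  have expand: "?r (f (g b)) b = (\<Sum>b'\<in>?B. ?r (g b) b' * ?r (f b') b)" if f: "clinear f" for f g :: "'a \<Rightarrow> 'a" and b
  proof -
    have "g b = (\<Sum>b'\<in>?B. ?r (g b) b' *\<^sub>C b')"
      using cvec.sum_representation_eq[OF B(2) _ B(1), of "g b"] B(3) by simp
    then have "f (g b) = (\<Sum>b'\<in>?B. ?r (g b) b' *\<^sub>C f b')"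
      by (metis (no_types, lifting) clinear_sum[OF f] clinear_scale[OF f] sum.cong)
    then show ?thesis by (simp add: clinear_sum[OF r] clinear_scale[OF r] scaleC_complex_def)
  qed
  have "endo_trace (\<lambda>z. f (g z)) = (\<Sum>b\<in>?B. \<Sum>b'\<in>?B. ?r (g b) b' * ?r (f b') b)"
    unfolding endo_trace_def by (rule sum.cong[OF refl]) (rule expand[OF f])
  also have "\<dots> = (\<Sum>b'\<in>?B. \<Sum>b\<in>?B. ?r (f b') b * ?r (g b) b')"
    by (subst sum.swap) (simp add: mult.commute)
  also have "\<dots> = endo_trace (\<lambda>z. g (f z))"
    unfolding endo_trace_def by (rule sum.cong[OF refl]) (rule expand[OF g, symmetric])
  finally show ?thesis .
qed


section \<open>The Killing form and inner derivations\<close>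

locale fd_lie_algebra =
  fixes br :: "'g::complex_vec \<Rightarrow> 'g \<Rightarrow> 'g"
  assumes fd: "finite_dimensional TYPE('g)" and lie: "lie_algebra br"
begin

lemma bil: "cbilinear br" using lie by (simp add: lie_algebra_def)

lemmas br_simps = cbilinear_simps[OF bil]

lemma ad_clinear: "clinear (br x)" and ad_clinear_left: "clinear (\<lambda>x. br x y)"
  by (rule cbilinear_right[OF bil], rule cbilinear_left[OF bil])

lemma br_self: "br x x = 0" using lie by (simp add: lie_algebra_def)

lemma br_skew: "br x y = - br y x"
proof -
  have "br (x + y) (x + y) = br x y + br y x" unfolding br_simps by (simp add: br_self)
  then show ?thesis by (simp add: br_self eq_neg_iff_add_eq_0)
qed

lemma ad_bracket: "br (br x y) z = br x (br y z) - br y (br x z)"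
proof -
  have "br x (br y z) + br y (br z x) + br z (br x y) = 0"
    using lie unfolding lie_algebra_def by blast
  moreover have "br y (br z x) = - br y (br x z)" by (subst br_skew[of z x]) (simp add: br_simps)
  moreover have "br z (br x y) = - br (br x y) z" by (rule br_skew)
  ultimately show ?thesis by (simp add: algebra_simps)
qed



abbreviation \<kappa> :: "'g \<Rightarrow> 'g \<Rightarrow> complex" where "\<kappa> \<equiv> killing_form br"

lemma killing_cbilinear: "cbilinear \<kappa>"
  unfolding killing_form_def
  by (rule cbilinearI; rule endo_trace_clinear_arg[OF fd])
    (auto intro!: clinear_compose[OF ad_clinear] ad_clinear_left)



text \<open>Both invariance of the Killing form and the identity behind inner derivations are the cyclicity
  of the trace, applied to the commutator \<open>ad (D x) = D \<circ> ad x - ad x \<circ> D\<close>.\<close>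

lemma killing_derivation:
  assumes D: "clinear D" and der: "\<And>x y. D (br x y) = br (D x) y + br x (D y)"
  shows "\<kappa> (D x) y = endo_trace (\<lambda>w. D (br (br x y) w))"
proof -
  have adD: "br (D x) w = D (br x w) - br x (D w)" for w using der[of x w] by simp
  have "\<kappa> (D x) y = endo_trace (\<lambda>w. D (br x (br y w))) - endo_trace (\<lambda>w. br x (D (br y w)))"
    unfolding killing_form_def adD by (rule endo_trace_diff[OF fd])
  also have "endo_trace (\<lambda>w. br x (D (br y w))) = endo_trace (\<lambda>w. D (br y (br x w)))"
    by (rule endo_trace_comm[OF fd ad_clinear clinear_compose[OF D ad_clinear]])
  finally show ?thesis
    unfolding endo_trace_diff[OF fd, symmetric] ad_bracket clinear_diff[OF D] .
qed

lemma killing_invariant: "\<kappa> (br z x) y = \<kappa> z (br x y)"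
proof -
  have "br z (br x y) = br (br z x) y + br x (br z y)" for x y using ad_bracket[of z x y] by simp
  from killing_derivation[OF ad_clinear this, of x y]
  show ?thesis unfolding killing_form_def[of br z] by simp
qed

end

locale nondegenerate_lie_algebra = fd_lie_algebra br for br :: "'g::complex_vec \<Rightarrow> 'g \<Rightarrow> 'g" +
  assumes nondeg: "\<And>x. (\<And>y. killing_form br x y = 0) \<Longrightarrow> x = 0"
begin

lemma killing_separates: "(\<And>y. \<kappa> x y = \<kappa> x' y) \<Longrightarrow> x = x'"
  using nondeg[of "x - x'"] cbilinear_simps(9)[OF killing_cbilinear, of x x'] by simp



text \<open>The map that sends \<open>z\<close> to the vector with coordinates \<open>\<kappa> z b\<close> in a basis is an injective
  endomorphism of a finite-dimensional space, hence surjective.\<close>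

lemma killing_represents:
  assumes \<phi>: "clinear \<phi>"
  shows "\<exists>z. \<forall>y. \<kappa> z y = \<phi> y"
proof -
  let ?B = "cvec.extend_basis {} :: 'g set"
  note B = extend_basis_empty[OF fd]
  interpret V: finite_dimensional_vector_space "scaleC :: complex \<Rightarrow> 'g \<Rightarrow> 'g" ?B
    by unfold_locales (use B in auto)
  define E where "E p = (\<Sum>b\<in>?B. p b *\<^sub>C b)" for p :: "'g \<Rightarrow> complex"
  have E_inj: "p b = q b" if "E p = E q" "b \<in> ?B" for p q b
  proof -
    have "(\<Sum>b\<in>?B. (p b - q b) *\<^sub>C b) = 0"
      using that(1) by (simp add: E_def cvec.scale_left_diff_distrib sum_subtractf)
    then show ?thesis using cvec.independentD[OF B(2) B(1) order_refl, of "\<lambda>b. p b - q b" b] that(2) by simp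
  qed
  have agree: "\<kappa> z y = \<psi> y" if "clinear \<psi>" "\<And>b. b \<in> ?B \<Longrightarrow> \<kappa> z b = \<psi> b" for z y \<psi>
    by (rule clinear_eq_on_span[OF cbilinear_right[OF killing_cbilinear] that(1), of ?B])
      (use that(2) B(3) in auto)
  let ?T = "\<lambda>z. E (\<kappa> z)"
  have lin: "clinear ?T"
    unfolding E_def
    by (intro clinear_sum_of clinear_compose[OF clinear_scale_left] cbilinear_left killing_cbilinear)
  have "inj ?T"
    by (rule injI, rule killing_separates, rule agree)
      (auto intro: E_inj cbilinear_right killing_cbilinear)
  from V.linear_inj_imp_surj[OF lin this] obtain z where "E \<phi> = ?T z" by (metis surjD)
  then show ?thesis using agree[OF \<phi>, of z] E_inj by metis
qed

text \<open>Represent the functional \<open>y \<mapsto> tr (D \<circ> ad y)\<close> by \<open>z\<close>.  Then \<open>\<kappa> (D x) y = tr (D \<circ> ad [x, y]) =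
  \<kappa> z [x, y] = \<kappa> [z, x] y\<close> for all \<open>y\<close>.\<close>

lemma derivation_inner:
  assumes D: "clinear D" and der: "\<And>x y. D (br x y) = br (D x) y + br x (D y)"
  shows "\<exists>z. \<forall>x. D x = br z x"
proof -
  have "clinear (\<lambda>y. endo_trace (\<lambda>w. D (br y w)))"
    by (rule endo_trace_clinear_arg[OF fd]) (intro clinear_compose[OF D] ad_clinear_left)
  from killing_represents[OF this] obtain z where z: "\<And>y. \<kappa> z y = endo_trace (\<lambda>w. D (br y w))" by blast
  have "D x = br z x" for x
    by (rule killing_separates) (simp add: killing_derivation[OF D der] killing_invariant z)
  then show ?thesis by blast
qed

text \<open>\<open>ad x - (c + d)\<close> obeys the Leibniz rule with \<open>ad x - c\<close> on the first factor and \<open>ad x - d\<close> on the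
  second; after enough applications every term contains a zero factor.\<close>

lemma gen_eigenspace_bracket:
  assumes "u \<in> gen_eigenspace (br x) c" "v \<in> gen_eigenspace (br x) d"
  shows "br u v \<in> gen_eigenspace (br x) (c + d)"
proof -
  let ?T = "shifted (br x) (c + d)"
  have step: "?T (br u v) = br (shifted (br x) c u) v + br u (shifted (br x) d v)" for u v
  proof -
    have "br x (br u v) = br (br x u) v + br u (br x v)" using ad_bracket[of x u v] by simp
    then show ?thesis by (simp add: br_simps scaleC_add_left algebra_simps)
  qed
  have "\<lbrakk>(shifted (br x) c ^^ m) u = 0; (shifted (br x) d ^^ n) v = 0\<rbrakk>
      \<Longrightarrow> br u v \<in> gen_eigenspace (br x) (c + d)" for m n u v
  proof (induction "m + n" arbitrary: m n u v)
    case 0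
    then show ?case using cvec.subspace_0[OF subspace_gen_eigenspace[OF ad_clinear]] by (simp add: br_simps)
  next
    case (Suc k)
    have "br (shifted (br x) c u) v \<in> gen_eigenspace (br x) (c + d)"
    proof (cases m)
      case 0
      then show ?thesis using Suc.prems cvec.subspace_0[OF subspace_gen_eigenspace[OF ad_clinear]]
        by (simp add: br_simps)
    next
      case (Suc m')
      show ?thesis
        by (rule Suc.hyps(1)[of m' n])
          (use Suc \<open>Suc k = m + n\<close> Suc.prems funpow_swap1[of "shifted (br x) c" m' u] in auto)
    qed
    moreover have "br u (shifted (br x) d v) \<in> gen_eigenspace (br x) (c + d)"
    proof (cases n)
      case 0
      then show ?thesis using Suc.prems cvec.subspace_0[OF subspace_gen_eigenspace[OF ad_clinear]]
        by (simp add: br_simps)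
    next
      case (Suc n')
      show ?thesis
        by (rule Suc.hyps(1)[of m n'])
          (use Suc \<open>Suc k = m + n\<close> Suc.prems funpow_swap1[of "shifted (br x) d" n' v] in auto)
    qed
    ultimately have "?T (br u v) \<in> gen_eigenspace (br x) (c + d)"
      unfolding step by (intro cvec.subspace_add subspace_gen_eigenspace ad_clinear)
    then obtain j where "(?T ^^ j) (?T (br u v)) = 0" unfolding gen_eigenspace_def by blast
    then have "(?T ^^ Suc j) (br u v) = 0" unfolding funpow_Suc_right by simp
    then show ?case unfolding gen_eigenspace_def by blast
  qed
  then show ?thesis using assms unfolding gen_eigenspace_def by blast
qed

text \<open>The eigenvalues add under the bracket, so the semisimple part of \<open>ad x\<close> is a derivation.\<close>

lemma semisimple_part_inner:
  "\<exists>z. \<forall>c. \<forall>v\<in>gen_eigenspace (br x) c. br z v = c *\<^sub>C v"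
proof -
  obtain D where D: "clinear D" "\<And>c v. v \<in> gen_eigenspace (br x) c \<Longrightarrow> D v = c *\<^sub>C v"
    using exists_semisimple_part[OF fd ad_clinear] by blast
  note G = gen_eigenspaces_span[OF fd ad_clinear, of x]
  have 1: "D (br u v) = br (D u) v + br u (D v)" if u: "u \<in> gen_eigenspace (br x) c" for c u v
    by (rule clinear_eq_on_span[of "\<lambda>v. D (br u v)" "\<lambda>v. br (D u) v + br u (D v)" "\<Union>d. gen_eigenspace (br x) d"])
      (use G in \<open>auto intro!: clinear_plus clinear_scaled clinear_compose[OF D(1)] clinear_compose[OF ad_clinear] D(1) ad_clinear
         simp: D(2) D(2)[OF u] D(2)[OF gen_eigenspace_bracket[OF u]] br_simps scaleC_add_left\<close>)
  have "D (br u v) = br (D u) v + br u (D v)" for u v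
    by (rule clinear_eq_on_span[of "\<lambda>u. D (br u v)" "\<lambda>u. br (D u) v + br u (D v)" "\<Union>d. gen_eigenspace (br x) d"])
      (use G in \<open>auto intro!: clinear_plus clinear_compose[OF D(1)] clinear_compose[OF ad_clinear_left] D(1) 
          ad_clinear_left simp: 1\<close>)
  from derivation_inner[OF D(1) this] show ?thesis using D(2) by metis
qed

end


section \<open>The root space decomposition\<close>

locale cartan_setting = nondegenerate_lie_algebra br for br :: "'g::complex_vec \<Rightarrow> 'g \<Rightarrow> 'g" +
  fixes h :: "'g set" and S :: "('g \<Rightarrow> complex) set" and \<Delta>p :: "('g \<Rightarrow> complex) set"
  assumes cartan: "cartan_subalgebra br h" and base: "root_base br h S"
    and pos: "\<Delta>p = {\<beta> \<in> roots br h. nonneg_comb S \<beta>}"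
begin

lemma h_subspace: "cvec.subspace h" and h_closed: "\<lbrakk>x \<in> h; y \<in> h\<rbrakk> \<Longrightarrow> br x y \<in> h"
  and h_normalizer: "(\<And>y. y \<in> h \<Longrightarrow> br x y \<in> h) \<Longrightarrow> x \<in> h"
  using cartan unfolding cartan_subalgebra_def by blast+

lemma centralizer_in_h: "(\<And>y. y \<in> h \<Longrightarrow> br x y = 0) \<Longrightarrow> x \<in> h"
  by (rule h_normalizer) (simp add: cvec.subspace_0[OF h_subspace])

lemma dual_space_subspace: "cvec.subspace (dual_space h)"
  by (rule cvec.subspaceI) (auto simp: dual_space_def scaleC_fun_def scaleC_complex_def algebra_simps)

lemma base_separates:
  assumes "n \<in> h" and "\<And>\<alpha>. \<alpha> \<in> S \<Longrightarrow> \<alpha> n = 0"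
  shows "n = 0"
proof (rule ccontr)
  assume "n \<noteq> 0"
  then have ind: "\<not> cvec.dependent {n}" by simp
  let ?B = "cvec.extend_basis {n}"
  have B: "\<not> cvec.dependent ?B" "cvec.span ?B = UNIV" "n \<in> ?B"
    using cvec.independent_extend_basis[OF ind] cvec.span_extend_basis[OF ind]
      cvec.extend_basis_superset[OF ind] by auto
  define \<phi> where "\<phi> y = (if y \<in> h then cvec.representation ?B y n else 0)" for y
  have "\<phi> \<in> dual_space h"
    unfolding dual_space_def \<phi>_def
    by (auto simp: cvec.subspace_add[OF h_subspace] cvec.subspace_scale[OF h_subspace]
        clinear_simps[OF representation_clinear[OF B(1,2)]] scaleC_complex_def)
  then have "\<phi> \<in> cvec.span S" using base by (simp add: root_base_def)
  then have "\<phi> n = 0"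
    by (induction rule: cvec.span_induct_alt) (auto simp: scaleC_fun_def scaleC_complex_def assms(2))
  moreover have "\<phi> n = 1" using assms(1) cvec.representation_basis[OF B(1,3)] by (simp add: \<phi>_def)
  ultimately show False by simp
qed

lemma base_root_vector:
  assumes "\<alpha> \<in> S"
  obtains e where "e \<noteq> 0" "\<And>x. x \<in> h \<Longrightarrow> br x e = \<alpha> x *\<^sub>C e"
proof -
  have "root_space br h \<alpha> \<noteq> {0}" using assms base by (auto simp: root_base_def roots_def)
  moreover have "0 \<in> root_space br h \<alpha>" by (simp add: root_space_def br_simps)
  ultimately obtain e where "e \<in> root_space br h \<alpha>" "e \<noteq> 0" by blast
  then show ?thesis using that by (auto simp: root_space_def)
qed

text \<open>A commutator in \<open>h\<close> acts by zero on every root vector, and the simple roots separate the points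
  of \<open>h\<close>.\<close>

lemma h_abelian:
  assumes "x \<in> h" "y \<in> h"
  shows "br x y = 0"
proof (rule base_separates[OF h_closed[OF assms]])
  fix \<alpha> assume "\<alpha> \<in> S"
  then obtain e where e: "e \<noteq> 0" "\<And>x. x \<in> h \<Longrightarrow> br x e = \<alpha> x *\<^sub>C e" by (rule base_root_vector) blast
  have "\<alpha> (br x y) *\<^sub>C e = br (br x y) e" using e(2) h_closed[OF assms] by simp
  also have "\<dots> = 0" unfolding ad_bracket using assms by (simp add: e(2) br_simps scaleC_scaleC mult.commute)
  finally show "\<alpha> (br x y) = 0" using e(1) by simp
qed

text \<open>Let \<open>ad z\<close> be the semisimple part of \<open>ad x\<close>.  As \<open>h\<close> lies in the generalized eigenspace of \<open>ad x\<close>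
  for \<open>0\<close>, the element \<open>z\<close> centralizes \<open>h\<close> and so belongs to it.  On a root vector for \<open>\<alpha>\<close> both operators
  have the same eigenvalue, that is, \<open>\<alpha> x = \<alpha> z\<close>; since the simple roots separate the points of \<open>h\<close>,
  this gives \<open>x = z\<close>.\<close>

lemma ad_semisimple:
  assumes x: "x \<in> h" and v: "v \<in> gen_eigenspace (br x) c"
  shows "br x v = c *\<^sub>C v"
proof -
  obtain z where z: "\<And>c v. v \<in> gen_eigenspace (br x) c \<Longrightarrow> br z v = c *\<^sub>C v"
    using semisimple_part_inner by blast
  have "z \<in> h"
  proof (rule centralizer_in_h)
    fix y assume y: "y \<in> h"
    have y0: "y \<in> gen_eigenspace (br x) 0"
      by (rule eigenvector_in_gen_eigenspace) (use ad_clinear h_abelian[OF x y] in auto)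
    show "br z y = 0"
      using z[OF y0] by simp
  qed
  have "x - z = 0"
  proof (rule base_separates)
    show "x - z \<in> h" using x \<open>z \<in> h\<close> h_subspace by (rule cvec.subspace_diff[rotated])
    fix \<alpha> assume "\<alpha> \<in> S"
    then obtain e where e: "e \<noteq> 0" "\<And>x. x \<in> h \<Longrightarrow> br x e = \<alpha> x *\<^sub>C e" by (rule base_root_vector) blast
    have "br z e = \<alpha> x *\<^sub>C e"
      by (intro z eigenvector_in_gen_eigenspace ad_clinear e x)
    then have "\<alpha> x = \<alpha> z" using e \<open>z \<in> h\<close> by simp
    moreover have "\<alpha> \<in> dual_space h" using \<open>\<alpha> \<in> S\<close> base by (auto simp: root_base_def roots_def)
    then have "\<alpha> (x - z) + \<alpha> z = \<alpha> x"
      using x \<open>z \<in> h\<close> \<open>x - z \<in> h\<close> unfolding dual_space_def by (metis (mono_tags, lifting) diff_add_cancel mem_Collect_eq)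
    ultimately show "\<alpha> (x - z) = 0" by simp
  qed
  then show ?thesis using z[OF v] by simp
qed

text \<open>The eigencomponents for \<open>ad x\<close> of a joint eigenvector of \<open>ad y\<close>, \<open>y \<in> F\<close>, are again joint
  eigenvectors: \<open>ad y\<close> commutes with \<open>ad x\<close>, and the decomposition into components is unique.\<close>

lemma joint_eigenvectors_span:
  assumes "finite F" "F \<subseteq> h"
  shows "cvec.span {v. \<forall>y\<in>F. \<exists>c. br y v = c *\<^sub>C v} = UNIV"
  using assms
proof (induction F rule: finite_induct)
  case (insert x F)
  let ?J = "{v. \<forall>y\<in>insert x F. \<exists>c. br y v = c *\<^sub>C v}"
  have "v \<in> cvec.span ?J" if v: "\<forall>y\<in>F. \<exists>c. br y v = c *\<^sub>C v" for v
  proof -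
    obtain u where u: "\<And>c. Poly_Mapping.lookup u c \<in> gen_eigenspace (br x) c" "family_sum u = v"
      using in_span_Union_imp_family_sum[of "gen_eigenspace (br x)" v, OF subspace_gen_eigenspace[OF ad_clinear]]
        gen_eigenspaces_span[OF fd ad_clinear, of x] by auto
    have xu: "br x (Poly_Mapping.lookup u c) = c *\<^sub>C Poly_Mapping.lookup u c" for c
      by (rule ad_semisimple[OF _ u(1)]) (use insert.prems in blast)
    have "Poly_Mapping.lookup u d \<in> ?J" for d
    proof -
      have "\<exists>c. br y (Poly_Mapping.lookup u d) = c *\<^sub>C Poly_Mapping.lookup u d" if "y \<in> F" for y
      proof -
        from v that obtain c where c: "br y v = c *\<^sub>C v" by (auto dest: bspec)
        obtain u' where u': "\<And>i. Poly_Mapping.lookup u' i = br y (Poly_Mapping.lookup u i)"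
          "family_sum u' = family_lift (\<lambda>_. br y) u"
          using family_map[of "\<lambda>_. br y" u, OF clinear_zero[OF ad_clinear]] by auto
        have "br y (family_sum u) = family_sum u'"
          unfolding u'(2) by (simp add: family_lift_def clinear_sum[OF ad_clinear])
        then have "family_sum u' = family_sum (c *\<^sub>C u)" by (simp add: c u(2) clinear_scale[OF clinear_family_sum])
        moreover have "Poly_Mapping.lookup u' i \<in> gen_eigenspace (br x) i" for i
        proof (rule eigenvector_in_gen_eigenspace[OF ad_clinear])
          have "br x y = 0" using h_abelian insert.prems that by blast
          then show "br x (Poly_Mapping.lookup u' i) = i *\<^sub>C Poly_Mapping.lookup u' i"
            using ad_bracket[of x y "Poly_Mapping.lookup u i"] by (simp add: u' xu br_simps)
        qed
        moreover have "Poly_Mapping.lookup (c *\<^sub>C u) i \<in> gen_eigenspace (br x) i" for i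
          using u(1) by (simp add: lookup_scaleC cvec.subspace_scale subspace_gen_eigenspace[OF ad_clinear])
        ultimately have "u' = c *\<^sub>C u" by (intro gen_eigenspaces_unique[OF ad_clinear])
        then have "br y (Poly_Mapping.lookup u d) = c *\<^sub>C Poly_Mapping.lookup u d"
          using u'(1)[of d] by (simp add: lookup_scaleC)
        then show ?thesis by blast
      qed
      then show ?thesis using xu by blast
    qed
    then have "family_sum u \<in> cvec.span ?J" unfolding family_lift_def by (intro cvec.span_sum cvec.span_base)
    then show ?thesis using u(2) by simp
  qed
  then have "{v. \<forall>y\<in>F. \<exists>c. br y v = c *\<^sub>C v} \<subseteq> cvec.span ?J" by blast
  then have "cvec.span {v. \<forall>y\<in>F. \<exists>c. br y v = c *\<^sub>C v} \<subseteq> cvec.span ?J"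
    by (rule cvec.span_minimal) simp
  then show ?case using insert by auto
qed simp

lemma joint_eigenvector_weight:
  assumes "v \<noteq> 0" "\<And>y. y \<in> h \<Longrightarrow> \<exists>c. br y v = c *\<^sub>C v"
  shows "\<exists>\<chi>\<in>dual_space h. v \<in> root_space br h \<chi>"
proof -
  define \<chi> where "\<chi> y = (if y \<in> h then SOME c. br y v = c *\<^sub>C v else 0)" for y
  have \<chi>: "br y v = \<chi> y *\<^sub>C v" if "y \<in> h" for y
    using someI_ex[OF assms(2)[OF that]] that by (simp add: \<chi>_def)
  have inj: "c = d" if "c *\<^sub>C v = d *\<^sub>C v" for c d using that assms(1) by simp
  have "\<chi> \<in> dual_space h"
    unfolding dual_space_def
  proof (intro CollectI conjI ballI allI impI)
    fix x y assume "x \<in> h" "y \<in> h"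
    then show "\<chi> (x + y) = \<chi> x + \<chi> y"
      by (intro inj) (simp add: \<chi>[symmetric] scaleC_add_left br_simps cvec.subspace_add[OF h_subspace])
  next
    fix c x assume "x \<in> h"
    then show "\<chi> (c *\<^sub>C x) = c * \<chi> x"
      by (intro inj) (simp add: \<chi>[symmetric] scaleC_scaleC[symmetric] br_simps cvec.subspace_scale[OF h_subspace])
  qed (simp add: \<chi>_def)
  then show ?thesis using \<chi> by (auto simp: root_space_def)
qed

lemma weight_vectors_span: "cvec.span (\<Union>\<chi>\<in>dual_space h. root_space br h \<chi>) = UNIV"
proof -
  obtain B where B: "B \<subseteq> h" "\<not> cvec.dependent B" "h \<subseteq> cvec.span B"
    using cvec.maximal_independent_subset[of h] by blast
  have finB: "finite B" using finite_dimensional_independent_finite[OF fd B(2)] .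
  have "v \<in> cvec.span (\<Union>\<chi>\<in>dual_space h. root_space br h \<chi>)" if v: "\<forall>y\<in>B. \<exists>c. br y v = c *\<^sub>C v" for v
  proof (cases "v = 0")
    case False
    have "\<exists>c. br y v = c *\<^sub>C v" if "y \<in> cvec.span B" for y
      using that
    proof (induction rule: cvec.span_induct_alt)
      case base
      then show ?case by (intro exI[of _ 0]) (simp add: br_simps)
    next
      case (step a x y)
      then obtain c d where "br x v = c *\<^sub>C v" "br y v = d *\<^sub>C v" using v by blast
      then have "br (a *\<^sub>C x + y) v = (a * c + d) *\<^sub>C v"
        by (simp add: br_simps scaleC_add_left scaleC_scaleC)
      then show ?case by blast
    qed
    then have "\<And>y. y \<in> h \<Longrightarrow> \<exists>c. br y v = c *\<^sub>C v" using B(3) by blast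
    from joint_eigenvector_weight[OF False this] show ?thesis by (meson UN_I cvec.span_base)
  qed (simp add: cvec.span_zero)
  then have "{v. \<forall>y\<in>B. \<exists>c. br y v = c *\<^sub>C v} \<subseteq> cvec.span (\<Union>\<chi>\<in>dual_space h. root_space br h \<chi>)" by blast
  then have "cvec.span {v. \<forall>y\<in>B. \<exists>c. br y v = c *\<^sub>C v} \<subseteq> cvec.span (\<Union>\<chi>\<in>dual_space h. root_space br h \<chi>)"
    by (rule cvec.span_minimal) simp
  then show ?thesis using joint_eigenvectors_span[OF finB B(1)] by auto
qed

lemma root_space_killing_orthogonal:
  assumes "u \<in> root_space br h \<chi>" "v \<in> root_space br h \<psi>" "y \<in> h" "\<chi> y + \<psi> y \<noteq> 0"
  shows "\<kappa> u v = 0"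
proof -
  have "\<kappa> (br u y) v = \<kappa> u (br y v)" by (rule killing_invariant)
  moreover have "br u y = - (\<chi> y *\<^sub>C u)" using br_skew[of u y] assms by (simp add: root_space_def)
  moreover have "br y v = \<psi> y *\<^sub>C v" using assms by (simp add: root_space_def)
  ultimately have "- (\<chi> y * \<kappa> u v) = \<psi> y * \<kappa> u v"
    by (simp add: cbilinear_simps[OF killing_cbilinear] scaleC_complex_def)
  then have "(\<chi> y + \<psi> y) * \<kappa> u v = 0" by (simp add: distrib_right add_eq_0_iff)
  then show ?thesis using assms(4) by simp
qed

text \<open>By orthogonality, a root vector for \<open>\<alpha>\<close> can pair to a nonzero value only with weight vectors of
  weight \<open>- \<alpha>\<close>; nondegeneracy provides one.\<close>

lemma roots_uminus:
  assumes "\<alpha> \<in> roots br h"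
  shows "- \<alpha> \<in> roots br h"
proof -
  have \<alpha>: "\<alpha> \<in> dual_space h" "\<alpha> \<noteq> 0" "root_space br h \<alpha> \<noteq> {0}" using assms by (auto simp: roots_def)
  have neg: "- \<alpha> \<in> dual_space h" using \<alpha>(1) by (rule cvec.subspace_neg[OF dual_space_subspace])
  have "0 \<in> root_space br h \<alpha>" by (simp add: root_space_def br_simps)
  then obtain u where u: "u \<in> root_space br h \<alpha>" "u \<noteq> 0" using \<alpha>(3) by blast
  have "\<exists>v \<chi>. \<chi> \<in> dual_space h \<and> v \<in> root_space br h \<chi> \<and> \<kappa> u v \<noteq> 0"
  proof (rule ccontr)
    assume "\<nexists>v \<chi>. \<chi> \<in> dual_space h \<and> v \<in> root_space br h \<chi> \<and> \<kappa> u v \<noteq> 0"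
    then have z: "\<kappa> u v = 0" if "v \<in> (\<Union>\<chi>\<in>dual_space h. root_space br h \<chi>)" for v using that by blast
    have "\<kappa> u y = 0" for y
      by (rule clinear_eq_on_span[OF cbilinear_right[OF killing_cbilinear] clinear_const_zero z,
            where X = "\<Union>\<chi>\<in>dual_space h. root_space br h \<chi>"]) (simp_all add: weight_vectors_span)
    then show False using nondeg u(2) by blast
  qed
  then obtain v \<chi> where v: "\<chi> \<in> dual_space h" "v \<in> root_space br h \<chi>" "\<kappa> u v \<noteq> 0" by blast
  have "\<chi> = - \<alpha>"
  proof
    fix y
    show "\<chi> y = (- \<alpha>) y"
    proof (cases "y \<in> h")
      case True
      then have "\<alpha> y + \<chi> y = 0" using root_space_killing_orthogonal[OF u(1) v(2)] v(3) by blast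
      then show ?thesis by (simp add: add_eq_0_iff)
    qed (use v(1) \<alpha>(1) in \<open>simp add: dual_space_def\<close>)
  qed
  moreover have "v \<noteq> 0" using v(3) by (auto simp: cbilinear_simps[OF killing_cbilinear])
  ultimately show ?thesis using neg \<alpha>(2) v(2) by (auto simp: roots_def)
qed

theorem triangular_decomposition:
  "cvec.span (h \<union> (\<Union>\<alpha>\<in>\<Delta>p. root_space br h \<alpha>) \<union> (\<Union>\<alpha>\<in>\<Delta>p. root_space br h (- \<alpha>))) = UNIV"
    (is "cvec.span ?X = _")
proof -
  have "v \<in> cvec.span ?X" if \<chi>: "\<chi> \<in> dual_space h" and v: "v \<in> root_space br h \<chi>" for \<chi> v
  proof (cases "v = 0 \<or> \<chi> = 0")
    case True
    have "v \<in> h" if "\<chi> = 0"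
    proof (rule centralizer_in_h)
      fix y assume "y \<in> h"
      then have "br y v = 0" using v that by (simp add: root_space_def)
      then show "br v y = 0" by (subst br_skew) simp
    qed
    then show ?thesis using True by (auto simp: cvec.span_zero cvec.span_base)
  next
    case False
    then have r: "\<chi> \<in> roots br h" using \<chi> v by (auto simp: roots_def)
    then consider "nonneg_comb S \<chi>" | "nonneg_comb S (- \<chi>)" using base by (auto simp: root_base_def)
    then have "v \<in> ?X"
    proof cases
      case 2
      then have "- \<chi> \<in> \<Delta>p" using roots_uminus[OF r] by (simp add: pos)
      then show ?thesis using v by (metis UN_I UnI2 minus_minus)
    qed (use r v pos in auto)
    then show ?thesis by (rule cvec.span_base)
  qed
  then have "cvec.span (\<Union>\<chi>\<in>dual_space h. root_space br h \<chi>) \<subseteq> cvec.span ?X"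
    by (intro cvec.span_minimal) auto
  then show ?thesis using weight_vectors_span by auto
qed

lemma nonneg_comb_add: "nonneg_comb S \<beta> \<Longrightarrow> nonneg_comb S \<gamma> \<Longrightarrow> nonneg_comb S (\<beta> + \<gamma>)"
proof -
  assume "nonneg_comb S \<beta>" "nonneg_comb S \<gamma>"
  then obtain m n :: "('g \<Rightarrow> complex) \<Rightarrow> nat"
    where "\<beta> = (\<Sum>\<alpha>\<in>S. of_nat (m \<alpha>) *\<^sub>C \<alpha>)" "\<gamma> = (\<Sum>\<alpha>\<in>S. of_nat (n \<alpha>) *\<^sub>C \<alpha>)"
    unfolding nonneg_comb_def by blast
  then have "\<beta> + \<gamma> = (\<Sum>\<alpha>\<in>S. of_nat (m \<alpha> + n \<alpha>) *\<^sub>C \<alpha>)"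
    by (simp only: of_nat_add scaleC_add_left sum.distrib)
  then show ?thesis unfolding nonneg_comb_def by (intro exI[of _ "\<lambda>\<alpha>. m \<alpha> + n \<alpha>"]) simp
qed

lemma nonneg_comb_sum_zero:
  assumes "nonneg_comb S \<beta>" "nonneg_comb S \<gamma>" "\<beta> + \<gamma> = 0"
  shows "\<beta> = 0"
proof -
  obtain m n :: "('g \<Rightarrow> complex) \<Rightarrow> nat"
    where mn: "\<beta> = (\<Sum>\<alpha>\<in>S. of_nat (m \<alpha>) *\<^sub>C \<alpha>)" "\<gamma> = (\<Sum>\<alpha>\<in>S. of_nat (n \<alpha>) *\<^sub>C \<alpha>)"
    using assms unfolding nonneg_comb_def by blast
  have "(\<Sum>\<alpha>\<in>S. of_nat (m \<alpha> + n \<alpha>) *\<^sub>C \<alpha>) = 0"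
    using assms(3) by (simp only: mn of_nat_add scaleC_add_left sum.distrib)
  moreover have S: "finite S" "\<not> cvec.dependent S" using base by (auto simp: root_base_def)
  ultimately have "of_nat (m \<alpha> + n \<alpha>) = (0::complex)" if "\<alpha> \<in> S" for \<alpha>
    using cvec.independentD[OF S(2) S(1) order_refl, of "\<lambda>\<alpha>. of_nat (m \<alpha> + n \<alpha>)" \<alpha>] that by blast
  then have "m \<alpha> = 0" if "\<alpha> \<in> S" for \<alpha> using that by (metis add_eq_0_iff_both_eq_0 of_nat_eq_0_iff)
  then show ?thesis unfolding mn by simp
qed

lemma sum_list_positive_roots_nonzero:
  assumes "set \<beta>s \<subseteq> \<Delta>p" "\<beta>s \<noteq> []"
  shows "sum_list \<beta>s \<noteq> 0"
proof -
  have nn: "set \<beta>s \<subseteq> \<Delta>p \<Longrightarrow> nonneg_comb S (sum_list \<beta>s)" for \<beta>s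
  proof (induction \<beta>s)
    case Nil
    show ?case unfolding nonneg_comb_def by (rule exI[of _ "\<lambda>_. 0"]) simp
  qed (use pos in \<open>auto intro: nonneg_comb_add\<close>)
  obtain \<beta> \<beta>s' where \<beta>s: "\<beta>s = \<beta> # \<beta>s'" using assms(2) by (cases \<beta>s) auto
  then have "\<beta> \<noteq> 0" "nonneg_comb S \<beta>" using assms(1) pos by (auto simp: roots_def)
  then show ?thesis using nonneg_comb_sum_zero[of \<beta> "sum_list \<beta>s'"] nn[of \<beta>s'] assms(1) \<beta>s by auto
qed

end

text \<open>By invariance the radical of the Killing form is an ideal; simplicity leaves only \<open>0\<close> once the form
  is nonzero.\<close>

lemma simple_nondegenerate:
  assumes "finite_dimensional TYPE('g::complex_vec)" "simple_lie_algebra (br :: 'g \<Rightarrow> 'g \<Rightarrow> 'g)"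
    and "killing_form br x0 y0 \<noteq> 0"
  shows "nondegenerate_lie_algebra br"
proof -
  interpret fd_lie_algebra br
    using assms by unfold_locales (auto simp: simple_lie_algebra_def)
  let ?I = "{x. \<forall>y. \<kappa> x y = 0}"
  have "cvec.subspace ?I"
    by (rule cvec.subspaceI) (auto simp: cbilinear_simps[OF killing_cbilinear])
  moreover have "br x y \<in> ?I" if "y \<in> ?I" for x y
    using that killing_invariant[of y x] br_skew[of x y] by (simp add: cbilinear_simps[OF killing_cbilinear])
  ultimately have "?I = {0} \<or> ?I = UNIV" using assms(2) unfolding simple_lie_algebra_def by blast
  moreover have "x0 \<notin> ?I" using assms(3) by blast
  ultimately have "?I = {0}" by blast
  then show ?thesis by unfold_locales blast
qed


section \<open>Tensor products\<close>

lemma tens_eq_iff_rel: "tensor_rel p q \<longleftrightarrow> abs_tensor p = abs_tensor q"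
  by (rule tensor.abs_eq_iff[symmetric])

lemma tensor_relations_null:
  assumes "r \<in> tensor_relations"
  shows "abs_tensor r = 0"
proof -
  have "tensor_rel r 0" using assms by (simp add: tensor_rel_def cvec.span_base)
  then show ?thesis by (simp add: tens_eq_iff_rel zero_tensor_def)
qed

lemma abs_tensor_clinear: "clinear abs_tensor"
  by (rule clinearI) (simp_all add: plus_tensor.abs_eq scaleC_tensor.abs_eq)

lemma tens_abs: "x \<otimes>\<^sub>C y = abs_tensor (Poly_Mapping.single (x, y) 1)"
  by (simp add: tens_def)

lemma tens_cbilinear: "cbilinear (\<otimes>\<^sub>C)"
proof -
  note L = clinear_simps[OF abs_tensor_clinear]
  have "(x + y) \<otimes>\<^sub>C z = x \<otimes>\<^sub>C z + y \<otimes>\<^sub>C z" for x y :: 'a and z :: 'b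
    using tensor_relations_null[of "Poly_Mapping.single (x + y, z) 1 - Poly_Mapping.single (x, z) 1
        - Poly_Mapping.single (y, z) 1"]
    unfolding tensor_relations_def by (force simp: L tens_abs algebra_simps)
  moreover have "x \<otimes>\<^sub>C (y + z) = x \<otimes>\<^sub>C y + x \<otimes>\<^sub>C z" for x :: 'a and y z :: 'b
    using tensor_relations_null[of "Poly_Mapping.single (x, y + z) 1 - Poly_Mapping.single (x, y) 1
        - Poly_Mapping.single (x, z) 1"]
    unfolding tensor_relations_def by (force simp: L tens_abs algebra_simps)
  moreover have "(c *\<^sub>C x) \<otimes>\<^sub>C y = c *\<^sub>C (x \<otimes>\<^sub>C y)" for c and x :: 'a and y :: 'b
    using tensor_relations_null[of "Poly_Mapping.single (c *\<^sub>C x, y) 1 - c *\<^sub>C Poly_Mapping.single (x, y) 1"]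
    unfolding tensor_relations_def by (force simp: L tens_abs)
  moreover have "x \<otimes>\<^sub>C (c *\<^sub>C y) = c *\<^sub>C (x \<otimes>\<^sub>C y)" for c and x :: 'a and y :: 'b
    using tensor_relations_null[of "Poly_Mapping.single (x, c *\<^sub>C y) 1 - c *\<^sub>C Poly_Mapping.single (x, y) 1"]
    unfolding tensor_relations_def by (force simp: L tens_abs)
  ultimately show ?thesis by (intro cbilinearI clinearI)
qed

lemmas tens_simps = cbilinear_simps[OF tens_cbilinear]

lemma tens_clinear: "clinear (\<lambda>x. x \<otimes>\<^sub>C y)" "clinear (\<lambda>y. x \<otimes>\<^sub>C y)"
  by (rule cbilinear_left[OF tens_cbilinear], rule cbilinear_right[OF tens_cbilinear])

lemma in_pure_tensors_span:
  fixes T :: "('a::complex_vec, 'b::complex_vec) tensor"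
  shows "T \<in> cvec.span {x \<otimes>\<^sub>C y |x y. True}"
proof -
    obtain p where T: "T = abs_tensor p" by (metis Quotient_abs_rep[OF Quotient_tensor])
    have "abs_tensor p = (\<Sum>i\<in>Poly_Mapping.keys p. abs_tensor (Poly_Mapping.single i (Poly_Mapping.lookup p i)))"
      by (subst family_as_sum[of p]) (simp only: clinear_sum[OF abs_tensor_clinear])
    moreover have "abs_tensor (Poly_Mapping.single i c) = c *\<^sub>C (fst i \<otimes>\<^sub>C snd i)" for i :: "'a \<times> 'b" and c
      unfolding tens_abs clinear_scale[OF abs_tensor_clinear, symmetric]
      by (simp add: scaleC_single scaleC_complex_def)
    ultimately have "T = (\<Sum>i\<in>Poly_Mapping.keys p. Poly_Mapping.lookup p i *\<^sub>C (fst i \<otimes>\<^sub>C snd i))"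
      by (simp add: T)
    also have "\<dots> \<in> cvec.span {x \<otimes>\<^sub>C y |x y. True}"
      by (intro cvec.span_sum cvec.span_scale cvec.span_base) blast
    finally show ?thesis .
qed

text \<open>The universal property of the tensor product.  The extension to the free vector space is
  evaluated at a representative; for bilinear \<open>\<beta>\<close> it vanishes on the tensor relations, so the value does
  not depend on the representative.\<close>

definition tensor_lift :: "('a::complex_vec \<Rightarrow> 'b::complex_vec \<Rightarrow> 'c::complex_vec) \<Rightarrow> ('a, 'b) tensor \<Rightarrow> 'c" where
  "tensor_lift \<beta> T = family_lift (\<lambda>i c. c *\<^sub>C \<beta> (fst i) (snd i)) (rep_tensor T)"

lemma tensor_lift_abs:
  assumes \<beta>: "cbilinear \<beta>"
  shows "tensor_lift \<beta> (abs_tensor p) = family_lift (\<lambda>i c. c *\<^sub>C \<beta> (fst i) (snd i)) p"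
proof -
  let ?F = "family_lift (\<lambda>i c. c *\<^sub>C \<beta> (fst i) (snd i))"
  have F: "clinear ?F" by (intro clinear_family_lift clinear_scale_left)
  have single: "?F (Poly_Mapping.single i c) = c *\<^sub>C \<beta> (fst i) (snd i)" for i c
    by (rule family_lift_single) simp
  have "?F r = 0" if "r \<in> tensor_relations" for r
    using that unfolding tensor_relations_def
    by (auto simp: clinear_simps[OF F] single scaleC_one cbilinear_simps[OF \<beta>])
  then have "?F r = 0" if "r \<in> cvec.span tensor_relations" for r
    by (rule clinear_eq_on_span[OF F clinear_const_zero _ that])
  moreover have "rep_tensor (abs_tensor p) - p \<in> cvec.span tensor_relations"
    using tens_eq_iff_rel[of "rep_tensor (abs_tensor p)" p] Quotient_abs_rep[OF Quotient_tensor]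
    by (simp add: tensor_rel_def)
  ultimately have "?F (rep_tensor (abs_tensor p) - p) = 0" by blast
  then show ?thesis by (simp add: tensor_lift_def clinear_diff[OF F])
qed

lemma tensor_lift_tens: "cbilinear \<beta> \<Longrightarrow> tensor_lift \<beta> (x \<otimes>\<^sub>C y) = \<beta> x y"
  unfolding tens_abs by (simp add: tensor_lift_abs family_lift_single scaleC_one)

lemma tensor_lift_clinear:
  assumes \<beta>: "cbilinear \<beta>"
  shows "clinear (tensor_lift \<beta>)"
proof -
  have F: "clinear (family_lift (\<lambda>i c. c *\<^sub>C \<beta> (fst i) (snd i)))"
    by (intro clinear_family_lift clinear_scale_left)
  have ex: "\<exists>p. T = abs_tensor p" for T :: "('a, 'b) tensor"
    by (metis Quotient_abs_rep[OF Quotient_tensor])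
  show ?thesis
  proof (rule clinearI)
    fix S T :: "('a, 'b) tensor" and c
    obtain p q where "S = abs_tensor p" "T = abs_tensor q" using ex by blast
    then show "tensor_lift \<beta> (S + T) = tensor_lift \<beta> S + tensor_lift \<beta> T"
      "tensor_lift \<beta> (c *\<^sub>C S) = c *\<^sub>C tensor_lift \<beta> S"
      by (simp_all add: tensor_lift_abs[OF \<beta>] clinear_simps[OF F]
          flip: clinear_add[OF abs_tensor_clinear] clinear_scale[OF abs_tensor_clinear])
  qed
qed



type_synonym ('w, 'v) loop_tensor = "(('w, 'v) tensor, laurent) tensor"

lemma laurent_span: "cvec.span (range t_pow) = UNIV"
proof -
  have "p \<in> cvec.span (range t_pow)" for p
  proof -
    have "p = (\<Sum>i\<in>Poly_Mapping.keys p. Poly_Mapping.lookup p i *\<^sub>C t_pow i)"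
      using family_as_sum[of p] by (simp add: scaleC_single scaleC_complex_def)
    also have "\<dots> \<in> cvec.span (range t_pow)"
      by (intro cvec.span_sum cvec.span_scale cvec.span_base) blast
    finally show ?thesis .
  qed
  then show ?thesis by blast
qed

lemma in_loop_tensor_span:
  fixes T :: "('w::complex_vec, 'v::complex_vec) loop_tensor"
  assumes W: "cvec.span (X :: 'w set) = UNIV"
  shows "T \<in> cvec.span {w \<otimes>\<^sub>C v \<otimes>\<^sub>C t_pow n |w v n. w \<in> X}" (is "_ \<in> cvec.span ?P")
proof -
  have 1: "w \<otimes>\<^sub>C v \<otimes>\<^sub>C t_pow n \<in> cvec.span ?P" for w :: 'w and v :: 'v and n
    by (rule clinear_span_image[where f = "\<lambda>w. w \<otimes>\<^sub>C v \<otimes>\<^sub>C t_pow n" and X = X])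
      (auto simp: W intro!: clinear_compose[OF tens_clinear(1)] tens_clinear cvec.span_base)
  have 2: "S \<otimes>\<^sub>C t_pow n \<in> cvec.span ?P" for S :: "('w, 'v) tensor" and n
    by (rule clinear_span_image[OF tens_clinear(1) cvec.subspace_span _ in_pure_tensors_span]) (use 1 in blast)
  have 3: "S \<otimes>\<^sub>C p \<in> cvec.span ?P" for S :: "('w, 'v) tensor" and p :: laurent
    by (rule clinear_span_image[where f = "\<lambda>p. S \<otimes>\<^sub>C p" and X = "range t_pow"])
      (use 2 in \<open>auto simp: laurent_span tens_clinear\<close>)
  show ?thesis
    by (rule clinear_span_image[OF clinear_ident cvec.subspace_span _ in_pure_tensors_span]) (use 3 in blast)
qed

lemma clinear_eq_on_loop_tensor:
  fixes F H :: "('w::complex_vec, 'v::complex_vec) loop_tensor \<Rightarrow> 'c::complex_vec"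
  assumes "clinear F" "clinear H" "\<And>w v n. F (w \<otimes>\<^sub>C v \<otimes>\<^sub>C t_pow n) = H (w \<otimes>\<^sub>C v \<otimes>\<^sub>C t_pow n)"
  shows "F T = H T"
  by (rule clinear_eq_on_span[OF assms(1,2) _ in_loop_tensor_span[OF cvec.span_UNIV]]) (use assms(3) in blast)

text \<open>Contractions to a single factor.  Those to \<open>V\<close> by the coordinate functionals of \<open>W\<close> separate
  the points of the tensor product; those to \<open>W\<close> recover an operator on \<open>W\<close> from one on the tensor
  product.\<close>

definition contract1 :: "('w::complex_vec \<Rightarrow> complex) \<Rightarrow> int \<Rightarrow> ('w, 'v::complex_vec) loop_tensor \<Rightarrow> 'v" where
  "contract1 \<xi> n = tensor_lift (\<lambda>S p. Poly_Mapping.lookup p n *\<^sub>C tensor_lift (\<lambda>w v. \<xi> w *\<^sub>C v) S)"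

definition contract2 :: "('v::complex_vec \<Rightarrow> complex) \<Rightarrow> int \<Rightarrow> ('w::complex_vec, 'v) loop_tensor \<Rightarrow> 'w" where
  "contract2 \<eta> n = tensor_lift (\<lambda>S p. Poly_Mapping.lookup p n *\<^sub>C tensor_lift (\<lambda>w v. \<eta> v *\<^sub>C w) S)"

lemma contraction_bilinear:
  assumes "cbilinear \<beta>"
  shows "cbilinear (\<lambda>S p. Poly_Mapping.lookup p (n::int) *\<^sub>C tensor_lift \<beta> S)"
  by (intro cbilinearI clinear_scaled tensor_lift_clinear[OF assms]
      clinear_compose[OF clinear_scale_left] lookup_clinear)

lemma scaled_bilinear:
  assumes "clinear \<xi>"
  shows "cbilinear (\<lambda>w v. \<xi> w *\<^sub>C v)" "cbilinear (\<lambda>w v. \<xi> v *\<^sub>C w)"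
  by (intro cbilinearI clinear_scaled clinear_ident clinear_compose[OF clinear_scale_left] assms)+

lemma contract1_clinear: "clinear \<xi> \<Longrightarrow> clinear (contract1 \<xi> n)"
  and contract2_clinear: "clinear \<eta> \<Longrightarrow> clinear (contract2 \<eta> n)"
  unfolding contract1_def contract2_def
  by (intro tensor_lift_clinear contraction_bilinear scaled_bilinear; assumption)+

lemma contract1_pure:
  "clinear \<xi> \<Longrightarrow> contract1 \<xi> n (w \<otimes>\<^sub>C v \<otimes>\<^sub>C t_pow m) = (if m = n then \<xi> w *\<^sub>C v else 0)"
  and contract2_pure:
  "clinear \<eta> \<Longrightarrow> contract2 \<eta> n (w \<otimes>\<^sub>C v \<otimes>\<^sub>C t_pow m) = (if m = n then \<eta> v *\<^sub>C w else 0)"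
  unfolding contract1_def contract2_def
  by (simp_all add: tensor_lift_tens contraction_bilinear scaled_bilinear lookup_single when_def scaleC_one)

lemma contract_swap:
  assumes "clinear \<xi>" "clinear \<eta>"
  shows "\<xi> (contract2 \<eta> n T) = \<eta> (contract1 \<xi> n T)"
proof (rule clinear_eq_on_loop_tensor)
  show "clinear (\<lambda>T. \<xi> (contract2 \<eta> n T))" "clinear (\<lambda>T. \<eta> (contract1 \<xi> n T))"
    using assms by (auto intro: clinear_compose contract1_clinear contract2_clinear)
qed (simp add: contract1_pure[OF assms(1)] contract2_pure[OF assms(2)] clinear_zero[OF assms(1)]
    clinear_zero[OF assms(2)] clinear_scale[OF assms(1)] clinear_scale[OF assms(2)] scaleC_complex_def)

abbreviation coord :: "'a::complex_vec \<Rightarrow> 'a \<Rightarrow> complex" where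
  "coord b v \<equiv> cvec.representation (cvec.extend_basis {}) v b"

lemma basis_props:
  "\<not> cvec.dependent (cvec.extend_basis {} :: 'a::complex_vec set)"
  "cvec.span (cvec.extend_basis {} :: 'a set) = UNIV"
  by (rule cvec.independent_extend_basis[OF cvec.independent_empty],
      rule cvec.span_extend_basis[OF cvec.independent_empty])

lemma coord_clinear: "clinear (coord b)"
  by (rule representation_clinear) (rule basis_props)+

lemma coord_basis:
  "b' \<in> cvec.extend_basis {} \<Longrightarrow> coord b b' = (if b = b' then 1 else 0)"
  using cvec.representation_basis[OF basis_props(1), of b'] by auto



text \<open>A tensor is a finite sum of terms \<open>b \<otimes> v \<otimes> t\<^sup>n\<close>, one for each pair of a basis vector \<open>b\<close> and
  an exponent \<open>n\<close>; contraction picks out the vectors \<open>v\<close>.\<close>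

lemma loop_tensor_eqI:
  fixes T T' :: "('w::complex_vec, 'v::complex_vec) loop_tensor"
  assumes "\<And>b n. contract1 (coord b) n T = contract1 (coord b) n T'"
  shows "T = T'"
proof -
  let ?B = "cvec.extend_basis {} :: 'w set"
  note lin = contract1_clinear[OF coord_clinear]
  let ?E = "\<lambda>u. family_lift (\<lambda>(b, n) v. b \<otimes>\<^sub>C v \<otimes>\<^sub>C t_pow n) u :: ('w, 'v) loop_tensor"
  have E: "clinear ?E"
    by (rule clinear_family_lift) (auto intro!: clinear_compose[OF tens_clinear(1)] tens_clinear)
  have E1: "?E (Poly_Mapping.single (b, n) v) = b \<otimes>\<^sub>C v \<otimes>\<^sub>C t_pow n" for b v n
    by (subst family_lift_single) (auto simp: tens_simps)
  have expand: "\<exists>u. Poly_Mapping.keys u \<subseteq> ?B \<times> UNIV \<and> T = ?E u" for T :: "('w, 'v) loop_tensor"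
  proof -
    have "T \<in> cvec.span {w \<otimes>\<^sub>C v \<otimes>\<^sub>C t_pow n |w v n. w \<in> ?B}" by (rule in_loop_tensor_span[OF basis_props(2)])
    then show ?thesis
    proof (induction rule: cvec.span_induct_alt)
      case base
      show ?case by (rule exI[of _ 0]) (simp add: clinear_zero[OF E])
    next
      case (step c x y)
      then obtain b v n u where x: "x = b \<otimes>\<^sub>C v \<otimes>\<^sub>C t_pow n" "b \<in> ?B"
        and u: "Poly_Mapping.keys u \<subseteq> ?B \<times> UNIV" "y = ?E u" by blast
      have "c *\<^sub>C x + y = ?E (Poly_Mapping.single (b, n) (c *\<^sub>C v) + u)"
        unfolding clinear_add[OF E] E1 x(1) u(2) tens_simps ..
      moreover have "Poly_Mapping.keys (Poly_Mapping.single (b, n) (c *\<^sub>C v) + u) \<subseteq> ?B \<times> UNIV"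
        using Poly_Mapping.keys_add[of "Poly_Mapping.single (b, n) (c *\<^sub>C v)" u] u(1) x(2)
        by (auto split: if_splits)
      ultimately show ?case by blast
    qed
  qed
  obtain u where u: "Poly_Mapping.keys u \<subseteq> ?B \<times> UNIV" "T - T' = ?E u" using expand by blast
  have "Poly_Mapping.lookup u (b, n) = 0" for b n
  proof (cases "b \<in> ?B")
    case True
    have "0 = contract1 (coord b) n (T - T')" using assms by (simp add: clinear_diff[OF lin])
    also have "\<dots> = (\<Sum>i\<in>Poly_Mapping.keys u. contract1 (coord b) n (fst i \<otimes>\<^sub>C Poly_Mapping.lookup u i \<otimes>\<^sub>C t_pow (snd i)))"
      unfolding u(2) family_lift_def clinear_sum[OF lin] by (simp add: case_prod_beta)
    also have "\<dots> = (\<Sum>i\<in>Poly_Mapping.keys u. if i = (b, n) then Poly_Mapping.lookup u i else 0)"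
    proof (rule sum.cong[OF refl])
      fix i assume "i \<in> Poly_Mapping.keys u"
      then obtain a m where "i = (a, m)" "a \<in> ?B" using u(1) by blast
      then show "contract1 (coord b) n (fst i \<otimes>\<^sub>C Poly_Mapping.lookup u i \<otimes>\<^sub>C t_pow (snd i))
          = (if i = (b, n) then Poly_Mapping.lookup u i else 0)"
        by (auto simp: contract1_pure[OF coord_clinear] coord_basis scaleC_one)
    qed
    also have "\<dots> = Poly_Mapping.lookup u (b, n)" by (simp add: in_keys_iff)
    finally show ?thesis by simp
  qed (use u(1) in \<open>auto simp: in_keys_iff\<close>)
  then have "u = 0" by (intro poly_mapping_eqI) auto
  then have "T - T' = 0" using u(2) clinear_zero[OF E] by simp
  then show ?thesis by simp
qed


section \<open>The enveloping algebra\<close>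

lemma uea_act_family: "uea_act \<rho> P v = family_lift (\<lambda>xs a. a *\<^sub>C foldr \<rho> xs v) P"
  by (simp add: uea_act_def family_lift_def)

lemma uea_act_single: "uea_act \<rho> (Poly_Mapping.single xs a) v = a *\<^sub>C foldr \<rho> xs v"
  unfolding uea_act_family by (rule family_lift_single) simp

lemma uea_act_clinear: "clinear (\<lambda>P. uea_act \<rho> P v)"
  unfolding uea_act_family by (intro clinear_family_lift clinear_scale_left)

lemma two_sided_ideal_add:
  "p \<in> two_sided_ideal R \<Longrightarrow> q \<in> two_sided_ideal R \<Longrightarrow> p + q \<in> two_sided_ideal R"
  by (induction rule: two_sided_ideal.induct) (auto simp: add.assoc intro: two_sided_ideal.step)

lemma two_sided_ideal_mult:
  "p \<in> two_sided_ideal R \<Longrightarrow> x * p * y \<in> two_sided_ideal R"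
proof (induction rule: two_sided_ideal.induct)
  case (step r q x' y')
  have "x * (x' * r * y' + q) * y = (x * x') * r * (y' * y) + x * q * y"
    by (simp add: algebra_simps)
  then show ?case using step by (auto intro: two_sided_ideal.step)
qed (simp add: two_sided_ideal.zero)

lemma two_sided_ideal_base: "r \<in> R \<Longrightarrow> r \<in> two_sided_ideal R"
  using two_sided_ideal.step[of r R 0 1 1] two_sided_ideal.zero by auto

lemma left_ideal_base: "r \<in> R \<Longrightarrow> r \<in> left_ideal R"
  using left_ideal.step[of r R 0 1] left_ideal.zero by auto

text \<open>A monomial in eigenvectors of \<open>ad d\<^sub>0\<close> is homogeneous: \<open>d\<^sub>0\<close> is moved through one factor at a time.\<close>

lemma homogeneous_monomial:
  fixes br :: "'a::complex_vec \<Rightarrow> 'a \<Rightarrow> 'a" and ys :: "'a affvir list"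
  assumes "list_all2 (\<lambda>y n. affvir_bracket br frm (d_elt 0) y = of_int n *\<^sub>C y) ys ns"
  shows "homogeneous br frm (sum_list ns) (Poly_Mapping.single ys 1)"
  using assms
proof (induction rule: list_all2_induct)
  case Nil
  have "gen (d_elt 0) * Poly_Mapping.single [] 1 - Poly_Mapping.single [] 1 * gen (d_elt 0) = (0 :: 'a affvir free_algebra)"
    unfolding gen_def mult_single by (simp add: plus_list_def)
  then show ?case
    by (simp add: homogeneous_def uea_eq_def scal_def uea_ideal_def two_sided_ideal.zero)
next
  case (Cons y ys n ns)
  let ?b = "affvir_bracket br frm"
  let ?I = "uea_ideal ?b"
  let ?d = "gen (d_elt 0) :: 'a affvir free_algebra"
  let ?Q = "Poly_Mapping.single ys 1 :: 'a affvir free_algebra"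
  have prod: "Poly_Mapping.single (y # ys) 1 = gen y * ?Q"
    by (simp add: gen_def mult_single plus_list_def)
  have bracket: "?d * gen y - gen y * ?d - gen (?b (d_elt 0) y) \<in> ?I"
    unfolding uea_ideal_def by (rule two_sided_ideal_base) blast
  have scale: "gen (of_int n *\<^sub>C y) - scal (of_int n) * gen y \<in> ?I"
    unfolding uea_ideal_def by (rule two_sided_ideal_base) blast
  have "?d * gen y - gen y * ?d - scal (of_int n) * gen y \<in> ?I"
    using two_sided_ideal_add[OF bracket[unfolded uea_ideal_def] scale[unfolded uea_ideal_def]] Cons.hyps(1)
    by (simp add: uea_ideal_def)
  then have "1 * (?d * gen y - gen y * ?d - scal (of_int n) * gen y) * ?Q \<in> ?I"
    unfolding uea_ideal_def by (rule two_sided_ideal_mult)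
  moreover have "gen y * (?d * ?Q - ?Q * ?d - scal (of_int (sum_list ns)) * ?Q) * 1 \<in> ?I"
    using Cons.IH unfolding homogeneous_def uea_eq_def uea_ideal_def by (rule two_sided_ideal_mult)
  ultimately have "1 * (?d * gen y - gen y * ?d - scal (of_int n) * gen y) * ?Q
      + gen y * (?d * ?Q - ?Q * ?d - scal (of_int (sum_list ns)) * ?Q) * 1 \<in> ?I"
    unfolding uea_ideal_def by (rule two_sided_ideal_add)
  moreover have "gen y * (scal (of_int (sum_list ns)) * ?Q) = scal (of_int (sum_list ns)) * (gen y * ?Q)"
    by (simp add: gen_def scal_def mult_single plus_list_def)
  moreover have "scal (of_int (n + sum_list ns)) = scal (of_int n) + (scal (of_int (sum_list ns)) :: 'a affvir free_algebra)"
    by (simp add: scal_def single_add)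
  ultimately show ?case
    by (simp add: homogeneous_def uea_eq_def prod algebra_simps)
qed


section \<open>Generators of the affine-Virasoro algebra\<close>

lemma loop_elt_clinear: "clinear (\<lambda>x. loop_elt x n)"
  by (rule clinearI) (simp_all add: loop_elt_def scaleC_prod_def scaleC_single single_add zero_prod_def)

lemma affvir_generators_span:
  "(Z :: 'g::complex_vec affvir) \<in> cvec.span ({loop_elt x n |x n. True} \<union> range d_elt \<union> {k_elt, c_elt})"
    (is "_ \<in> cvec.span ?A")
proof -
  obtain X D a b where Z: "Z = (X, D, a, b)" by (metis prod.collapse)
  have 1: "clinear (\<lambda>X. (X, 0, 0, 0) :: 'g affvir)" "clinear (\<lambda>D. (0, D, 0, 0) :: 'g affvir)"
    by (auto intro!: clinearI simp: scaleC_prod_def)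
  have "(X, 0, 0, 0) = (\<Sum>i\<in>Poly_Mapping.keys X. loop_elt (Poly_Mapping.lookup X i) i)"
    by (subst family_as_sum[of X]) (simp add: clinear_sum[OF 1(1)] loop_elt_def)
  moreover have "\<dots> \<in> cvec.span ?A" by (intro cvec.span_sum cvec.span_base) auto
  moreover have "(0, D, 0, 0) = (\<Sum>i\<in>Poly_Mapping.keys D. Poly_Mapping.lookup D i *\<^sub>C (d_elt i :: 'g affvir))"
    by (subst family_as_sum[of D])
      (simp add: clinear_sum[OF 1(2)] d_elt_def scaleC_prod_def scaleC_single scaleC_complex_def)
  moreover have "\<dots> \<in> cvec.span ?A" by (intro cvec.span_sum cvec.span_scale cvec.span_base) auto
  moreover have "a *\<^sub>C k_elt \<in> cvec.span ?A" "b *\<^sub>C c_elt \<in> cvec.span ?A"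
    by (intro cvec.span_scale cvec.span_base; simp)+
  moreover have "Z = (X, 0, 0, 0) + (0, D, 0, 0) + a *\<^sub>C k_elt + b *\<^sub>C c_elt"
    by (simp add: Z k_elt_def c_elt_def scaleC_prod_def scaleC_complex_def)
  ultimately show ?thesis by (metis (no_types, lifting) cvec.span_add)
qed

lemma affvir_generators_induct:
  assumes "\<And>x n. loop_elt x n \<in> N" "\<And>n. d_elt n \<in> N" "k_elt \<in> N" "c_elt \<in> N" "cvec.subspace N"
  shows "Z \<in> N"
proof -
  have "cvec.span ({loop_elt x n |x n. True} \<union> range d_elt \<union> {k_elt, c_elt}) \<subseteq> N"
    by (rule cvec.span_minimal) (use assms in auto)
  then show ?thesis using affvir_generators_span by blast
qed


section \<open>Irreducible highest weight modules\<close>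

text \<open>Joint eigenvectors with weights different from \<open>\<chi>\<^sub>0\<close> cannot combine to a nonzero vector of
  weight \<open>\<chi>\<^sub>0\<close>: for a summand of weight \<open>\<chi>\<close> and an operator \<open>T\<close> with \<open>\<chi> T \<noteq> \<chi>\<^sub>0 T\<close>, applying
  \<open>T - \<chi> T\<close> removes that summand and multiplies the vector by a nonzero scalar.\<close>

lemma weight_not_in_span:
  assumes lin: "\<And>T. T \<in> \<T> \<Longrightarrow> clinear T"
    and X: "\<And>v. v \<in> X \<Longrightarrow> \<exists>\<chi>. (\<forall>T\<in>\<T>. T v = \<chi> T *\<^sub>C v) \<and> (\<exists>T\<in>\<T>. \<chi> T \<noteq> \<chi>\<^sub>0 T)"
    and w: "w \<in> cvec.span X" "\<And>T. T \<in> \<T> \<Longrightarrow> T w = \<chi>\<^sub>0 T *\<^sub>C w"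
  shows "w = 0"
proof -
  have "finite I \<Longrightarrow> I \<subseteq> X \<Longrightarrow> w = (\<Sum>v\<in>I. a v *\<^sub>C v) \<Longrightarrow> (\<And>T. T \<in> \<T> \<Longrightarrow> T w = \<chi>\<^sub>0 T *\<^sub>C w) \<Longrightarrow> w = 0" for I a w
  proof (induction I arbitrary: a w rule: finite_induct)
    case (insert v1 I)
    obtain wt where wt: "\<And>v T. v \<in> X \<Longrightarrow> T \<in> \<T> \<Longrightarrow> T v = wt v T *\<^sub>C v"
      "\<And>v. v \<in> X \<Longrightarrow> \<exists>T\<in>\<T>. wt v T \<noteq> \<chi>\<^sub>0 T" using X by metis
    obtain T where T: "T \<in> \<T>" "wt v1 T \<noteq> \<chi>\<^sub>0 T" using wt(2) insert.prems(1) by blast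
    let ?w = "(\<chi>\<^sub>0 T - wt v1 T) *\<^sub>C w"
    have Tw: "T w = (\<Sum>v\<in>insert v1 I. (a v * wt v T) *\<^sub>C v)"
      unfolding insert.prems(2) clinear_sum[OF lin[OF T(1)]]
    proof (rule sum.cong[OF refl])
      fix v assume "v \<in> insert v1 I"
      then have "T v = wt v T *\<^sub>C v" using wt(1) T(1) insert.prems(1) by blast
      then show "T (a v *\<^sub>C v) = (a v * wt v T) *\<^sub>C v" by (simp add: clinear_scale[OF lin[OF T(1)]] scaleC_scaleC)
    qed
    have "?w = T w - wt v1 T *\<^sub>C w"
      using insert.prems(3)[OF T(1)] by (simp add: cvec.scale_left_diff_distrib)
    also have "\<dots> = (\<Sum>v\<in>insert v1 I. (a v * wt v T - wt v1 T * a v) *\<^sub>C v)"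
      unfolding Tw unfolding insert.prems(2)
      by (simp only: cvec.scale_sum_right scaleC_scaleC cvec.scale_left_diff_distrib sum_subtractf)
    also have "\<dots> = (\<Sum>v\<in>I. (a v * wt v T - wt v1 T * a v) *\<^sub>C v)"
      using insert.hyps by (simp add: mult.commute)
    finally have eq: "?w = (\<Sum>v\<in>I. (a v * wt v T - wt v1 T * a v) *\<^sub>C v)" .
    have "?w = 0"
    proof (rule insert.IH[OF _ eq])
      show "T' ?w = \<chi>\<^sub>0 T' *\<^sub>C ?w" if "T' \<in> \<T>" for T'
        using insert.prems(3)[OF that] by (simp add: clinear_scale[OF lin[OF that]] scaleC_scaleC mult.commute)
    qed (use insert.prems in blast)
    then show ?case using T(2) by simp
  qed simp
  moreover obtain I a where "finite I" "I \<subseteq> X" "w = (\<Sum>v\<in>I. a v *\<^sub>C v)"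
    using w(1) unfolding cvec.span_explicit by blast
  ultimately show ?thesis using w(2) by blast
qed

locale highest_weight_module = cartan_setting br h S \<Delta>p
  for br :: "'g::complex_vec \<Rightarrow> 'g \<Rightarrow> 'g" and h S \<Delta>p +
  fixes frm :: "'g \<Rightarrow> 'g \<Rightarrow> complex" and lam :: "'g \<Rightarrow> complex" and l k c :: complex
    and \<rho> :: "'g affvir \<Rightarrow> 'w::complex_vec \<Rightarrow> 'w" and ub :: 'w
  assumes frm_bil: "cbilinear frm"
    and irr: "irreducible_module (affvir_bracket br frm) \<rho>"
    and ub_nonzero: "ub \<noteq> 0"
    and hw_plus: "\<And>y. y \<in> affvir_plus br h \<Delta>p \<Longrightarrow> \<rho> y ub = 0"
    and hw_h: "\<And>x. x \<in> h \<Longrightarrow> \<rho> (loop_elt x 0) ub = lam x *\<^sub>C ub"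
    and hw_d: "\<rho> (d_elt 0) ub = l *\<^sub>C ub"
    and hw_k: "\<rho> k_elt ub = k *\<^sub>C ub"
    and hw_c: "\<rho> c_elt ub = c *\<^sub>C ub"
begin

abbreviation "L_br \<equiv> affvir_bracket br frm"

lemmas bracket_rules = affvir_bracket_relations[OF bil frm_bil]

lemma rho_bil: "cbilinear \<rho>" and rho_bracket: "\<rho> (L_br x y) v = \<rho> x (\<rho> y v) - \<rho> y (\<rho> x v)"
  using irr unfolding irreducible_module_def lie_module_def by blast+

lemmas rho_simps = cbilinear_simps[OF rho_bil]

lemma rho_clinear: "clinear (\<rho> x)" and rho_clinear_left: "clinear (\<lambda>x. \<rho> x v)"
  by (rule cbilinear_right[OF rho_bil], rule cbilinear_left[OF rho_bil])

lemma rho_commute: "\<rho> x (\<rho> y v) = \<rho> (L_br x y) v + \<rho> y (\<rho> x v)"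
  by (simp add: rho_bracket)

lemma invariant_subspace_UNIV:
  assumes "cvec.subspace N" "ub \<in> N"
    and "\<And>x n v. v \<in> N \<Longrightarrow> \<rho> (loop_elt x n) v \<in> N" "\<And>n v. v \<in> N \<Longrightarrow> \<rho> (d_elt n) v \<in> N"
    and "\<And>v. v \<in> N \<Longrightarrow> \<rho> k_elt v \<in> N" "\<And>v. v \<in> N \<Longrightarrow> \<rho> c_elt v \<in> N"
  shows "v \<in> N"
proof -
  have "\<rho> Z v \<in> N" if v: "v \<in> N" for Z v
  proof -
    have sub: "cvec.subspace {Z. \<rho> Z v \<in> N}"
      by (rule cvec.subspaceI)
        (simp_all add: rho_simps cvec.subspace_0 cvec.subspace_add cvec.subspace_scale assms(1))
    have "Z \<in> {Z. \<rho> Z v \<in> N}"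
      by (rule affvir_generators_induct) (simp_all add: v assms sub)
    then show ?thesis by simp
  qed
  then have "submodule \<rho> N" using assms(1) by (simp add: submodule_def)
  then have "N = {0} \<or> N = UNIV" using irr by (simp add: irreducible_module_def)
  then show ?thesis using assms(2) ub_nonzero by blast
qed

lemma central_scalars: "\<rho> k_elt v = k *\<^sub>C v" "\<rho> c_elt v = c *\<^sub>C v"
proof -
  have "\<rho> z v = q *\<^sub>C v" if z: "\<And>Z. L_br z Z = 0" and q: "\<rho> z ub = q *\<^sub>C ub" for z q v
  proof -
    have comm: "\<rho> z (\<rho> Z v) = \<rho> Z (\<rho> z v)" for Z v
      by (subst rho_commute) (simp add: z rho_simps)
    have "v \<in> {v. \<rho> z v = q *\<^sub>C v}"
    proof (rule invariant_subspace_UNIV)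
      show "cvec.subspace {v. \<rho> z v = q *\<^sub>C v}"
        by (rule subspace_eq_of_clinear) (intro rho_clinear clinear_scaled clinear_ident)+
    qed (simp_all add: q comm rho_simps)
    then show ?thesis by simp
  qed
  then show "\<rho> k_elt v = k *\<^sub>C v" "\<rho> c_elt v = c *\<^sub>C v"
    using bracket_rules(5,7) hw_k hw_c by blast+
qed

text \<open>The vectors that all modes of sufficiently large degree annihilate form a submodule, and the highest
  weight vector is one of them.\<close>

lemma eventually_annihilated:
  "\<exists>M. \<forall>m\<ge>M. (\<forall>x. \<rho> (loop_elt x m) w = 0) \<and> \<rho> (d_elt m) w = 0"
proof -
  define kills where "kills M w \<longleftrightarrow> (\<forall>m\<ge>M. (\<forall>x. \<rho> (loop_elt x m) w = 0) \<and> \<rho> (d_elt m) w = 0)" for M w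
  let ?N = "{w. \<exists>M. kills M w}"
  have mono: "kills M' w" if "kills M w" "M \<le> M'" for M M' w
    using that unfolding kills_def by (meson order_trans)
  have "w \<in> ?N"
  proof (rule invariant_subspace_UNIV)
    show "cvec.subspace ?N"
    proof (rule cvec.subspaceI)
      show "0 \<in> ?N" by (auto simp: kills_def rho_simps)
      show "x + y \<in> ?N" if "x \<in> ?N" "y \<in> ?N" for x y
      proof -
        obtain M M' where "kills M x" "kills M' y" using \<open>x \<in> ?N\<close> \<open>y \<in> ?N\<close> by auto
        then have "kills (max M M') x" "kills (max M M') y"
          using mono[of M x "max M M'"] mono[of M' y "max M M'"] by simp_all
        then have "kills (max M M') (x + y)" by (simp add: kills_def rho_simps)
        then show ?thesis by blast
      qed
      show "a *\<^sub>C x \<in> ?N" if "x \<in> ?N" for a x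
      proof -
        obtain M where "kills M x" using \<open>x \<in> ?N\<close> by auto
        then have "kills M (a *\<^sub>C x)" by (simp add: kills_def rho_simps)
        then show ?thesis by blast
      qed
    qed
    have "kills 1 ub"
      unfolding kills_def affvir_plus_def
    proof (intro allI impI conjI)
      fix m :: int assume "1 \<le> m"
      then have m: "m > 0" by simp
      show "\<rho> (loop_elt x m) ub = 0" for x
        by (rule hw_plus) (use m in \<open>auto simp: affvir_plus_def intro!: cvec.span_base\<close>)
      show "\<rho> (d_elt m) ub = 0"
        by (rule hw_plus) (use m in \<open>auto simp: affvir_plus_def intro!: cvec.span_base\<close>)
    qed
    then show "ub \<in> ?N" by blast
    fix v assume "v \<in> ?N"
    then obtain M where M: "kills M v" by blast
    have z: "\<rho> (loop_elt x m) v = 0" "\<rho> (d_elt m) v = 0" if "m \<ge> M" for x m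
      using M that by (auto simp: kills_def)
    \<comment> \<open>beyond this bound the commutator with a mode of degree \<open>n\<close> has no central term and itself
      annihilates \<open>v\<close>\<close>
    let ?M = "\<lambda>n. max M (max (M - n) (1 - n))"
    show "\<rho> (loop_elt y n) v \<in> ?N" for y n
    proof -
      have "kills (?M n) (\<rho> (loop_elt y n) v)"
        unfolding kills_def
      proof (intro allI impI conjI)
        fix m assume "?M n \<le> m"
        then have m: "m \<ge> M" "m + n \<ge> M" "n + m \<ge> M" "m + n \<noteq> 0" by auto
        show "\<rho> (loop_elt x m) (\<rho> (loop_elt y n) v) = 0" for x
          by (subst rho_commute) (simp add: bracket_rules m z rho_simps)
        show "\<rho> (d_elt m) (\<rho> (loop_elt y n) v) = 0"
          by (subst rho_commute) (simp add: bracket_rules m z rho_simps)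
      qed
      then show ?thesis by blast
    qed
    show "\<rho> (d_elt n) v \<in> ?N" for n
    proof -
      have "kills (?M n) (\<rho> (d_elt n) v)"
        unfolding kills_def
      proof (intro allI impI conjI)
        fix m assume "?M n \<le> m"
        then have m: "m \<ge> M" "m + n \<ge> M" "n + m \<ge> M" "m + n \<noteq> 0" by auto
        show "\<rho> (loop_elt x m) (\<rho> (d_elt n) v) = 0" for x
          by (subst rho_commute) (simp add: bracket_rules m z rho_simps)
        show "\<rho> (d_elt m) (\<rho> (d_elt n) v) = 0"
          by (subst rho_commute) (simp add: bracket_rules m z rho_simps)
      qed
      then show ?thesis by blast
    qed
    have "kills M (a *\<^sub>C v)" for a using M by (simp add: kills_def rho_simps)
    then show "\<rho> k_elt v \<in> ?N" "\<rho> c_elt v \<in> ?N" by (auto simp: central_scalars)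
  qed
  then show ?thesis by (auto simp: kills_def)
qed

text \<open>The spanning set of the negative part consists of eigenvectors of \<open>d\<^sub>0\<close> and of \<open>h\<close>, so that
  monomials in it are homogeneous and produce weight vectors.\<close>

definition lowering :: "'g affvir set" where
  "lowering = {loop_elt x 0 |x \<alpha>. \<alpha> \<in> \<Delta>p \<and> x \<in> root_space br h (- \<alpha>)}
     \<union> {loop_elt x (- n) |x \<chi> n. n > 0 \<and> \<chi> \<in> dual_space h \<and> x \<in> root_space br h \<chi>}
     \<union> {d_elt (- n) |n. n > 0}"

definition monomials :: "'w set" where
  "monomials = {foldr \<rho> ys ub |ys. ys \<in> lists lowering}"

lemma lowering_subset: "lowering \<subseteq> affvir_minus br h \<Delta>p"
  unfolding lowering_def affvir_minus_def n_minus_def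
  by (auto intro!: cvec.span_base)

lemma lowering_monomials: "y \<in> lowering \<Longrightarrow> w \<in> cvec.span monomials \<Longrightarrow> \<rho> y w \<in> cvec.span monomials"
proof (erule clinear_span_image[OF rho_clinear cvec.subspace_span, rotated])
  fix x assume y: "y \<in> lowering" and "x \<in> monomials"
  then obtain ys where ys: "ys \<in> lists lowering" "x = foldr \<rho> ys ub" by (auto simp: monomials_def)
  then have "\<rho> y x = foldr \<rho> (y # ys) ub" "y # ys \<in> lists lowering" using y by auto
  then show "\<rho> y x \<in> cvec.span monomials" unfolding monomials_def by (intro cvec.span_base) blast
qed

text \<open>By the triangular decomposition every generator is a combination of lowering operators, raising
  operators, which kill the highest weight vector, and elements acting on it by scalars.\<close>

lemma algebra_on_ub: "\<rho> Z ub \<in> cvec.span monomials"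
proof -
  have ub: "ub \<in> cvec.span monomials"
    unfolding monomials_def by (rule cvec.span_base) (auto intro: exI[of _ "[]"])
  have low: "\<rho> y ub \<in> cvec.span monomials" if "y \<in> lowering" for y using lowering_monomials[OF that ub] .
  have "Z \<in> {Z. \<rho> Z ub \<in> cvec.span monomials}"
  proof (rule affvir_generators_induct)
    show "cvec.subspace {Z. \<rho> Z ub \<in> cvec.span monomials}"
      by (rule cvec.subspaceI) (simp_all add: rho_simps cvec.span_zero cvec.span_add cvec.span_scale)
    have lin: "clinear (\<lambda>x. \<rho> (loop_elt x n) ub)" for n
      by (rule clinear_compose[OF rho_clinear_left loop_elt_clinear])
    fix x and n :: int
    consider "n > 0" | "n = 0" | "n < 0" by linarith
    then show "loop_elt x n \<in> {Z. \<rho> Z ub \<in> cvec.span monomials}"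
    proof cases
      case 1
      then have "loop_elt x n \<in> affvir_plus br h \<Delta>p"
        unfolding affvir_plus_def by (intro cvec.span_base) auto
      then show ?thesis by (simp add: hw_plus cvec.span_zero)
    next
      case 2
      have "\<rho> (loop_elt x 0) ub \<in> cvec.span monomials"
      proof (rule clinear_span_image[OF lin cvec.subspace_span])
        show "x \<in> cvec.span (h \<union> (\<Union>\<alpha>\<in>\<Delta>p. root_space br h \<alpha>) \<union> (\<Union>\<alpha>\<in>\<Delta>p. root_space br h (- \<alpha>)))"
          by (simp add: triangular_decomposition)
        fix y assume "y \<in> h \<union> (\<Union>\<alpha>\<in>\<Delta>p. root_space br h \<alpha>) \<union> (\<Union>\<alpha>\<in>\<Delta>p. root_space br h (- \<alpha>))"
        then consider "y \<in> h" | "y \<in> (\<Union>\<alpha>\<in>\<Delta>p. root_space br h \<alpha>)" | "y \<in> (\<Union>\<alpha>\<in>\<Delta>p. root_space br h (- \<alpha>))" by blast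
        then show "\<rho> (loop_elt y 0) ub \<in> cvec.span monomials"
        proof cases
          case 1
          then show ?thesis using ub by (simp add: hw_h cvec.span_scale)
        next
          case 2
          then have "y \<in> n_plus br h \<Delta>p" unfolding n_plus_def by (rule cvec.span_base)
          then have "loop_elt y 0 \<in> affvir_plus br h \<Delta>p"
            unfolding affvir_plus_def by (intro cvec.span_base) auto
          then show ?thesis by (simp add: hw_plus cvec.span_zero)
        next
          case 3
          then show ?thesis by (intro low) (auto simp: lowering_def)
        qed
      qed
      then show ?thesis using 2 by simp
    next
      case 3
      have "\<rho> (loop_elt x n) ub \<in> cvec.span monomials"
      proof (rule clinear_span_image[OF lin cvec.subspace_span])
        show "x \<in> cvec.span (\<Union>\<chi>\<in>dual_space h. root_space br h \<chi>)" by (simp add: weight_vectors_span)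
        fix y assume "y \<in> (\<Union>\<chi>\<in>dual_space h. root_space br h \<chi>)"
        then obtain \<chi> where "\<chi> \<in> dual_space h" "y \<in> root_space br h \<chi>" by blast
        moreover have "loop_elt y n = loop_elt y (- (- n))" "- n > 0" using 3 by auto
        ultimately have "loop_elt y n \<in> lowering" unfolding lowering_def by blast
        then show "\<rho> (loop_elt y n) ub \<in> cvec.span monomials" by (rule low)
      qed
      then show ?thesis by simp
    qed
  next
    fix n :: int
    consider "n > 0" | "n = 0" | "n < 0" by linarith
    then show "d_elt n \<in> {Z. \<rho> Z ub \<in> cvec.span monomials}"
    proof cases
      case 1
      then have "d_elt n \<in> affvir_plus br h \<Delta>p"
        unfolding affvir_plus_def by (intro cvec.span_base) auto
      then show ?thesis by (simp add: hw_plus cvec.span_zero)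
    next
      case 2
      then show ?thesis using ub by (simp add: hw_d cvec.span_scale)
    next
      case 3
      then have "d_elt n = d_elt (- (- n))" "- n > 0" by auto
      then have "d_elt n \<in> lowering" unfolding lowering_def by blast
      then show ?thesis using low by simp
    qed
  qed (simp_all add: hw_k hw_c ub cvec.span_scale)
  then show ?thesis by simp
qed

text \<open>An arbitrary element of the algebra is commuted to the right through a monomial; the commutators
  are again elements of the algebra in front of a shorter monomial.\<close>

theorem monomials_span: "cvec.span monomials = UNIV"
proof -
  have step: "\<rho> Z (foldr \<rho> ys ub) \<in> cvec.span monomials" if "ys \<in> lists lowering" for ys Z
    using that
  proof (induction ys arbitrary: Z rule: lists.induct)
    case (Cons y ys)
    have "\<rho> Z (foldr \<rho> (y # ys) ub) = \<rho> (L_br Z y) (foldr \<rho> ys ub) + \<rho> y (\<rho> Z (foldr \<rho> ys ub))"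
      by (simp add: rho_commute[of Z])
    moreover note cvec.span_add[OF Cons.IH lowering_monomials[OF Cons.hyps(1) Cons.IH]]
    ultimately show ?case by simp
  qed (simp add: algebra_on_ub)
  have "\<rho> Z v \<in> cvec.span monomials" if "v \<in> cvec.span monomials" for Z v
  proof (rule clinear_span_image[OF rho_clinear cvec.subspace_span _ that])
    fix x assume "x \<in> monomials"
    then obtain ys where "ys \<in> lists lowering" "x = foldr \<rho> ys ub" unfolding monomials_def by blast
    then show "\<rho> Z x \<in> cvec.span monomials" using step[of ys Z] by simp
  qed
  note closed = this
  have ub: "ub \<in> cvec.span monomials"
    unfolding monomials_def by (rule cvec.span_base) (auto intro: exI[of _ "[]"])
  have "v \<in> cvec.span monomials" for v
    by (rule invariant_subspace_UNIV) (simp_all only: cvec.subspace_span ub closed)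
  then show ?thesis by blast
qed

lemma lowering_graded:
  assumes "y \<in> lowering"
  shows "\<exists>n \<chi>. L_br (d_elt 0) y = of_int n *\<^sub>C y \<and> (\<forall>x\<in>h. L_br (loop_elt x 0) y = \<chi> x *\<^sub>C y)
    \<and> (n < 0 \<or> n = 0 \<and> - \<chi> \<in> \<Delta>p)"
proof -
  have root: "L_br (d_elt 0) (loop_elt x n) = of_int n *\<^sub>C loop_elt x n"
    "z \<in> h \<Longrightarrow> L_br (loop_elt z 0) (loop_elt x n) = \<chi> z *\<^sub>C loop_elt x n"
    if "x \<in> root_space br h \<chi>" for x z \<chi> n
    using that by (simp_all add: bracket_rules root_space_def clinear_scale[OF loop_elt_clinear])
  from assms consider
    (zero) x \<alpha> where "\<alpha> \<in> \<Delta>p" "x \<in> root_space br h (- \<alpha>)" "y = loop_elt x 0"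
    | (loop) x \<chi> n where "n > 0" "x \<in> root_space br h \<chi>" "y = loop_elt x (- n)"
    | (vir) n where "n > 0" "y = d_elt (- n)"
    unfolding lowering_def by blast
  then show ?thesis
  proof cases
    case zero
    then show ?thesis using root(1)[OF zero(2), where n = 0] root(2)[OF zero(2), where n = 0]
      by (intro exI[of _ "0::int"] exI[of _ "- \<alpha>"]) auto
  next
    case loop
    then show ?thesis using root(1)[OF loop(2), where n = "- n"] root(2)[OF loop(2), where n = "- n"]
      by (intro exI[of _ "- n"] exI[of _ \<chi>]) auto
  next
    case vir
    then show ?thesis by (intro exI[of _ "- n"] exI[of _ "\<lambda>_. 0"]) (auto simp: bracket_rules)
  qed
qed

lemma monomial_weight:
  assumes "ys \<in> lists lowering"
  shows "\<exists>n \<chi>. \<rho> (d_elt 0) (foldr \<rho> ys ub) = (l + of_int n) *\<^sub>C foldr \<rho> ys ub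
    \<and> (\<forall>x\<in>h. \<rho> (loop_elt x 0) (foldr \<rho> ys ub) = (lam x + \<chi> x) *\<^sub>C foldr \<rho> ys ub)
    \<and> (n < 0 \<or> n = 0 \<and> (\<exists>\<beta>s. length \<beta>s = length ys \<and> set \<beta>s \<subseteq> \<Delta>p \<and> \<chi> = - sum_list \<beta>s))"
  using assms
proof (induction ys rule: lists.induct)
  case Nil
  then show ?case by (intro exI[of _ 0] exI[of _ 0]) (auto simp: hw_d hw_h)
next
  case (Cons y ys)
  let ?w = "foldr \<rho> ys ub"
  from Cons.IH obtain n \<chi> where w: "\<rho> (d_elt 0) ?w = (l + of_int n) *\<^sub>C ?w"
    "\<And>x. x \<in> h \<Longrightarrow> \<rho> (loop_elt x 0) ?w = (lam x + \<chi> x) *\<^sub>C ?w"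
    and alt: "n < 0 \<or> n = 0 \<and> (\<exists>\<beta>s. length \<beta>s = length ys \<and> set \<beta>s \<subseteq> \<Delta>p \<and> \<chi> = - sum_list \<beta>s)" by blast
  from lowering_graded[OF Cons.hyps(1)] obtain m \<psi> where y: "L_br (d_elt 0) y = of_int m *\<^sub>C y"
    "\<And>x. x \<in> h \<Longrightarrow> L_br (loop_elt x 0) y = \<psi> x *\<^sub>C y" and alt': "m < 0 \<or> m = 0 \<and> - \<psi> \<in> \<Delta>p" by blast
  have "\<rho> (d_elt 0) (\<rho> y ?w) = (l + of_int (m + n)) *\<^sub>C \<rho> y ?w"
    by (subst rho_commute) (simp add: y w rho_simps scaleC_add_left algebra_simps)
  moreover have "\<rho> (loop_elt x 0) (\<rho> y ?w) = (lam x + (\<psi> + \<chi>) x) *\<^sub>C \<rho> y ?w" if "x \<in> h" for x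
    by (subst rho_commute) (simp add: y w that rho_simps scaleC_add_left algebra_simps)
  moreover have "m + n < 0 \<or> m + n = 0 \<and> (\<exists>\<beta>s. length \<beta>s = length (y # ys) \<and> set \<beta>s \<subseteq> \<Delta>p \<and> \<psi> + \<chi> = - sum_list \<beta>s)"
  proof (cases "m + n < 0")
    case False
    then have mn: "m = 0" "n = 0" using alt alt' by auto
    then obtain \<beta>s where "length \<beta>s = length ys" "set \<beta>s \<subseteq> \<Delta>p" "\<chi> = - sum_list \<beta>s" using alt by auto
    then show ?thesis using mn alt' by (intro disjI2 conjI exI[of _ "- \<psi> # \<beta>s"]) auto
  qed simp
  ultimately show ?case unfolding foldr.simps comp_apply by blast
qed

lemma monomial_homogeneous:
  assumes "ys \<in> lists lowering"
  shows "\<exists>P n. P \<in> uea_of (affvir_minus br h \<Delta>p) \<and> homogeneous br frm n P \<and> uea_act \<rho> P ub = foldr \<rho> ys ub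
    \<and> \<rho> (d_elt 0) (foldr \<rho> ys ub) = (l + of_int n) *\<^sub>C foldr \<rho> ys ub"
proof -
  have "\<exists>ns. list_all2 (\<lambda>y n. L_br (d_elt 0) y = of_int n *\<^sub>C y) ys ns
    \<and> \<rho> (d_elt 0) (foldr \<rho> ys ub) = (l + of_int (sum_list ns)) *\<^sub>C foldr \<rho> ys ub"
    using assms
  proof (induction ys rule: lists.induct)
    case Nil
    show ?case by (intro exI[of _ "[]"]) (simp add: hw_d)
  next
    case (Cons y ys)
    let ?w = "foldr \<rho> ys ub"
    from Cons.IH obtain ns where ns: "list_all2 (\<lambda>y n. L_br (d_elt 0) y = of_int n *\<^sub>C y) ys ns"
      "\<rho> (d_elt 0) ?w = (l + of_int (sum_list ns)) *\<^sub>C ?w" by blast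
    from lowering_graded[OF Cons.hyps(1)] obtain m where y: "L_br (d_elt 0) y = of_int m *\<^sub>C y" by blast
    have "\<rho> (d_elt 0) (\<rho> y ?w) = (l + of_int (m + sum_list ns)) *\<^sub>C \<rho> y ?w"
      by (subst rho_commute) (simp add: y ns rho_simps scaleC_add_left algebra_simps)
    then show ?case using ns(1) y by (intro exI[of _ "m # ns"]) auto
  qed
  then obtain ns where "list_all2 (\<lambda>y n. L_br (d_elt 0) y = of_int n *\<^sub>C y) ys ns"
    "\<rho> (d_elt 0) (foldr \<rho> ys ub) = (l + of_int (sum_list ns)) *\<^sub>C foldr \<rho> ys ub" by blast
  moreover have "Poly_Mapping.single ys 1 \<in> uea_of (affvir_minus br h \<Delta>p)"
    using assms lowering_subset by (auto simp: uea_of_def)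
  ultimately show ?thesis
    using homogeneous_monomial[of br frm ys ns] uea_act_single[of \<rho> ys 1 ub] unfolding scaleC_one by blast
qed

text \<open>A nonempty monomial produces no nonzero vector of the highest weight: either it lowers the degree, or it
  lowers the \<open>h\<close>-weight by a nonempty sum of positive roots, which is nonzero.\<close>

lemma highest_weight_space:
  assumes "\<rho> (d_elt 0) w = l *\<^sub>C w" "\<And>x. x \<in> h \<Longrightarrow> \<rho> (loop_elt x 0) w = lam x *\<^sub>C w"
  shows "\<exists>z. w = z *\<^sub>C ub"
proof -
  let ?X = "{foldr \<rho> ys ub |ys. ys \<in> lists lowering \<and> ys \<noteq> []}"
  let ?T = "insert (d_elt 0) ((\<lambda>x. loop_elt x 0) ` h)"
  have "monomials \<subseteq> insert ub ?X" by (auto simp: monomials_def)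
  then have "w \<in> cvec.span (insert ub ?X)" using cvec.span_mono[of monomials] monomials_span by blast
  then obtain z where z: "w - z *\<^sub>C ub \<in> cvec.span ?X" by (auto simp: cvec.span_breakdown_eq)
  have wt: "\<rho> (d_elt 0) (w - z *\<^sub>C ub) = l *\<^sub>C (w - z *\<^sub>C ub)"
    "\<And>x. x \<in> h \<Longrightarrow> \<rho> (loop_elt x 0) (w - z *\<^sub>C ub) = lam x *\<^sub>C (w - z *\<^sub>C ub)"
    by (simp_all add: rho_simps assms hw_d hw_h cvec.scale_right_diff_distrib scaleC_scaleC mult.commute)
  define \<chi>\<^sub>0 where "\<chi>\<^sub>0 T = (SOME e. T ub = e *\<^sub>C ub)" for T :: "'w \<Rightarrow> 'w"
  have \<chi>\<^sub>0: "\<chi>\<^sub>0 T = e" if "T ub = e *\<^sub>C ub" for T e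
    unfolding \<chi>\<^sub>0_def by (rule some_equality) (use that ub_nonzero in auto)
  note \<chi>\<^sub>0_d = \<chi>\<^sub>0[where T = "\<rho> (d_elt 0)" and e = l, OF hw_d]
  have \<chi>\<^sub>0_h: "\<chi>\<^sub>0 (\<rho> (loop_elt x 0)) = lam x" if "x \<in> h" for x
    by (rule \<chi>\<^sub>0) (rule hw_h[OF that])
  have "w - z *\<^sub>C ub = 0"
  proof (rule weight_not_in_span[where \<T> = "\<rho> ` ?T" and \<chi>\<^sub>0 = \<chi>\<^sub>0])
    show "w - z *\<^sub>C ub \<in> cvec.span ?X" by (rule z)
    show "clinear T" if "T \<in> \<rho> ` ?T" for T using that rho_clinear by blast
    show "T (w - z *\<^sub>C ub) = \<chi>\<^sub>0 T *\<^sub>C (w - z *\<^sub>C ub)" if "T \<in> \<rho> ` ?T" for T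
    proof -
      from that consider "T = \<rho> (d_elt 0)" | x where "x \<in> h" "T = \<rho> (loop_elt x 0)" by blast
      then show ?thesis
        by cases (simp_all only: wt \<chi>\<^sub>0_d \<chi>\<^sub>0_h)
    qed
    fix v assume "v \<in> ?X"
    then obtain ys where ys: "ys \<in> lists lowering" "ys \<noteq> []" "v = foldr \<rho> ys ub" by blast
    then obtain n \<chi> where n: "\<rho> (d_elt 0) v = (l + of_int n) *\<^sub>C v"
      "\<And>x. x \<in> h \<Longrightarrow> \<rho> (loop_elt x 0) v = (lam x + \<chi> x) *\<^sub>C v"
      "n < 0 \<or> n = 0 \<and> (\<exists>\<beta>s. length \<beta>s = length ys \<and> set \<beta>s \<subseteq> \<Delta>p \<and> \<chi> = - sum_list \<beta>s)"
      using monomial_weight[OF ys(1)] by auto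
    show "\<exists>\<chi>. (\<forall>T\<in>\<rho> ` ?T. T v = \<chi> T *\<^sub>C v) \<and> (\<exists>T\<in>\<rho> ` ?T. \<chi> T \<noteq> \<chi>\<^sub>0 T)"
    proof (cases "v = 0")
      case True
      \<comment> \<open>the zero vector has every weight\<close>
      have "(\<lambda>T. \<chi>\<^sub>0 T + 1) (\<rho> (d_elt 0)) \<noteq> \<chi>\<^sub>0 (\<rho> (d_elt 0))" by simp
      then show ?thesis using True rho_simps(6) by (intro exI[of _ "\<lambda>T. \<chi>\<^sub>0 T + 1"]) auto
    next
      case False
      define \<psi> where "\<psi> T = (SOME e. T v = e *\<^sub>C v)" for T :: "'w \<Rightarrow> 'w"
      have \<psi>: "\<psi> T = e" if "T v = e *\<^sub>C v" for T e
        unfolding \<psi>_def by (rule some_equality) (use that False in auto)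
      have \<psi>_d: "\<psi> (\<rho> (d_elt 0)) = l + of_int n" by (rule \<psi>) (rule n(1))
      have \<psi>_h: "\<psi> (\<rho> (loop_elt x 0)) = lam x + \<chi> x" if "x \<in> h" for x
        by (rule \<psi>) (rule n(2)[OF that])
      have "\<forall>T\<in>\<rho> ` ?T. T v = \<psi> T *\<^sub>C v"
        using n(1,2) by (auto simp: \<psi>_d \<psi>_h)
      moreover have "\<exists>T\<in>\<rho> ` ?T. \<psi> T \<noteq> \<chi>\<^sub>0 T"
      proof (cases "n = 0")
        case False
        then have "\<psi> (\<rho> (d_elt 0)) \<noteq> \<chi>\<^sub>0 (\<rho> (d_elt 0))" by (simp add: \<psi>_d \<chi>\<^sub>0_d)
        then show ?thesis by blast
      next
        case True
        then obtain \<beta>s where \<beta>s: "length \<beta>s = length ys" "set \<beta>s \<subseteq> \<Delta>p" "\<chi> = - sum_list \<beta>s" using n(3) by auto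
        have "\<beta>s \<noteq> []" using \<beta>s(1) ys(2) by auto
        then have "sum_list \<beta>s \<noteq> 0" using sum_list_positive_roots_nonzero \<beta>s(2) by blast
        moreover have "set \<beta>s \<subseteq> \<Delta>p \<Longrightarrow> sum_list \<beta>s \<in> dual_space h" for \<beta>s
          by (induction \<beta>s) (use pos in \<open>auto simp: roots_def cvec.subspace_0[OF dual_space_subspace]
              intro: cvec.subspace_add[OF dual_space_subspace]\<close>)
        ultimately obtain x where "sum_list \<beta>s x \<noteq> 0" "x \<in> h"
          using \<beta>s(2) by (fastforce simp: dual_space_def fun_eq_iff)
        then have "\<psi> (\<rho> (loop_elt x 0)) \<noteq> \<chi>\<^sub>0 (\<rho> (loop_elt x 0))"
          using \<beta>s(3) by (simp add: \<psi>_h \<chi>\<^sub>0_h)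
        then show ?thesis using \<open>x \<in> h\<close> by blast
      qed
      ultimately show ?thesis by blast
    qed
  qed
  then show ?thesis by auto
qed

text \<open>The operator preserves the highest weight line, hence has an eigenvector; its eigenspace is a
  submodule.  This replaces the dimension argument of the usual Schur lemma.\<close>

theorem schur:
  assumes G: "clinear G" and loop: "\<And>x n w. G (\<rho> (loop_elt x n) w) = \<rho> (loop_elt x n) (G w)"
    and vir: "\<And>n w. G (\<rho> (d_elt n) w) = \<rho> (d_elt n) (G w)"
  shows "\<exists>z. \<forall>w. G w = z *\<^sub>C w"
proof -
  have "\<exists>z. G ub = z *\<^sub>C ub"
    by (rule highest_weight_space) (simp_all add: loop[symmetric] vir[symmetric] hw_d hw_h clinear_scale[OF G])
  then obtain z where z: "G ub = z *\<^sub>C ub" by blast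
  have "w \<in> {w. G w = z *\<^sub>C w}" for w
  proof (rule invariant_subspace_UNIV)
    show "cvec.subspace {w. G w = z *\<^sub>C w}"
      by (rule subspace_eq_of_clinear) (intro G clinear_scaled clinear_ident)+
  qed (simp_all add: z loop vir rho_simps central_scalars clinear_scale[OF G] scaleC_scaleC mult.commute)
  then show ?thesis by blast
qed

end


section \<open>Finite-dimensional irreducible modules\<close>

locale nontrivial_irreducible_module =
  fixes br :: "'g::complex_vec \<Rightarrow> 'g \<Rightarrow> 'g" and \<sigma> :: "'g \<Rightarrow> 'v::complex_vec \<Rightarrow> 'v"
  assumes fd_V: "finite_dimensional TYPE('v)" and irr_V: "irreducible_module br \<sigma>"
    and nontrivial: "\<exists>x v. \<sigma> x v \<noteq> 0"
begin

lemma sigma_bil: "cbilinear \<sigma>"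
  using irr_V unfolding irreducible_module_def lie_module_def by blast

lemmas sigma_simps = cbilinear_simps[OF sigma_bil]

lemma sigma_clinear: "clinear (\<sigma> x)"
  by (rule cbilinear_right[OF sigma_bil])

lemma submodule_cases: "submodule \<sigma> N \<Longrightarrow> N = {0} \<or> N = UNIV"
  using irr_V by (simp add: irreducible_module_def)

lemma no_invariants:
  assumes "\<And>x. \<sigma> x v = 0"
  shows "v = 0"
proof -
  let ?N = "{v. \<forall>x. \<sigma> x v = 0}"
  have "cvec.subspace ?N" by (rule cvec.subspaceI) (simp_all add: sigma_simps)
  then have "submodule \<sigma> ?N" by (auto simp: submodule_def sigma_simps)
  moreover have "?N \<noteq> UNIV" using nontrivial by blast
  ultimately have "?N = {0}" using submodule_cases by blast
  then show ?thesis using assms by blast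
qed

lemma action_spans: "cvec.span {\<sigma> x v |x v. True} = UNIV"
proof -
  have "submodule \<sigma> (cvec.span {\<sigma> x v |x v. True})"
    unfolding submodule_def by (auto intro!: cvec.span_base)
  moreover have "cvec.span {\<sigma> x v |x v. True} \<noteq> {0}"
  proof
    assume "cvec.span {\<sigma> x v |x v. True} = {0}"
    moreover have "\<sigma> x v \<in> cvec.span {\<sigma> x v |x v. True}" for x v by (rule cvec.span_base) blast
    ultimately show False using nontrivial by blast
  qed
  ultimately show ?thesis using submodule_cases by blast
qed

lemma eq_on_action:
  assumes "clinear F" "clinear F'" "\<And>x v. F (\<sigma> x v) = F' (\<sigma> x v)"
  shows "F v = F' v"
  by (rule clinear_eq_on_span[OF assms(1,2), where X = "{\<sigma> x v |x v. True}"])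
    (use assms(3) in \<open>auto simp only: action_spans\<close>)

lemma intertwiner_scalar:
  assumes F: "clinear F" and "\<And>x v. F (\<sigma> x v) = \<sigma> x (F v)"
  shows "\<exists>z. \<forall>v. F v = z *\<^sub>C v"
proof -
  have "\<exists>v::'v. v \<noteq> 0" using nontrivial by blast
  then obtain z v where v: "v \<noteq> 0" "F v = z *\<^sub>C v" using exists_eigenvector[OF fd_V F] by blast
  let ?N = "{v. F v = z *\<^sub>C v}"
  have "cvec.subspace ?N" by (rule subspace_eq_of_clinear[OF F]) (intro clinear_scaled clinear_ident)
  then have "submodule \<sigma> ?N" by (auto simp: submodule_def assms(2) sigma_simps)
  then have "?N = UNIV" using submodule_cases v by blast
  then show ?thesis by blast
qed

text \<open>For large \<open>p\<close> the map \<open>F (n + p)\<close> is determined by \<open>F n\<close> on the vectors \<open>\<sigma> x v\<close>, which span, so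
  \<open>F\<close> is eventually constant.  The limit value is an intertwiner, hence a scalar \<open>z\<close>, and then
  \<open>\<sigma> x (F n v) = \<sigma> x (z v)\<close> for all \<open>x\<close>; as the module has no invariants, \<open>F n = z\<close> for every \<open>n\<close>.\<close>

lemma asymptotic_intertwiner_scalar:
  fixes F :: "int \<Rightarrow> 'v \<Rightarrow> 'v"
  assumes F: "\<And>n. clinear (F n)"
    and shift: "\<And>n. \<forall>\<^sub>F p in at_top. \<forall>x v. F (n + p) (\<sigma> x v) = \<sigma> x (F n v)"
  shows "\<exists>z. \<forall>n v. F n v = z *\<^sub>C v"
proof -
  obtain M where M: "\<And>p x v. p \<ge> M \<Longrightarrow> F p (\<sigma> x v) = \<sigma> x (F 0 v)"
    using shift[of 0] by (auto simp: eventually_at_top_linorder)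
  have const: "F p v = F M v" if "p \<ge> M" for p v
    by (rule eq_on_action[OF F F]) (simp add: M that)
  have limit: "F M (\<sigma> x v) = \<sigma> x (F n v)" for n x v
  proof -
    obtain N where N: "\<And>p x v. p \<ge> N \<Longrightarrow> F (n + p) (\<sigma> x v) = \<sigma> x (F n v)"
      using shift[of n] by (auto simp: eventually_at_top_linorder)
    show ?thesis using N[of "max N (M - n)" x v] const[of "n + max N (M - n)" "\<sigma> x v"] by simp
  qed
  from intertwiner_scalar[OF F limit] obtain z where z: "\<And>v. F M v = z *\<^sub>C v" by blast
  have "F n v - z *\<^sub>C v = 0" for n v
    by (rule no_invariants) (simp add: sigma_simps limit[symmetric] z)
  then show ?thesis by auto
qed

end


section \<open>Endomorphisms of the tensor product\<close>

locale tensor_module = highest_weight_module br h S \<Delta>p frm lam l k c \<rho> ub +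
  nontrivial_irreducible_module br \<sigma>
  for br :: "'g::complex_vec \<Rightarrow> 'g \<Rightarrow> 'g" and h S \<Delta>p frm lam l k c
    and \<rho> :: "'g affvir \<Rightarrow> 'w::complex_vec \<Rightarrow> 'w" and ub
    and \<sigma> :: "'g \<Rightarrow> 'v::complex_vec \<Rightarrow> 'v" +
  fixes a b :: complex and \<tau> :: "'g affvir \<Rightarrow> ('w, 'v) loop_tensor \<Rightarrow> ('w, 'v) loop_tensor"
  assumes tau: "tensor_module_action br frm h \<Delta>p k c \<rho> ub \<sigma> a b \<tau>"
begin

lemma tau_bil: "cbilinear \<tau>"
  using tau unfolding tensor_module_action_def by blast

lemmas tau_simps = cbilinear_simps[OF tau_bil]

lemma tau_clinear: "clinear (\<tau> Z)"
  by (rule cbilinear_right[OF tau_bil])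

lemma pure_clinear: "clinear (\<lambda>w. w \<otimes>\<^sub>C v \<otimes>\<^sub>C t_pow n)" "clinear (\<lambda>v. w \<otimes>\<^sub>C v \<otimes>\<^sub>C t_pow n)"
  by (rule clinear_compose[OF tens_clinear(1)], rule tens_clinear)+

text \<open>The action is prescribed for homogeneous first factors; as these span and the formula below is
  linear in the first factor, it holds for all of them.\<close>

lemma tau_loop:
  "\<tau> (loop_elt x m) (w \<otimes>\<^sub>C v \<otimes>\<^sub>C t_pow n)
     = \<rho> (loop_elt x m) w \<otimes>\<^sub>C v \<otimes>\<^sub>C t_pow (m + n) + w \<otimes>\<^sub>C \<sigma> x v \<otimes>\<^sub>C t_pow (m + n)" (is "?L w = ?R w")
proof -
  have "clinear ?L" by (rule clinear_compose[OF tau_clinear pure_clinear(1)])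
  moreover have "clinear ?R"
    by (intro clinear_plus pure_clinear clinear_compose[OF pure_clinear(1) rho_clinear])
  moreover have "?L w = ?R w" if w: "w \<in> monomials" for w
  proof -
    obtain P deg where P: "P \<in> uea_of (affvir_minus br h \<Delta>p)" "homogeneous br frm deg P" "uea_act \<rho> P ub = w"
      using w monomial_homogeneous unfolding monomials_def by blast
    then show ?thesis using tau unfolding tensor_module_action_def Let_def
      by (metis tens_simps(1))
  qed
  ultimately show ?thesis by (rule clinear_eq_on_span[where X = monomials]) (simp_all only: monomials_span UNIV_I)
qed

text \<open>The degree that enters the action is recovered from \<open>d\<^sub>0\<close>, which acts on a homogeneous
  vector of degree \<open>n\<close> as \<open>l + n\<close>.\<close>

lemma tau_d:
  "\<tau> (d_elt m) (w \<otimes>\<^sub>C v \<otimes>\<^sub>C t_pow n)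
     = (\<rho> (d_elt m) w - \<rho> (d_elt 0) w + (l + a + of_int n + b * of_int m) *\<^sub>C w) \<otimes>\<^sub>C v \<otimes>\<^sub>C t_pow (m + n)"
  (is "?L w = ?R w")
proof -
  have "clinear ?L" by (rule clinear_compose[OF tau_clinear pure_clinear(1)])
  moreover have "clinear ?R"
    by (rule clinear_compose[OF pure_clinear(1)])
      (intro clinear_plus clinear_sub clinear_scaled rho_clinear clinear_ident)
  moreover have "?L w = ?R w" if w: "w \<in> monomials" for w
  proof -
    obtain P deg where P: "P \<in> uea_of (affvir_minus br h \<Delta>p)" "homogeneous br frm deg P" "uea_act \<rho> P ub = w"
      "\<rho> (d_elt 0) w = (l + of_int deg) *\<^sub>C w"
      using w monomial_homogeneous unfolding monomials_def by blast
    have "?L w = (\<rho> (d_elt m) w + (a + of_int n - of_int deg + b * of_int m) *\<^sub>C w) \<otimes>\<^sub>C v \<otimes>\<^sub>C t_pow (m + n)"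
      using tau P(1,2) unfolding tensor_module_action_def Let_def P(3)[symmetric] by blast
    moreover have "(a + of_int n - of_int deg + b * of_int m) *\<^sub>C w
        = (l + a + of_int n + b * of_int m) *\<^sub>C w - \<rho> (d_elt 0) w"
      unfolding P(4) cvec.scale_left_diff_distrib[symmetric] by (simp add: algebra_simps)
    ultimately show ?thesis by (simp add: algebra_simps)
  qed
  ultimately show ?thesis by (rule clinear_eq_on_span[where X = monomials]) (simp_all only: monomials_span UNIV_I)
qed

lemma contract1_d0:
  assumes "clinear \<xi>"
  shows "contract1 \<xi> n (\<tau> (d_elt 0) T) = (l + a + of_int n) *\<^sub>C contract1 \<xi> n T"
proof (rule clinear_eq_on_loop_tensor)
  note L = contract1_clinear[OF assms]
  show "clinear (\<lambda>T. contract1 \<xi> n (\<tau> (d_elt 0) T))" by (rule clinear_compose[OF L tau_clinear])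
  show "clinear (\<lambda>T. (l + a + of_int n) *\<^sub>C contract1 \<xi> n T)" by (rule clinear_scaled[OF L])
qed (simp add: tau_d tens_simps clinear_scale[OF contract1_clinear[OF assms]] contract1_pure[OF assms])

text \<open>Modes of large degree kill the first tensor factor, so only the loop module factor sees them.\<close>

lemma eventually_loop_action:
  "\<forall>\<^sub>F p in at_top. \<forall>x n e. contract1 (coord e) (n + p) (\<tau> (loop_elt x p) T) = \<sigma> x (contract1 (coord e) n T)"
proof -
  note lin = clinear_simps[OF contract1_clinear[OF coord_clinear]]
  have "T \<in> cvec.span {w \<otimes>\<^sub>C v \<otimes>\<^sub>C t_pow n |w v n. w \<in> UNIV}"
    by (rule in_loop_tensor_span[OF cvec.span_UNIV])
  then show ?thesis
  proof (induction rule: cvec.span_induct_alt)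
    case base
    show ?case by (simp add: tau_simps sigma_simps lin)
  next
    case (step q y T)
    then obtain w v m where y: "y = w \<otimes>\<^sub>C v \<otimes>\<^sub>C t_pow m" by blast
    have "\<forall>\<^sub>F p in at_top. \<forall>x. \<rho> (loop_elt x p) w = 0"
      using eventually_annihilated[of w] by (auto simp: eventually_at_top_linorder)
    with step(2) show ?case
    proof eventually_elim
      case (elim p)
      then show ?case
        by (auto simp: y tau_simps tau_loop sigma_simps lin tens_simps contract1_pure[OF coord_clinear])
    qed
  qed
qed

text \<open>The power of \<open>t\<close> records the eigenvalue of \<open>d\<^sub>0\<close>.\<close>

lemma endomorphism_preserves_degree:
  assumes "f \<in> module_End \<tau>" "m \<noteq> n"
  shows "contract1 (coord e) m (f (w \<otimes>\<^sub>C v \<otimes>\<^sub>C t_pow n)) = 0"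
proof -
  have f: "clinear f" "\<And>Z T. f (\<tau> Z T) = \<tau> Z (f T)" using assms(1) by (auto simp: module_End_def module_hom_lie_def)
  let ?T = "w \<otimes>\<^sub>C v \<otimes>\<^sub>C t_pow n"
  let ?y = "contract1 (coord e) m (f ?T)"
  have "\<tau> (d_elt 0) ?T = (l + a + of_int n) *\<^sub>C ?T" by (simp add: tau_d tens_simps)
  then have "\<tau> (d_elt 0) (f ?T) = (l + a + of_int n) *\<^sub>C f ?T"
    using f(2)[of "d_elt 0" ?T] by (simp add: clinear_scale[OF f(1)])
  then have "(l + a + of_int m) *\<^sub>C ?y = (l + a + of_int n) *\<^sub>C ?y"
    using contract1_d0[OF coord_clinear, of e m "f ?T"]
    by (auto simp: clinear_scale[OF contract1_clinear[OF coord_clinear]])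
  then show ?thesis using assms(2) by auto
qed

text \<open>Fix \<open>w\<close> and a coordinate functional of the first factor.  The maps \<open>F n\<close> on \<open>V\<close> obtained from
  \<open>v \<mapsto> f (w \<otimes> v \<otimes> t\<^sup>n)\<close> satisfy the hypothesis of \<open>asymptotic_intertwiner_scalar\<close>, because a loop mode of
  large degree acts on both \<open>w \<otimes> v \<otimes> t\<^sup>n\<close> and its image through \<open>V\<close> alone.  A basis of \<open>V\<close> makes
  the bound on the degree uniform in \<open>v\<close>.\<close>

lemma endomorphism_coordinate_scalar:
  assumes "f \<in> module_End \<tau>"
  shows "\<exists>z. \<forall>n v. contract1 (coord e) n (f (w \<otimes>\<^sub>C v \<otimes>\<^sub>C t_pow n)) = z *\<^sub>C v"
proof (rule asymptotic_intertwiner_scalar)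
  have f: "clinear f" "\<And>Z T. f (\<tau> Z T) = \<tau> Z (f T)" using assms by (auto simp: module_End_def module_hom_lie_def)
  let ?F = "\<lambda>n v. contract1 (coord e) n (f (w \<otimes>\<^sub>C v \<otimes>\<^sub>C t_pow n))"
  show lin: "clinear (?F n)" for n
    by (intro clinear_compose[OF contract1_clinear[OF coord_clinear]] clinear_compose[OF f(1)] pure_clinear)
  fix n :: int
  let ?B = "cvec.extend_basis {} :: 'v set"
  note B = extend_basis_empty[OF fd_V]
  have "\<forall>\<^sub>F p in at_top. \<forall>x. ?F (n + p) (\<sigma> x v) = \<sigma> x (?F n v)" for v
  proof -
    have "\<forall>\<^sub>F p in at_top. \<forall>x. \<rho> (loop_elt x p) w = 0"
      using eventually_annihilated[of w] by (auto simp: eventually_at_top_linorder)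
    with eventually_loop_action[of "f (w \<otimes>\<^sub>C v \<otimes>\<^sub>C t_pow n)"] show ?thesis
    proof eventually_elim
      case (elim p)
      have "f (w \<otimes>\<^sub>C \<sigma> x v \<otimes>\<^sub>C t_pow (n + p)) = \<tau> (loop_elt x p) (f (w \<otimes>\<^sub>C v \<otimes>\<^sub>C t_pow n))" for x
        using elim(2) by (simp add: f(2)[symmetric] tau_loop tens_simps add.commute)
      then show ?case using elim(1) by simp
    qed
  qed
  then have "\<forall>\<^sub>F p in at_top. \<forall>v\<in>?B. \<forall>x. ?F (n + p) (\<sigma> x v) = \<sigma> x (?F n v)"
    by (intro eventually_ball_finite B(1)) blast
  then show "\<forall>\<^sub>F p in at_top. \<forall>x v. ?F (n + p) (\<sigma> x v) = \<sigma> x (?F n v)"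
  proof eventually_elim
    case (elim p)
    have "?F (n + p) (\<sigma> x v) = \<sigma> x (?F n v)" for x v
      by (rule clinear_eq_on_span[OF clinear_compose[OF lin sigma_clinear] clinear_compose[OF sigma_clinear lin], where X = ?B])
        (use elim B(3) in auto)
    then show ?case by blast
  qed
qed

text \<open>The coordinates being scalars, \<open>f\<close> has the form \<open>w \<otimes> v \<otimes> t\<^sup>n \<mapsto> G w \<otimes> v \<otimes> t\<^sup>n\<close>.  Comparing the
  actions shows that \<open>G\<close> commutes with all loop modes and all differences \<open>d\<^sub>n - d\<^sub>0\<close>; the separate
  commutation with \<open>d\<^sub>0\<close> comes from modes of large degree.\<close>

theorem endomorphism_scalar:
  assumes "f \<in> module_End \<tau>"
  shows "\<exists>z. \<forall>T. f T = z *\<^sub>C T"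
proof -
  have f: "clinear f" "\<And>Z T. f (\<tau> Z T) = \<tau> Z (f T)" using assms by (auto simp: module_End_def module_hom_lie_def)
  have "(cvec.extend_basis {} :: 'v set) \<noteq> {}"
  proof
    assume "(cvec.extend_basis {} :: 'v set) = {}"
    then have "(UNIV :: 'v set) = {0}" using basis_props(2)[where 'a = 'v] by simp
    then show False using nontrivial by blast
  qed
  then obtain v\<^sub>0 :: 'v where v\<^sub>0: "v\<^sub>0 \<in> cvec.extend_basis {}" by blast
  define \<eta> where "\<eta> = (coord v\<^sub>0 :: 'v \<Rightarrow> complex)"
  have \<eta>: "clinear \<eta>" "\<eta> v\<^sub>0 = 1" by (simp_all add: \<eta>_def coord_clinear coord_basis[OF v\<^sub>0])
  have inj: "w = w'" if "w \<otimes>\<^sub>C v\<^sub>0 \<otimes>\<^sub>C t_pow n = w' \<otimes>\<^sub>C v\<^sub>0 \<otimes>\<^sub>C t_pow n" for w w' :: 'w and n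
    using arg_cong[OF that, of "contract2 \<eta> n"] by (simp add: contract2_pure[OF \<eta>(1)] \<eta>(2) scaleC_one)
  define G where "G w = contract2 \<eta> 0 (f (w \<otimes>\<^sub>C v\<^sub>0 \<otimes>\<^sub>C t_pow 0))" for w
  have G: "clinear G"
    unfolding G_def
    by (intro clinear_compose[OF contract2_clinear[OF \<eta>(1)]] clinear_compose[OF f(1)] pure_clinear)
  have fG: "f (w \<otimes>\<^sub>C v \<otimes>\<^sub>C t_pow n) = G w \<otimes>\<^sub>C v \<otimes>\<^sub>C t_pow n" for w v n
  proof (rule loop_tensor_eqI)
    fix e m
    show "contract1 (coord e) m (f (w \<otimes>\<^sub>C v \<otimes>\<^sub>C t_pow n)) = contract1 (coord e) m (G w \<otimes>\<^sub>C v \<otimes>\<^sub>C t_pow n)"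
    proof (cases "m = n")
      case True
      obtain z where z: "\<And>n v. contract1 (coord e) n (f (w \<otimes>\<^sub>C v \<otimes>\<^sub>C t_pow n)) = z *\<^sub>C v"
        using endomorphism_coordinate_scalar[OF assms] by blast
      have "coord e (G w) = \<eta> (z *\<^sub>C v\<^sub>0)"
        unfolding G_def contract_swap[OF coord_clinear \<eta>(1)] z ..
      also have "\<dots> = z" unfolding clinear_scale[OF \<eta>(1)] \<eta>(2) by (simp add: scaleC_complex_def)
      finally show ?thesis using z True by (simp add: contract1_pure[OF coord_clinear])
    qed (simp add: endomorphism_preserves_degree[OF assms] contract1_pure[OF coord_clinear])
  qed
  have loop: "G (\<rho> (loop_elt x n) w) = \<rho> (loop_elt x n) (G w)" for x n w
  proof (rule inj)
    show "G (\<rho> (loop_elt x n) w) \<otimes>\<^sub>C v\<^sub>0 \<otimes>\<^sub>C t_pow (n + 0) = \<rho> (loop_elt x n) (G w) \<otimes>\<^sub>C v\<^sub>0 \<otimes>\<^sub>C t_pow (n + 0)"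
      using f(2)[of "loop_elt x n" "w \<otimes>\<^sub>C v\<^sub>0 \<otimes>\<^sub>C t_pow 0"]
      unfolding tau_loop fG clinear_add[OF f(1)] by simp
  qed
  have vir_diff: "G (\<rho> (d_elt n) w) - G (\<rho> (d_elt 0) w) = \<rho> (d_elt n) (G w) - \<rho> (d_elt 0) (G w)" for n w
  proof -
    let ?q = "(l + a + of_int 0 + b * of_int n)"
    have "G (\<rho> (d_elt n) w - \<rho> (d_elt 0) w + ?q *\<^sub>C w) = \<rho> (d_elt n) (G w) - \<rho> (d_elt 0) (G w) + ?q *\<^sub>C G w"
      using f(2)[of "d_elt n" "w \<otimes>\<^sub>C v\<^sub>0 \<otimes>\<^sub>C t_pow 0"] unfolding tau_d fG by (rule inj)
    then show ?thesis by (simp only: clinear_simps[OF G]) simp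
  qed
  \<comment> \<open>for large \<open>n\<close> both \<open>d\<^sub>n\<close>-terms vanish, which isolates \<open>d\<^sub>0\<close>\<close>
  have vir0: "G (\<rho> (d_elt 0) w) = \<rho> (d_elt 0) (G w)" for w
  proof -
    obtain M M' where M: "\<And>m. m \<ge> M \<Longrightarrow> \<rho> (d_elt m) w = 0" "\<And>m. m \<ge> M' \<Longrightarrow> \<rho> (d_elt m) (G w) = 0"
      using eventually_annihilated[of w] eventually_annihilated[of "G w"] by blast
    have "\<rho> (d_elt (max M M')) w = 0" "\<rho> (d_elt (max M M')) (G w) = 0" by (simp_all add: M)
    then show ?thesis using vir_diff[of "max M M'" w] by (simp add: clinear_zero[OF G])
  qed
  have "G (\<rho> (d_elt n) w) = \<rho> (d_elt n) (G w)" for n w using vir_diff[of n w] vir0[of w] by simp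
  from schur[OF G loop this] obtain z where z: "\<And>w. G w = z *\<^sub>C w" by blast
  have "f T = z *\<^sub>C T" for T
    by (rule clinear_eq_on_loop_tensor[OF f(1)])
      (auto simp: fG z tens_simps intro!: clinear_scaled clinear_ident)
  then show ?thesis by blast
qed

theorem module_End_iso_complex: "iso_complex_algebra (module_End \<tau>)"
proof -
  let ?\<Phi> = "\<lambda>z (T :: ('w, 'v) loop_tensor). z *\<^sub>C T"
  have "inj ?\<Phi>"
  proof (rule injI)
    fix z z' assume eq: "?\<Phi> z = ?\<Phi> z'"
    obtain v :: 'v where "v \<noteq> 0" using nontrivial by blast
    obtain e where e: "coord e ub \<noteq> 0"
    proof (rule ccontr)
      assume "\<not> thesis"
      then have z: "coord e ub = 0" for e using that by blast
      have "(\<Sum>e | coord e ub \<noteq> 0. coord e ub *\<^sub>C e) = ub"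
        by (rule cvec.sum_nonzero_representation_eq) (simp_all add: basis_props)
      then show False using ub_nonzero by (simp add: z)
    qed
    have "contract1 (coord e) 1 (z *\<^sub>C (ub \<otimes>\<^sub>C v \<otimes>\<^sub>C t_pow 1)) = contract1 (coord e) 1 (z' *\<^sub>C (ub \<otimes>\<^sub>C v \<otimes>\<^sub>C t_pow 1))"
      using arg_cong[OF fun_cong[OF eq, of "ub \<otimes>\<^sub>C v \<otimes>\<^sub>C t_pow 1"], of "contract1 (coord e) 1"] .
    then show "z = z'" using e \<open>v \<noteq> 0\<close>
      by (simp add: clinear_scale[OF contract1_clinear[OF coord_clinear]] contract1_pure[OF coord_clinear] scaleC_scaleC)
  qed
  moreover have "range ?\<Phi> = module_End \<tau>"
  proof
    show "range ?\<Phi> \<subseteq> module_End \<tau>"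
      by (auto simp: module_End_def module_hom_lie_def tau_simps intro!: clinear_scaled clinear_ident)
    show "module_End \<tau> \<subseteq> range ?\<Phi>"
    proof
      fix f assume "f \<in> module_End \<tau>"
      then obtain z where "\<And>T. f T = z *\<^sub>C T" using endomorphism_scalar by blast
      then have "f = ?\<Phi> z" by (simp add: fun_eq_iff)
      then show "f \<in> range ?\<Phi>" by blast
    qed
  qed
  ultimately show ?thesis
    unfolding iso_complex_algebra_def
    by (intro exI[of _ ?\<Phi>])
      (auto simp: bij_betw_def fun_eq_iff scaleC_add_left scaleC_scaleC scaleC_one scaleC_fun_def scaleC_complex_def)
qed

end

lemma module_hom_uea_act:
  assumes "module_hom_lie \<rho> \<rho>' \<pi>"
  shows "\<pi> (uea_act \<rho> P v) = uea_act \<rho>' P (\<pi> v)"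
proof -
  have \<pi>: "clinear \<pi>" "\<And>x v. \<pi> (\<rho> x v) = \<rho>' x (\<pi> v)" using assms by (auto simp: module_hom_lie_def)
  have "\<pi> (foldr \<rho> xs v) = foldr \<rho>' xs (\<pi> v)" for xs by (induction xs) (simp_all add: \<pi>(2))
  then show ?thesis by (simp add: uea_act_def clinear_sum[OF \<pi>(1)] clinear_scale[OF \<pi>(1)])
qed

text \<open>All relations pass from the Verma module to the quotient.  If the image of the generator were zero,
  so would be the whole quotient.\<close>

lemma irreducible_quotient_highest_weight:
  assumes verma: "verma_module br frm h \<Delta>p lam l k c \<rho>M u"
    and quot: "irreducible_quotient (affvir_bracket br frm) \<rho>M \<rho>L \<pi>"
  shows "\<pi> u \<noteq> 0"
    and "\<And>y. y \<in> affvir_plus br h \<Delta>p \<Longrightarrow> \<rho>L y (\<pi> u) = 0"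
    and "\<And>x. x \<in> h \<Longrightarrow> \<rho>L (loop_elt x 0) (\<pi> u) = lam x *\<^sub>C \<pi> u"
    and "\<rho>L (d_elt 0) (\<pi> u) = l *\<^sub>C \<pi> u" "\<rho>L k_elt (\<pi> u) = k *\<^sub>C \<pi> u" "\<rho>L c_elt (\<pi> u) = c *\<^sub>C \<pi> u"
proof -
  have hom: "module_hom_lie \<rho>M \<rho>L \<pi>" and "surj \<pi>" and irr: "irreducible_module (affvir_bracket br frm) \<rho>L"
    using quot by (auto simp: irreducible_quotient_def)
  have \<pi>: "clinear \<pi>" using hom by (simp add: module_hom_lie_def)
  have rel: "uea_act \<rho>L P (\<pi> u) = 0" if "P \<in> verma_ideal br frm h \<Delta>p lam l k c" for P
  proof -
    have "uea_act \<rho>M P u = 0" using that verma unfolding verma_module_def by blast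
    then show ?thesis using module_hom_uea_act[OF hom, of P u] by (simp add: clinear_zero[OF \<pi>])
  qed
  have gen: "uea_act \<rho>L (gen x) v = \<rho>L x v" and scal: "uea_act \<rho>L (scal q) v = q *\<^sub>C v" for x q v
    by (simp_all add: gen_def scal_def uea_act_single scaleC_one)
  note diff = clinear_diff[OF uea_act_clinear]
  show "\<rho>L y (\<pi> u) = 0" if "y \<in> affvir_plus br h \<Delta>p" for y
    using rel[of "gen y"] that by (simp add: gen verma_ideal_def left_ideal_base)
  show "\<rho>L (loop_elt x 0) (\<pi> u) = lam x *\<^sub>C \<pi> u" if "x \<in> h" for x
  proof -
    have "gen (loop_elt x 0) - scal (lam x) \<in> verma_ideal br frm h \<Delta>p lam l k c"
      unfolding verma_ideal_def by (rule left_ideal_base) (use that in blast)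
    from rel[OF this] show ?thesis by (simp add: diff gen scal)
  qed
  have "gen (d_elt 0) - scal l \<in> verma_ideal br frm h \<Delta>p lam l k c"
    "gen k_elt - scal k \<in> verma_ideal br frm h \<Delta>p lam l k c"
    "gen c_elt - scal c \<in> verma_ideal br frm h \<Delta>p lam l k c"
    unfolding verma_ideal_def by (rule left_ideal_base, blast)+
  from this[THEN rel] show "\<rho>L (d_elt 0) (\<pi> u) = l *\<^sub>C \<pi> u" "\<rho>L k_elt (\<pi> u) = k *\<^sub>C \<pi> u" "\<rho>L c_elt (\<pi> u) = c *\<^sub>C \<pi> u"
    by (simp_all add: diff gen scal)
  show "\<pi> u \<noteq> 0"
  proof
    assume "\<pi> u = 0"
    have lin: "clinear (\<rho>L x)" for x
      using irr unfolding irreducible_module_def lie_module_def cbilinear_def by blast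
    have "foldr \<rho>L xs 0 = 0" for xs by (induction xs) (simp_all add: clinear_zero[OF lin])
    then have "uea_act \<rho>L P 0 = 0" for P by (simp add: uea_act_def)
    then have "\<pi> v = 0" for v
      using module_hom_uea_act[OF hom, of _ u] \<open>\<pi> u = 0\<close> verma unfolding verma_module_def by metis
    then show False using \<open>surj \<pi>\<close> irr unfolding irreducible_module_def by (metis surjD)
  qed
qed

theorem theorem3p2:
  fixes br :: "'g::complex_vec \<Rightarrow> 'g \<Rightarrow> 'g" and frm :: "'g \<Rightarrow> 'g \<Rightarrow> complex"
    and h :: "'g set" and \<Delta>p :: "('g \<Rightarrow> complex) set"
    and lam \<mu> :: "'g \<Rightarrow> complex" and l k c a b :: complex
    and \<rho>M :: "'g affvir \<Rightarrow> 'm::complex_vec \<Rightarrow> 'm" and u :: 'm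
    and \<rho>L :: "'g affvir \<Rightarrow> 'w::complex_vec \<Rightarrow> 'w" and \<pi> :: "'m \<Rightarrow> 'w"
    and \<sigma> :: "'g \<Rightarrow> 'v::complex_vec \<Rightarrow> 'v"
    and \<tau> :: "'g affvir \<Rightarrow> (('w, 'v) tensor, laurent) tensor \<Rightarrow> (('w, 'v) tensor, laurent) tensor"
  assumes "finite_dimensional TYPE('g)" and "simple_lie_algebra br"
    and "cartan_subalgebra br h" and "positive_roots br h \<Delta>p" and "normalized_form br h \<Delta>p frm"
    and "lam \<in> dual_space h"
    and "\<mu> \<in> dominant_integral h \<Delta>p frm" and "\<mu> \<noteq> 0"
    and "0 \<le> Re a" and "Re a < 1"
    and "verma_module br frm h \<Delta>p lam l k c \<rho>M u"
    and "irreducible_quotient (affvir_bracket br frm) \<rho>M \<rho>L \<pi>"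
    and "fd_irreducible_hw_module br h \<Delta>p \<mu> \<sigma>"
    and "tensor_module_action br frm h \<Delta>p k c \<rho>L (\<pi> u) \<sigma> a b \<tau>"
  shows "iso_complex_algebra (module_End \<tau>)"
proof -
  obtain s \<theta> where frm: "\<And>x y. frm x y = s * killing_form br x y" and "dual_form frm h \<theta> \<theta> = 2"
    using assms(5) unfolding normalized_form_def by blast
  \<comment> \<open>the normalization \<open>(\<theta>|\<theta>) = 2\<close> guarantees a nonzero Killing form\<close>
  then have "killing_form br (riesz_vec frm h \<theta>) (riesz_vec frm h \<theta>) \<noteq> 0"
    unfolding dual_form_def by auto
  then interpret nondegenerate_lie_algebra br
    by (rule simple_nondegenerate[OF assms(1,2)])
  obtain S where S: "root_base br h S" "\<Delta>p = {\<beta> \<in> roots br h. nonneg_comb S \<beta>}"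
    using assms(4) unfolding positive_roots_def by blast
  have "frm = (\<lambda>x y. s *\<^sub>C killing_form br x y)" by (simp add: fun_eq_iff frm scaleC_complex_def)
  then have frm_bil: "cbilinear frm"
    by (auto intro!: cbilinearI clinear_scaled cbilinear_left[OF killing_cbilinear] cbilinear_right[OF killing_cbilinear])
  \<comment> \<open>the nonzero highest weight makes the finite-dimensional module nontrivial\<close>
  obtain x where x: "\<mu> x \<noteq> 0" using assms(8) by (auto simp: fun_eq_iff)
  then have "x \<in> h" using assms(7) unfolding dominant_integral_def dual_space_def by blast
  moreover obtain v where v: "v \<noteq> 0" "\<And>x. x \<in> h \<Longrightarrow> \<sigma> x v = \<mu> x *\<^sub>C v"
    using assms(13) unfolding fd_irreducible_hw_module_def by blast
  ultimately have "\<sigma> x v \<noteq> 0" using x by simp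
  then interpret nontrivial_irreducible_module br \<sigma>
    using assms(13) by unfold_locales (auto simp: fd_irreducible_hw_module_def)
  interpret cartan_setting br h S \<Delta>p
    by unfold_locales (rule assms(3) S)+
  have irr: "irreducible_module (affvir_bracket br frm) \<rho>L" using assms(12) by (simp add: irreducible_quotient_def)
  interpret tensor_module br h S \<Delta>p frm lam l k c \<rho>L "\<pi> u" \<sigma> a b \<tau>
    by unfold_locales
      (rule frm_bil irr assms(14) irreducible_quotient_highest_weight[OF assms(11,12)]; assumption?)+
  show ?thesis by (rule module_End_iso_complex)
qed

end
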